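(* Let $\gamma>0$ and $1<p,q<\infty$. (i) If $\{f_n\}$ is a sequence of polynomials such that $\lim_{n\to\infty}f_n=f$ in $L^p_\gamma([-1,1]^d,\mu^d_{\alpha,\beta})$, then $\lim_{n\to\infty}D_\gamma^{\alpha,\beta}f_n\in L^p([-1,1]^d,\mu^d_{\alpha,\beta})$ (the limit exists in $L^p([-1,1]^d,\mu^d_{\alpha,\beta})$), and the limit does not depend on the choice of the sequence $\{f_n\}$. If $f\in L^p_\gamma([-1,1]^d,\mu^d_{\alpha,\beta})\cap L^q_\gamma([-1,1]^d,\mu^d_{\alpha,\beta})$, then the limit does not depend on the choice of $p$ or $q$. Thus $D_\gamma^{\alpha,\beta}$ is well defined on $L_\gamma([-1,1]^d,\mu^d_{\alpha,\beta})$ by $D_\gamma^{\alpha,\beta}f=\lim_{n\to\infty}D_\gamma^{\alpha,\beta}f_n$. (ii) For $f\in L_\gamma([-1,1]^d,\mu^d_{\alpha,\beta})$: $f\in L^p_\gamma([-1,1]^d,\mu^d_{\alpha,\beta})$ if and only if $D_\gamma^{\alpha,\beta}f\in L^p([-1,1]^d,\mu^d_{\alpha,\beta})$. Moreover, there exist positive constants $A_{p,\gamma}$ and $B_{p,\gamma}$ such that, for all $f\in L^p_\gamma([-1,1]^d,\mu^d_{\alpha,\beta})$, $$B_{p,\gamma}\|f\|_{p,\gamma}\le\|D_\gamma^{\alpha,\beta}f\|_p\le A_{p,\gamma}\|f\|_{p,\gamma}.$$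
   Context: $\mathbb{N}=\{0,1,2,\dots\}$. Fix $d\ge 1$ and $\alpha=(\alpha_1,\dots,\alpha_d),\ \beta=(\beta_1,\dots,\beta_d)\in\mathbb{R}^d$ with $\alpha_i,\beta_i>-\frac12$ for all $i$. The normalized Jacobi measure on $[-1,1]^d$ is the probability measure $\mu^d_{\alpha,\beta}(dx)=\prod_{i=1}^d \frac{1}{2^{\alpha_i+\beta_i+1}B(\alpha_i+1,\beta_i+1)}(1-x_i)^{\alpha_i}(1+x_i)^{\beta_i}dx_i$, where $B$ is the Beta function. $\|\cdot\|_p$ is the norm of $L^p([-1,1]^d,\mu^d_{\alpha,\beta})$, and $\mathcal{P}$ is the set of polynomials in $d$ variables. For $n\in\mathbb{N}$ and real $a,b>-1$, $p_n^{a,b}$ is the one-dimensional Jacobi polynomial of degree $n$, given by Rodrigues' formula $(1-x)^a(1+x)^b c_n p_n^{a,b}(x)=\frac{(-1)^n}{2^n n!}\frac{d^n}{dx^n}\{(1-x)^{a+n}(1+x)^{b+n}\}$, with constant $c_n>0$ chosen so that $p_n^{a,b}$ has $L^2$ norm $1$ with respect to the one-dimensional normalized Jacobi measure. For $\kappa=(\kappa_1,\dots,\kappa_d)\in\mathbb{N}^d$ put $\vec p_\kappa^{\,\alpha,\beta}(x)=\prod_{i=1}^d p_{\kappa_i}^{\alpha_i,\beta_i}(x_i)$; these form an orthonormal basis of $L^2([-1,1]^d,\mu^d_{\alpha,\beta})$. Put $\lambda_\kappa=\sum_{i=1}^d\kappa_i(\kappa_i+\alpha_i+\beta_i+1)$.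 The set $\{\lambda_\kappa:\kappa\in\mathbb{N}^d\}$ is written in increasing order as $\{r_n\}_{n=0}^\infty$, $0=r_0<r_1<r_2<\cdots$, and $A_n^{\alpha,\beta}=\{\kappa\in\mathbb{N}^d:\lambda_\kappa=r_n\}$. $J_n^{\alpha,\beta}$ is the orthogonal projection of $L^2([-1,1]^d,\mu^d_{\alpha,\beta})$ onto the span of $\{\vec p_\kappa^{\,\alpha,\beta}:\kappa\in A_n^{\alpha,\beta}\}$, i.e. $J_n^{\alpha,\beta}f=\sum_{\kappa\in A_n^{\alpha,\beta}}\hat f(\kappa)\,\vec p_\kappa^{\,\alpha,\beta}$ with $\hat f(\kappa)=\int_{[-1,1]^d} f\,\vec p_\kappa^{\,\alpha,\beta}\,d\mu^d_{\alpha,\beta}$. The Jacobi operator is $\mathcal{L}^{\alpha,\beta}=\sum_{i=1}^d\big[(1-x_i^2)\frac{\partial^2}{\partial x_i^2}+(\beta_i-\alpha_i-(\alpha_i+\beta_i+2)x_i)\frac{\partial}{\partial x_i}\big]$, with $\mathcal{L}^{\alpha,\beta}\vec p_\kappa^{\,\alpha,\beta}=-\lambda_\kappa\vec p_\kappa^{\,\alpha,\beta}$. For $\gamma>0$ the fractional derivative $D_\gamma^{\alpha,\beta}=(-\mathcal{L}^{\alpha,\beta})^{\gamma/2}$ acts on polynomials by $D_\gamma^{\alpha,\beta}f=\sum_n r_n^{\gamma/2}J_n^{\alpha,\beta}f$, and $(I-\mathcal{L}^{\alpha,\beta})^{\gamma/2}f=\sum_n(1+r_n)^{\gamma/2}J_n^{\alpha,\beta}f$.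 The Bessel potential $\mathcal{J}_\gamma^{\alpha,\beta}$, given on polynomials by $\sum_n(1+r_n)^{-\gamma/2}J_n^{\alpha,\beta}f$, extends continuously to $L^p([-1,1]^d,\mu^d_{\alpha,\beta})$, $1<p<\infty$. For $1<p<\infty$ and $\gamma>0$, the Jacobi Sobolev space $L^p_\gamma([-1,1]^d,\mu^d_{\alpha,\beta})$ is the completion of $\mathcal{P}$ with respect to the norm $\|f\|_{p,\gamma}=\|(I-\mathcal{L}^{\alpha,\beta})^{\gamma/2}f\|_p$; equivalently it is the image $\mathcal{J}_\gamma^{\alpha,\beta}L^p([-1,1]^d,\mu^d_{\alpha,\beta})\subseteq L^p([-1,1]^d,\mu^d_{\alpha,\beta})$, with $\|\mathcal{J}_\gamma^{\alpha,\beta}g\|_{p,\gamma}=\|g\|_p$. Put $L_\gamma([-1,1]^d,\mu^d_{\alpha,\beta})=\bigcup_{p>1}L^p_\gamma([-1,1]^d,\mu^d_{\alpha,\beta})$. For $f\in L_\gamma$, choose $p>1$ with $f\in L^p_\gamma$ and polynomials $f_n\to f$ in $L^p_\gamma$; $D_\gamma^{\alpha,\beta}f$ is defined as $\lim_n D_\gamma^{\alpha,\beta}f_n$ in $L^p$.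
   Formalization: The lower bound B‖f‖_{p,γ} ≤ ‖D_γ f‖_p is asserted only for f in L^p_γ with ∫f dμ = 0, since it fails for f = 1 (D_γ 1 = 0 but ‖1‖_{p,γ} = 1); the upper bound holds for all f in L^p_γ. *)

theory Defs
  imports "HOL-Analysis.Analysis" "HOL-Computational_Algebra.Polynomial"
begin

text \<open>
  Elements of \<open>L\<^sup>p\<close> are represented by measurable functions; equality in \<open>L\<^sup>p\<close> is equality
  almost everywhere. The exponent is a real number \<open>p > 1\<close> throughout.
\<close>

definition Lp_space :: "'a measure \<Rightarrow> real \<Rightarrow> ('a \<Rightarrow> real) set" where
  "Lp_space M p = {f \<in> borel_measurable M. integrable M (\<lambda>x. \<bar>f x\<bar> powr p)}"

definition Lp_norm :: "'a measure \<Rightarrow> real \<Rightarrow> ('a \<Rightarrow> real) \<Rightarrow> real" where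
  "Lp_norm M p f = (\<integral>x. \<bar>f x\<bar> powr p \<partial>M) powr (1 / p)"

definition Lp_tendsto :: "'a measure \<Rightarrow> real \<Rightarrow> (nat \<Rightarrow> 'a \<Rightarrow> real) \<Rightarrow> ('a \<Rightarrow> real) \<Rightarrow> bool" where
  "Lp_tendsto M p F f \<longleftrightarrow> f \<in> Lp_space M p \<and> (\<forall>k. F k \<in> Lp_space M p) \<and>
     (\<lambda>k. Lp_norm M p (\<lambda>x. F k x - f x)) \<longlonglongrightarrow> 0"

text \<open>The measure lives on the whole line (or on \<open>real^'n\<close>), with density zero off the cube.\<close>

definition jacobi_density1 :: "real \<Rightarrow> real \<Rightarrow> real \<Rightarrow> real" where
  "jacobi_density1 a b t =
     indicator {-1..1} t * ((1 - t) powr a * (1 + t) powr b) /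
       (2 powr (a + b + 1) * Beta (a + 1) (b + 1))"

definition jacobi_measure1 :: "real \<Rightarrow> real \<Rightarrow> real measure" where
  "jacobi_measure1 a b = density lborel (\<lambda>t. ennreal (jacobi_density1 a b t))"

definition jacobi_measure :: "real^'n \<Rightarrow> real^'n \<Rightarrow> (real^'n) measure" where
  "jacobi_measure \<alpha> \<beta> =
     density lborel (\<lambda>x. ennreal (\<Prod>i\<in>UNIV. jacobi_density1 (\<alpha> $ i) (\<beta> $ i) (x $ i)))"

text \<open>
  Rodrigues' formula is imposed on the open interval only, where the real powers are smooth;
  it determines the polynomial up to the positive factor \<open>c\<close>, which the normalization fixes.
\<close>

definition jacobi_poly :: "real \<Rightarrow> real \<Rightarrow> nat \<Rightarrow> real poly" where
  "jacobi_poly a b n = (THE p. \<exists>c>0.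
     (\<forall>x\<in>{-1<..<1}. (1 - x) powr a * (1 + x) powr b * c * poly p x =
        (-1) ^ n / (2 ^ n * fact n) *
        (deriv ^^ n) (\<lambda>t. (1 - t) powr (a + real n) * (1 + t) powr (b + real n)) x) \<and>
     (\<integral>x. (poly p x)\<^sup>2 \<partial>jacobi_measure1 a b) = 1)"

definition jacobi_polyvec :: "real^'n \<Rightarrow> real^'n \<Rightarrow> nat^'n \<Rightarrow> real^'n \<Rightarrow> real" where
  "jacobi_polyvec \<alpha> \<beta> \<kappa> x = (\<Prod>i\<in>UNIV. poly (jacobi_poly (\<alpha> $ i) (\<beta> $ i) (\<kappa> $ i)) (x $ i))"

definition jacobi_eigenvalue :: "real^'n \<Rightarrow> real^'n \<Rightarrow> nat^'n \<Rightarrow> real" where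
  "jacobi_eigenvalue \<alpha> \<beta> \<kappa> =
     (\<Sum>i\<in>UNIV. real (\<kappa> $ i) * (real (\<kappa> $ i) + \<alpha> $ i + \<beta> $ i + 1))"

definition jacobi_level :: "real^'n \<Rightarrow> real^'n \<Rightarrow> nat \<Rightarrow> real" where
  "jacobi_level \<alpha> \<beta> = (THE r. strict_mono r \<and> range r = range (jacobi_eigenvalue \<alpha> \<beta>))"

definition jacobi_index :: "real^'n \<Rightarrow> real^'n \<Rightarrow> nat \<Rightarrow> (nat^'n) set" where
  "jacobi_index \<alpha> \<beta> n = {\<kappa>. jacobi_eigenvalue \<alpha> \<beta> \<kappa> = jacobi_level \<alpha> \<beta> n}"

definition jacobi_coeff :: "real^'n \<Rightarrow> real^'n \<Rightarrow> (real^'n \<Rightarrow> real) \<Rightarrow> nat^'n \<Rightarrow> real" where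
  "jacobi_coeff \<alpha> \<beta> f \<kappa> = (\<integral>x. f x * jacobi_polyvec \<alpha> \<beta> \<kappa> x \<partial>jacobi_measure \<alpha> \<beta>)"

definition jacobi_proj ::
    "real^'n \<Rightarrow> real^'n \<Rightarrow> nat \<Rightarrow> (real^'n \<Rightarrow> real) \<Rightarrow> real^'n \<Rightarrow> real" where
  "jacobi_proj \<alpha> \<beta> n f x =
     (\<Sum>\<kappa>\<in>jacobi_index \<alpha> \<beta> n. jacobi_coeff \<alpha> \<beta> f \<kappa> * jacobi_polyvec \<alpha> \<beta> \<kappa> x)"

text \<open>
  The next two operators are meant for polynomial arguments only, for which just finitely many
  terms of the series are nonzero. For \<open>\<gamma> > 0\<close> the level \<open>r\<^sub>0 = 0\<close> contributes
  \<open>0 powr (\<gamma> / 2) = 0\<close> to the first one.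
\<close>

definition jacobi_frac_deriv_poly ::
    "real^'n \<Rightarrow> real^'n \<Rightarrow> real \<Rightarrow> (real^'n \<Rightarrow> real) \<Rightarrow> real^'n \<Rightarrow> real" where
  "jacobi_frac_deriv_poly \<alpha> \<beta> \<gamma> f x =
     (\<Sum>n. jacobi_level \<alpha> \<beta> n powr (\<gamma> / 2) * jacobi_proj \<alpha> \<beta> n f x)"

definition jacobi_bessel_inv_poly ::
    "real^'n \<Rightarrow> real^'n \<Rightarrow> real \<Rightarrow> (real^'n \<Rightarrow> real) \<Rightarrow> real^'n \<Rightarrow> real" where
  "jacobi_bessel_inv_poly \<alpha> \<beta> \<gamma> f x =
     (\<Sum>n. (1 + jacobi_level \<alpha> \<beta> n) powr (\<gamma> / 2) * jacobi_proj \<alpha> \<beta> n f x)"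

definition jacobi_sobolev_norm_poly ::
    "real^'n \<Rightarrow> real^'n \<Rightarrow> real \<Rightarrow> real \<Rightarrow> (real^'n \<Rightarrow> real) \<Rightarrow> real" where
  "jacobi_sobolev_norm_poly \<alpha> \<beta> p \<gamma> f =
     Lp_norm (jacobi_measure \<alpha> \<beta>) p (jacobi_bessel_inv_poly \<alpha> \<beta> \<gamma> f)"

text \<open>
  The completion of the polynomials is realized inside \<open>L\<^sup>p\<close>: the class of a Cauchy sequence of
  polynomials is identified with its limit in \<open>L\<^sup>p\<close>. (The sequence \<open>Q k\<close> of polynomials
  \<open>(I - \<L>)\<close> to the power \<open>\<gamma> / 2\<close> applied to \<open>P k\<close> is then Cauchy in \<open>L\<^sup>p\<close>, and \<open>f\<close> is the
  Bessel potential of its limit \<open>g\<close>; so this is the image of the Bessel potential, and the norm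
  below is the \<open>L\<^sup>p\<close> norm of \<open>g\<close>.)
\<close>

definition jacobi_sobolev_approx ::
    "real^'n \<Rightarrow> real^'n \<Rightarrow> real \<Rightarrow> real \<Rightarrow> (nat \<Rightarrow> real^'n \<Rightarrow> real) \<Rightarrow> (real^'n \<Rightarrow> real) \<Rightarrow> bool" where
  "jacobi_sobolev_approx \<alpha> \<beta> p \<gamma> P f \<longleftrightarrow>
     (\<forall>k. real_polynomial_function (P k)) \<and>
     (\<forall>e>0. \<exists>N. \<forall>m\<ge>N. \<forall>n\<ge>N. jacobi_sobolev_norm_poly \<alpha> \<beta> p \<gamma> (\<lambda>x. P m x - P n x) < e) \<and>
     Lp_tendsto (jacobi_measure \<alpha> \<beta>) p P f"

definition jacobi_sobolev ::
    "real^'n \<Rightarrow> real^'n \<Rightarrow> real \<Rightarrow> real \<Rightarrow> (real^'n \<Rightarrow> real) set" where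
  "jacobi_sobolev \<alpha> \<beta> p \<gamma> = {f. \<exists>P. jacobi_sobolev_approx \<alpha> \<beta> p \<gamma> P f}"

definition jacobi_sobolev_norm ::
    "real^'n \<Rightarrow> real^'n \<Rightarrow> real \<Rightarrow> real \<Rightarrow> (real^'n \<Rightarrow> real) \<Rightarrow> real" where
  "jacobi_sobolev_norm \<alpha> \<beta> p \<gamma> f =
     (THE l. \<exists>P. jacobi_sobolev_approx \<alpha> \<beta> p \<gamma> P f \<and>
        (\<lambda>k. jacobi_sobolev_norm_poly \<alpha> \<beta> p \<gamma> (P k)) \<longlonglongrightarrow> l)"

definition jacobi_sobolev_tendsto ::
    "real^'n \<Rightarrow> real^'n \<Rightarrow> real \<Rightarrow> real \<Rightarrow> (nat \<Rightarrow> real^'n \<Rightarrow> real) \<Rightarrow> (real^'n \<Rightarrow> real) \<Rightarrow> bool" where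
  "jacobi_sobolev_tendsto \<alpha> \<beta> p \<gamma> F f \<longleftrightarrow>
     f \<in> jacobi_sobolev \<alpha> \<beta> p \<gamma> \<and> (\<forall>k. F k \<in> jacobi_sobolev \<alpha> \<beta> p \<gamma>) \<and>
     (\<lambda>k. jacobi_sobolev_norm \<alpha> \<beta> p \<gamma> (\<lambda>x. F k x - f x)) \<longlonglongrightarrow> 0"

definition jacobi_sobolev_union ::
    "real^'n \<Rightarrow> real^'n \<Rightarrow> real \<Rightarrow> (real^'n \<Rightarrow> real) set" where
  "jacobi_sobolev_union \<alpha> \<beta> \<gamma> = (\<Union>p\<in>{1<..}. jacobi_sobolev \<alpha> \<beta> p \<gamma>)"

text \<open>
  \<open>g\<close> is a value of the fractional derivative at \<open>f\<close> obtained from some admissible choice of the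
  exponent and of the approximating polynomials; the operator picks such a value.
\<close>

definition is_jacobi_frac_deriv ::
    "real^'n \<Rightarrow> real^'n \<Rightarrow> real \<Rightarrow> (real^'n \<Rightarrow> real) \<Rightarrow> (real^'n \<Rightarrow> real) \<Rightarrow> bool" where
  "is_jacobi_frac_deriv \<alpha> \<beta> \<gamma> f g \<longleftrightarrow>
     (\<exists>p>1. \<exists>P. (\<forall>k. real_polynomial_function (P k)) \<and> jacobi_sobolev_tendsto \<alpha> \<beta> p \<gamma> P f \<and>
        Lp_tendsto (jacobi_measure \<alpha> \<beta>) p (\<lambda>k. jacobi_frac_deriv_poly \<alpha> \<beta> \<gamma> (P k)) g)"

definition jacobi_frac_deriv ::
    "real^'n \<Rightarrow> real^'n \<Rightarrow> real \<Rightarrow> (real^'n \<Rightarrow> real) \<Rightarrow> real^'n \<Rightarrow> real" where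
  "jacobi_frac_deriv \<alpha> \<beta> \<gamma> f = (SOME g. is_jacobi_frac_deriv \<alpha> \<beta> \<gamma> f g)"

end

theory Submission
  imports Defs "HOL-Probability.Probability_Measure"
begin

text \<open>
  On the basis function with index \<open>\<kappa>\<close>, the operators \<open>D\<^sub>\<gamma>\<close> and \<open>(I - \<L>)\<close> to the power \<open>\<gamma> / 2\<close> act
  by the numbers \<open>\<lambda> powr (\<gamma> / 2)\<close> and \<open>(1 + \<lambda>) powr (\<gamma> / 2)\<close>, where \<open>\<lambda>\<close> is the eigenvalue. So each is
  obtained from the other by the spectral multiplier \<open>(\<lambda> / (1 + \<lambda>)) powr (\<plusminus> \<gamma> / 2)\<close>, at least on functions of
  mean zero, and everything rests on three multipliers being bounded on \<open>L\<^sup>p\<close> for all \<open>p > 1\<close>: these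
  two, and the Bessel potential \<open>(1 + \<lambda>) powr (- \<gamma> / 2)\<close>.

  The boundedness comes from the resolvent \<open>(I - \<epsilon> \<L>)\<close> to the power \<open>- 1\<close> alone, whose \<open>L\<^sup>p\<close> norm on functions
  of mean zero is smaller than \<open>1\<close>. To see this, \<open>u - \<epsilon> \<L> u\<close> is tested against \<open>sgn u * \<bar>u\<bar> powr (p - 1)\<close>. Integration
  by parts turns the part with \<open>\<L>\<close> into an energy, and the Poincare inequality, applied to
  \<open>sgn u * \<bar>u\<bar> powr (p / 2)\<close>, bounds the integral of \<open>\<bar>u\<bar> powr p\<close> by a multiple of this energy; it is available
  because all nonzero eigenvalues are at least \<open>1\<close> (lemmas \<open>integral_powr_le_energy\<close>, \<open>resolvent_gap\<close>; here \<open>p \<ge> 2\<close>). With \<open>x = 1 / (1 + \<lambda>)\<close> one has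
  \<open>\<lambda> / (1 + \<lambda>) = 1 - x\<close>, so every real power of it is a binomial series in the resolvent, which
  converges in operator norm on functions of mean zero (\<open>ratio_mult_bounded\<close>). The Bessel potential
  is a limit of similar series with nonnegative coefficients, whose sum is \<open>1\<close>
  (\<open>bessel_mult_bounded\<close>). The exponents below \<open>2\<close> follow by duality (\<open>multiplier_bounded_dual\<close>).

  The passage from polynomials to Sobolev spaces uses that a function in \<open>L\<^sup>p\<close>, \<open>p > 1\<close>, is determined
  almost everywhere by its Jacobi coefficients (\<open>coef_eq_imp_AE_eq\<close>), which rests on the density of
  the polynomials. So \<open>f\<close> lies in the Sobolev space iff the coefficients of \<open>f\<close>, multiplied by
  \<open>(1 + \<lambda>) powr (\<gamma> / 2)\<close>, are those of some \<open>w \<in> L\<^sup>p\<close>, and the Sobolev norm of \<open>f\<close> is the norm of \<open>w\<close>; and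
  \<open>D\<^sub>\<gamma> f\<close> is the function with coefficients multiplied by \<open>\<lambda> powr (\<gamma> / 2)\<close>. Neither description refers to
  a sequence, and the second one not even to the exponent, which gives the independence claims.
  Bounded multipliers, extended to all of \<open>L\<^sup>p\<close>, give the rest.
\<close>

section \<open>The spaces \<open>L\<^sup>p\<close> over a measure space\<close>

text \<open>
  In Minkowski's inequality the functions may vanish, so the endpoint \<open>0\<close> has to be included.
\<close>

lemma powr_convex_nonneg:
  fixes x y u v p :: real
  assumes "1 \<le> p" "0 \<le> x" "0 \<le> y" "0 \<le> u" "0 \<le> v" "u + v = 1"
  shows "(u * x + v * y) powr p \<le> u * x powr p + v * y powr p"
proof -
  have shrink: "(w * z) powr p \<le> w * z powr p" if "0 \<le> w" "w \<le> 1" "0 \<le> z" for w z :: real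
  proof -
    have "w powr p \<le> w powr 1"
    proof (cases "w = 0")
      case False
      then show ?thesis using that assms(1) by (intro powr_mono') auto
    qed (use assms in auto)
    then show ?thesis
      using that by (simp add: powr_mult mult_right_mono)
  qed
  consider "x = 0" | "y = 0" | "0 < x" "0 < y"
    using assms by fastforce
  then show ?thesis
  proof cases
    case 3
    then show ?thesis
      using powr_convex[OF assms(1)] assms(4-6) unfolding convex_on_def by auto
  qed (use shrink[of v y] shrink[of u x] assms in auto)
qed

lemma abs_add_powr_le:
  fixes a b p :: real
  assumes "1 \<le> p"
  shows "\<bar>a + b\<bar> powr p \<le> 2 powr p * (\<bar>a\<bar> powr p + \<bar>b\<bar> powr p)"
proof -
  have "\<bar>a + b\<bar> powr p \<le> (2 * max \<bar>a\<bar> \<bar>b\<bar>) powr p"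
    using assms by (intro powr_mono2) auto
  also have "\<dots> = 2 powr p * max \<bar>a\<bar> \<bar>b\<bar> powr p"
    by (simp add: powr_mult)
  also have "\<dots> \<le> 2 powr p * (\<bar>a\<bar> powr p + \<bar>b\<bar> powr p)"
    by (intro mult_left_mono) (auto simp: max_def)
  finally show ?thesis .
qed

lemma le_mult_of_forall_add_eps:
  fixes X a b :: real
  assumes "\<And>e. 0 < e \<Longrightarrow> X \<le> (a + e) * (b + e)"
  shows "X \<le> a * b"
proof (rule tendsto_le)
  show "((\<lambda>e. (a + e) * (b + e)) \<longlongrightarrow> a * b) (at_right 0)"
    by (auto intro!: tendsto_eq_intros)
  show "\<forall>\<^sub>F e in at_right 0. X \<le> (a + e) * (b + e)"
    using assms by (auto intro: eventually_at_right_less simp: eventually_at_right_field intro!: exI[of _ 1])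
qed auto

lemma Lp_space_integrable: "f \<in> Lp_space M p \<Longrightarrow> integrable M (\<lambda>x. \<bar>f x\<bar> powr p)"
  by (simp add: Lp_space_def)

lemma Lp_norm_nonneg [simp]: "0 \<le> Lp_norm M p f"
  by (simp add: Lp_norm_def)

lemma Lp_norm_powr: "p \<noteq> 0 \<Longrightarrow> Lp_norm M p f powr p = (\<integral>x. \<bar>f x\<bar> powr p \<partial>M)"
  by (simp add: Lp_norm_def powr_powr)

lemma Lp_norm_abs [simp]: "Lp_norm M p (\<lambda>x. \<bar>f x\<bar>) = Lp_norm M p f"
  by (simp add: Lp_norm_def)

lemma Lp_norm_minus_commute: "Lp_norm M p (\<lambda>x. f x - g x) = Lp_norm M p (\<lambda>x. g x - f x)"
  by (simp add: Lp_norm_def abs_minus_commute)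

lemma Lp_norm_cong_AE:
  assumes "f \<in> borel_measurable M" "g \<in> borel_measurable M" "AE x in M. f x = g x"
  shows "Lp_norm M p f = Lp_norm M p g"
  unfolding Lp_norm_def
  by (subst integral_cong_AE[of _ _ "\<lambda>x. \<bar>g x\<bar> powr p"]) (use assms in auto)

lemma Lp_space_cong_AE:
  assumes "f \<in> Lp_space M p" "g \<in> borel_measurable M" "AE x in M. f x = g x"
  shows "g \<in> Lp_space M p"
proof -
  have "f \<in> borel_measurable M" "integrable M (\<lambda>x. \<bar>f x\<bar> powr p)"
    using assms by (auto simp: Lp_space_def)
  then have "integrable M (\<lambda>x. \<bar>g x\<bar> powr p)"
    using assms by (subst integrable_cong_AE[of _ _ "\<lambda>x. \<bar>f x\<bar> powr p"]) auto
  then show ?thesis using assms by (simp add: Lp_space_def)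
qed

lemma Lp_space_cmult:
  assumes "f \<in> Lp_space M p" shows "(\<lambda>x. c * f x) \<in> Lp_space M p"
  using assms by (auto simp: Lp_space_def abs_mult powr_mult)

lemma Lp_norm_cmult:
  assumes "0 < p" shows "Lp_norm M p (\<lambda>x. c * f x) = \<bar>c\<bar> * Lp_norm M p f"
  using assms by (simp add: Lp_norm_def abs_mult powr_mult powr_powr)

lemma Lp_space_add:
  assumes "1 \<le> p" "f \<in> Lp_space M p" "g \<in> Lp_space M p"
  shows "(\<lambda>x. f x + g x) \<in> Lp_space M p"
proof -
  have [measurable]: "f \<in> borel_measurable M" "g \<in> borel_measurable M"
    using assms by (auto simp: Lp_space_def)
  have "integrable M (\<lambda>x. 2 powr p * (\<bar>f x\<bar> powr p + \<bar>g x\<bar> powr p))"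
    using assms by (auto simp: Lp_space_def)
  then have "integrable M (\<lambda>x. \<bar>f x + g x\<bar> powr p)"
    by (rule Bochner_Integration.integrable_bound) (use abs_add_powr_le[OF assms(1)] in auto)
  then show ?thesis by (simp add: Lp_space_def)
qed

lemma Lp_space_diff:
  assumes "1 \<le> p" "f \<in> Lp_space M p" "g \<in> Lp_space M p"
  shows "(\<lambda>x. f x - g x) \<in> Lp_space M p"
  using Lp_space_add[OF assms(1,2) Lp_space_cmult[OF assms(3), of "-1"]] by simp

lemma Lp_norm_leI:
  assumes "0 < p" "0 \<le> C" "(\<integral>x. \<bar>f x\<bar> powr p \<partial>M) \<le> C powr p"
  shows "Lp_norm M p f \<le> C"
proof -
  have "Lp_norm M p f \<le> (C powr p) powr (1/p)"
    unfolding Lp_norm_def using assms by (intro powr_mono2) auto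
  then show ?thesis using assms by (simp add: powr_powr)
qed

lemma integral_powr_le_of_Lp_norm_le:
  assumes "0 < p" "Lp_norm M p f \<le> C"
  shows "(\<integral>x. \<bar>f x\<bar> powr p \<partial>M) \<le> C powr p"
  using powr_mono2[of p "Lp_norm M p f" C] assms by (simp add: Lp_norm_powr)

lemma integral_scaled_powr_le_1:
  assumes "0 < p" "Lp_norm M p f \<le> A" "0 < A"
  shows "(\<integral>x. \<bar>f x / A\<bar> powr p \<partial>M) \<le> 1"
proof -
  have "(\<integral>x. \<bar>f x / A\<bar> powr p \<partial>M) = (\<integral>x. \<bar>f x\<bar> powr p \<partial>M) / A powr p"
    using assms by (simp add: powr_divide)
  then show ?thesis
    using integral_powr_le_of_Lp_norm_le[OF assms(1,2)] assms(3) by simp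
qed

text \<open>
  For \<open>u = A / (A + B)\<close> and \<open>v = B / (A + B)\<close>, the function \<open>f + g\<close> is \<open>A + B\<close> times the convex
  combination of \<open>f / A\<close> and \<open>g / B\<close> with weights \<open>u\<close> and \<open>v\<close>, and \<open>t powr p\<close> is convex. Taking \<open>A\<close> and \<open>B\<close>
  slightly above the two norms avoids a division by zero.
\<close>

theorem Lp_norm_triangle:
  assumes p: "1 \<le> p" and f: "f \<in> Lp_space M p" and g: "g \<in> Lp_space M p"
  shows "Lp_norm M p (\<lambda>x. f x + g x) \<le> Lp_norm M p f + Lp_norm M p g"
proof -
  have step: "Lp_norm M p (\<lambda>x. f x + g x) \<le> A + B"
    if A: "Lp_norm M p f \<le> A" "0 < A" and B: "Lp_norm M p g \<le> B" "0 < B" for A B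
  proof (rule Lp_norm_leI)
    define u where "u = A / (A + B)"
    define v where "v = B / (A + B)"
    have uv: "0 \<le> u" "0 \<le> v" "u + v = 1"
      using A B by (auto simp: u_def v_def simp flip: add_divide_distrib)
    have int: "integrable M (\<lambda>x. \<bar>f x / A\<bar> powr p)" "integrable M (\<lambda>x. \<bar>g x / B\<bar> powr p)"
      using Lp_space_cmult[OF f, of "1/A"] Lp_space_cmult[OF g, of "1/B"]
      by (auto simp: Lp_space_def)
    have le: "\<bar>f x + g x\<bar> powr p \<le> (A + B) powr p * (u * \<bar>f x / A\<bar> powr p + v * \<bar>g x / B\<bar> powr p)" for x
    proof -
      have "\<bar>f x + g x\<bar> \<le> \<bar>f x\<bar> + \<bar>g x\<bar>" by simp
      also have "\<dots> = (A + B) * (u * \<bar>f x / A\<bar> + v * \<bar>g x / B\<bar>)"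
        using A B by (simp add: u_def v_def distrib_left)
      finally have "\<bar>f x + g x\<bar> powr p \<le> ((A + B) * (u * \<bar>f x / A\<bar> + v * \<bar>g x / B\<bar>)) powr p"
        using p by (intro powr_mono2) auto
      also have "\<dots> = (A + B) powr p * (u * \<bar>f x / A\<bar> + v * \<bar>g x / B\<bar>) powr p"
        using A B by (subst powr_mult) auto
      also have "\<dots> \<le> (A + B) powr p * (u * \<bar>f x / A\<bar> powr p + v * \<bar>g x / B\<bar> powr p)"
        using p uv by (intro mult_left_mono powr_convex_nonneg) auto
      finally show ?thesis .
    qed
    have "(\<integral>x. \<bar>f x + g x\<bar> powr p \<partial>M)
        \<le> (\<integral>x. (A + B) powr p * (u * \<bar>f x / A\<bar> powr p + v * \<bar>g x / B\<bar> powr p) \<partial>M)"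
      using int Lp_space_integrable[OF Lp_space_add[OF p f g]]
      by (intro integral_mono le Bochner_Integration.integrable_mult_right
           Bochner_Integration.integrable_add) auto
    also have "\<dots> = (A + B) powr p * (u * (\<integral>x. \<bar>f x / A\<bar> powr p \<partial>M) + v * (\<integral>x. \<bar>g x / B\<bar> powr p \<partial>M))"
      using int by simp
    also have "\<dots> \<le> (A + B) powr p * (u * 1 + v * 1)"
      using p A B uv by (intro mult_left_mono add_mono integral_scaled_powr_le_1) auto
    finally show "(\<integral>x. \<bar>f x + g x\<bar> powr p \<partial>M) \<le> (A + B) powr p"
      using uv by simp
  qed (use p A B in auto)
  show ?thesis
  proof (rule field_le_epsilon)
    fix e :: real assume "0 < e"
    then have pos: "0 < Lp_norm M p f + e/2" "0 < Lp_norm M p g + e/2"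
      using Lp_norm_nonneg[of M p f] Lp_norm_nonneg[of M p g] by linarith+
    show "Lp_norm M p (\<lambda>x. f x + g x) \<le> Lp_norm M p f + Lp_norm M p g + e"
      using step[of "Lp_norm M p f + e/2" "Lp_norm M p g + e/2"] \<open>0 < e\<close> pos by simp
  qed
qed

lemma Lp_norm_triangle_diff:
  assumes p: "1 \<le> p" and f: "f \<in> Lp_space M p" and g: "g \<in> Lp_space M p"
  shows "Lp_norm M p (\<lambda>x. f x - g x) \<le> Lp_norm M p f + Lp_norm M p g"
  using Lp_norm_triangle[OF p f Lp_space_cmult[OF g, of "-1"]] p Lp_norm_cmult[where c="-1" and M=M and p=p and f=g]
  by simp

lemma Lp_norm_triangle_mid:
  assumes p: "1 \<le> p" and "f \<in> Lp_space M p" "g \<in> Lp_space M p" "h \<in> Lp_space M p"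
  shows "Lp_norm M p (\<lambda>x. f x - h x) \<le> Lp_norm M p (\<lambda>x. f x - g x) + Lp_norm M p (\<lambda>x. g x - h x)"
  using Lp_norm_triangle[OF p, of "\<lambda>x. f x - g x" M "\<lambda>x. g x - h x"] assms
  by (auto intro: Lp_space_diff)

lemma Lp_norm_abs_diff_le:
  assumes p: "1 \<le> p" and f: "f \<in> Lp_space M p" and g: "g \<in> Lp_space M p"
  shows "\<bar>Lp_norm M p f - Lp_norm M p g\<bar> \<le> Lp_norm M p (\<lambda>x. f x - g x)"
proof -
  have "Lp_norm M p f \<le> Lp_norm M p (\<lambda>x. f x - g x) + Lp_norm M p g"
    using Lp_norm_triangle[OF p Lp_space_diff[OF p f g] g] by simp
  moreover have "Lp_norm M p g \<le> Lp_norm M p (\<lambda>x. g x - f x) + Lp_norm M p f"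
    using Lp_norm_triangle[OF p Lp_space_diff[OF p g f] f] by simp
  ultimately show ?thesis by (simp add: Lp_norm_minus_commute[of M p f g])
qed

text \<open>
  Young's inequality for \<open>f / A\<close> and \<open>g / B\<close>, again with \<open>A\<close> and \<open>B\<close> slightly above the norms.
\<close>

theorem Hoelder_inequality:
  assumes p: "1 < p" and q: "1 < q" and pq: "1/p + 1/q = 1"
    and f: "f \<in> Lp_space M p" and g: "g \<in> Lp_space M q"
  shows "integrable M (\<lambda>x. f x * g x)"
    and "\<bar>\<integral>x. f x * g x \<partial>M\<bar> \<le> Lp_norm M p f * Lp_norm M q g"
proof -
  have [measurable]: "f \<in> borel_measurable M" "g \<in> borel_measurable M"
    using f g by (auto simp: Lp_space_def)
  have Young: "\<bar>f x * g x\<bar> \<le> A * B * (\<bar>f x / A\<bar> powr p / p + \<bar>g x / B\<bar> powr q / q)"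
    if "0 < A" "0 < B" for A B :: real and x
  proof -
    have "\<bar>f x * g x\<bar> = A * B * (\<bar>f x / A\<bar> * \<bar>g x / B\<bar>)"
      using that by (simp add: abs_mult)
    also have "\<dots> \<le> A * B * (\<bar>f x / A\<bar> powr p / p + \<bar>g x / B\<bar> powr q / q)"
      using that by (intro mult_left_mono Youngs_inequality p q pq) auto
    finally show ?thesis .
  qed
  have int_f: "integrable M (\<lambda>x. \<bar>f x / A\<bar> powr p / p)" for A :: real
    using Lp_space_cmult[OF f, of "1/A"] by (auto simp: Lp_space_def)
  have int_g: "integrable M (\<lambda>x. \<bar>g x / B\<bar> powr q / q)" for B :: real
    using Lp_space_cmult[OF g, of "1/B"] by (auto simp: Lp_space_def)
  show int_fg: "integrable M (\<lambda>x. f x * g x)"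
    by (rule Bochner_Integration.integrable_bound[where f="\<lambda>x. \<bar>f x / 1\<bar> powr p / p + \<bar>g x / 1\<bar> powr q / q"])
       (use int_f[of 1] int_g[of 1] Young[of 1 1] p q in \<open>auto simp: abs_of_nonneg simp del: div_by_1\<close>)
  show "\<bar>\<integral>x. f x * g x \<partial>M\<bar> \<le> Lp_norm M p f * Lp_norm M q g"
  proof (rule le_mult_of_forall_add_eps)
    fix e :: real assume e: "0 < e"
    define A where "A = Lp_norm M p f + e"
    define B where "B = Lp_norm M q g + e"
    have A: "0 < A" "Lp_norm M p f \<le> A" and B: "0 < B" "Lp_norm M q g \<le> B"
      using e Lp_norm_nonneg[of M p f] Lp_norm_nonneg[of M q g] unfolding A_def B_def by linarith+
    have "\<bar>\<integral>x. f x * g x \<partial>M\<bar> \<le> (\<integral>x. \<bar>f x * g x\<bar> \<partial>M)"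
      using integral_abs_bound by blast
    also have "\<dots> \<le> (\<integral>x. A * B * (\<bar>f x / A\<bar> powr p / p + \<bar>g x / B\<bar> powr q / q) \<partial>M)"
      using int_f[of A] int_g[of B] int_fg A B
      by (intro integral_mono Young Bochner_Integration.integrable_mult_right
           Bochner_Integration.integrable_add) auto
    also have "\<dots> = A * B * ((\<integral>x. \<bar>f x / A\<bar> powr p \<partial>M) / p + (\<integral>x. \<bar>g x / B\<bar> powr q \<partial>M) / q)"
      using int_f[of A] int_g[of B] p q by (simp add: Bochner_Integration.integral_add)
    also have "\<dots> \<le> A * B * (1 / p + 1 / q)"
      using p q A B by (intro mult_left_mono add_mono divide_right_mono integral_scaled_powr_le_1) auto
    finally show "\<bar>\<integral>x. f x * g x \<partial>M\<bar> \<le> (Lp_norm M p f + e) * (Lp_norm M q g + e)"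
      using pq by (simp add: A_def B_def)
  qed
qed

lemma AE_eq_0_of_Lp_norm_eq_0:
  assumes "0 < p" "f \<in> Lp_space M p" "Lp_norm M p f = 0"
  shows "AE x in M. f x = 0"
proof -
  have "(\<integral>x. \<bar>f x\<bar> powr p \<partial>M) = 0"
    using assms Lp_norm_powr[of p M f] by simp
  then have "AE x in M. \<bar>f x\<bar> powr p = 0"
    using assms integral_nonneg_eq_0_iff_AE[of M "\<lambda>x. \<bar>f x\<bar> powr p"] by (simp add: Lp_space_def)
  then show ?thesis by simp
qed

lemma Lp_tendsto_unique:
  assumes p: "1 \<le> p" and "Lp_tendsto M p F f" "Lp_tendsto M p F g"
  shows "AE x in M. f x = g x"
proof -
  have mem: "f \<in> Lp_space M p" "g \<in> Lp_space M p" "\<And>k. F k \<in> Lp_space M p"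
    and lim: "(\<lambda>k. Lp_norm M p (\<lambda>x. F k x - f x)) \<longlonglongrightarrow> 0" "(\<lambda>k. Lp_norm M p (\<lambda>x. F k x - g x)) \<longlonglongrightarrow> 0"
    using assms by (auto simp: Lp_tendsto_def)
  have "Lp_norm M p (\<lambda>x. f x - g x) \<le> 0"
  proof (rule tendsto_lowerbound)
    show "(\<lambda>k. Lp_norm M p (\<lambda>x. F k x - f x) + Lp_norm M p (\<lambda>x. F k x - g x)) \<longlonglongrightarrow> 0"
      using tendsto_add[OF lim] by simp
    show "\<forall>\<^sub>F k in sequentially. Lp_norm M p (\<lambda>x. f x - g x)
        \<le> Lp_norm M p (\<lambda>x. F k x - f x) + Lp_norm M p (\<lambda>x. F k x - g x)"
      using Lp_norm_triangle_mid[OF p mem(1,3,2)] by (simp add: Lp_norm_minus_commute[of M p f])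
  qed auto
  then have "Lp_norm M p (\<lambda>x. f x - g x) = 0" by (simp add: order_antisym)
  from AE_eq_0_of_Lp_norm_eq_0[OF _ Lp_space_diff[OF p mem(1,2)] this] p
  show ?thesis by simp
qed

lemma Lp_tendsto_cong_AE:
  assumes "Lp_tendsto M p F f" "g \<in> borel_measurable M" "AE x in M. f x = g x"
  shows "Lp_tendsto M p F g"
proof -
  have [measurable]: "f \<in> borel_measurable M" "\<And>k. F k \<in> borel_measurable M"
    using assms by (auto simp: Lp_tendsto_def Lp_space_def)
  have "Lp_norm M p (\<lambda>x. F k x - g x) = Lp_norm M p (\<lambda>x. F k x - f x)" for k
    by (rule Lp_norm_cong_AE) (use assms in auto)
  then show ?thesis
    using assms Lp_space_cong_AE[OF _ assms(2,3)] by (simp add: Lp_tendsto_def)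
qed

lemma Lp_tendsto_norm:
  assumes p: "1 \<le> p" and "Lp_tendsto M p F f"
  shows "(\<lambda>k. Lp_norm M p (F k)) \<longlonglongrightarrow> Lp_norm M p f"
proof -
  have mem: "f \<in> Lp_space M p" "\<And>k. F k \<in> Lp_space M p"
    and lim: "(\<lambda>k. Lp_norm M p (\<lambda>x. F k x - f x)) \<longlonglongrightarrow> 0"
    using assms by (auto simp: Lp_tendsto_def)
  have "(\<lambda>k. Lp_norm M p (F k) - Lp_norm M p f) \<longlonglongrightarrow> 0"
    by (rule Lim_null_comparison[OF _ lim])
       (use Lp_norm_abs_diff_le[OF p mem(2) mem(1)] in auto)
  then show ?thesis by (simp add: LIM_zero_iff)
qed

lemma Lp_tendsto_Cauchy:
  assumes p: "1 \<le> p" and F: "Lp_tendsto M p F f" and "0 < e"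
  shows "\<exists>N. \<forall>m\<ge>N. \<forall>n\<ge>N. Lp_norm M p (\<lambda>x. F m x - F n x) < e"
proof -
  have mem: "f \<in> Lp_space M p" "\<And>k. F k \<in> Lp_space M p"
    and lim: "(\<lambda>k. Lp_norm M p (\<lambda>x. F k x - f x)) \<longlonglongrightarrow> 0"
    using assms by (auto simp: Lp_tendsto_def)
  obtain N where N: "\<And>n. n \<ge> N \<Longrightarrow> Lp_norm M p (\<lambda>x. F n x - f x) < e/2"
    using lim \<open>0 < e\<close> unfolding LIMSEQ_def dist_real_def by (metis Lp_norm_nonneg abs_of_nonneg diff_zero half_gt_zero)
  have "Lp_norm M p (\<lambda>x. F m x - F n x) < e" if "m \<ge> N" "n \<ge> N" for m n
    using Lp_norm_triangle_mid[OF p mem(2)[of m] mem(1) mem(2)[of n]] N[OF that(1)] N[OF that(2)]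
    by (simp add: Lp_norm_minus_commute[of M p f])
  then show ?thesis by blast
qed

context prob_space
begin

lemma Lp_space_of_bounded:
  assumes "f \<in> borel_measurable M" "AE x in M. \<bar>f x\<bar> \<le> B" "0 \<le> p"
  shows "f \<in> Lp_space M p"
proof -
  have "integrable M (\<lambda>x. \<bar>f x\<bar> powr p)"
    by (rule integrable_const_bound[where B="B powr p"])
       (use assms in \<open>auto elim!: eventually_mono intro: powr_mono2\<close>)
  then show ?thesis using assms by (simp add: Lp_space_def)
qed

lemma Lp_norm_le_of_bounded:
  assumes "f \<in> borel_measurable M" "AE x in M. \<bar>f x\<bar> \<le> B" "0 < p" "0 \<le> B"
  shows "Lp_norm M p f \<le> B"
proof (rule Lp_norm_leI)
  have "(\<integral>x. \<bar>f x\<bar> powr p \<partial>M) \<le> (\<integral>x. B powr p \<partial>M)"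
    using Lp_space_of_bounded[OF assms(1,2), of p] assms
    by (intro integral_mono_AE) (auto simp: Lp_space_def elim!: eventually_mono intro: powr_mono2)
  then show "(\<integral>x. \<bar>f x\<bar> powr p \<partial>M) \<le> B powr p" by (simp add: prob_space)
qed (use assms in auto)

lemma Lp_space_const: "0 \<le> p \<Longrightarrow> (\<lambda>_. c) \<in> Lp_space M p"
  by (rule Lp_space_of_bounded[where B="\<bar>c\<bar>"]) auto

lemma Lp_norm_const: "0 < p \<Longrightarrow> Lp_norm M p (\<lambda>_. c) = \<bar>c\<bar>"
  by (simp add: Lp_norm_def prob_space powr_powr)

text \<open>
  Hoelder's inequality for \<open>\<bar>f\<bar> powr r\<close> and the constant \<open>1\<close>.
\<close>

lemma Lp_norm_mono_exponent:
  assumes r: "1 \<le> r" and rp: "r \<le> p" and f: "f \<in> Lp_space M p"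
  shows "f \<in> Lp_space M r" and "Lp_norm M r f \<le> Lp_norm M p f"
proof -
  have "f \<in> Lp_space M r \<and> Lp_norm M r f \<le> Lp_norm M p f"
  proof (cases "r = p")
    case False
    then have rp: "r < p" using rp by simp
    define s where "s = p / r"
    define t where "t = s / (s - 1)"
    have s: "1 < s" using rp r by (simp add: s_def)
    have t: "1 < t" "1/s + 1/t = 1" using s by (auto simp: t_def field_simps)
    have [measurable]: "f \<in> borel_measurable M" using f by (simp add: Lp_space_def)
    have rs: "\<bar>\<bar>f x\<bar> powr r\<bar> powr s = \<bar>f x\<bar> powr p" for x
      using r by (simp add: powr_powr s_def)
    have fr: "(\<lambda>x. \<bar>f x\<bar> powr r) \<in> Lp_space M s"
      using f by (simp only: Lp_space_def mem_Collect_eq rs) simp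
    note H = Hoelder_inequality[OF s t(1,2) fr Lp_space_const[of t 1]]
    have "f \<in> Lp_space M r" using H(1) t by (simp add: Lp_space_def)
    moreover have "Lp_norm M r f \<le> Lp_norm M p f"
    proof (rule Lp_norm_leI)
      have "(\<integral>x. \<bar>f x\<bar> powr r \<partial>M) \<le> Lp_norm M s (\<lambda>x. \<bar>f x\<bar> powr r)"
        using H(2) t by (simp add: Lp_norm_const)
      also have "\<dots> = Lp_norm M p f powr r"
        unfolding Lp_norm_def rs using r rp by (simp add: powr_powr s_def)
      finally show "(\<integral>x. \<bar>f x\<bar> powr r \<partial>M) \<le> Lp_norm M p f powr r" .
    qed (use r in auto)
    ultimately show ?thesis by simp
  qed (use f in auto)
  then show "f \<in> Lp_space M r" "Lp_norm M r f \<le> Lp_norm M p f" by auto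
qed

lemma Lp_space_imp_integrable: "1 \<le> p \<Longrightarrow> f \<in> Lp_space M p \<Longrightarrow> integrable M f"
  using Lp_norm_mono_exponent(1)[of 1 p f] by (simp add: Lp_space_def integrable_abs_iff)

lemma abs_integral_le_Lp_norm:
  assumes "1 \<le> p" "f \<in> Lp_space M p"
  shows "\<bar>\<integral>x. f x \<partial>M\<bar> \<le> Lp_norm M p f"
proof -
  have "\<bar>\<integral>x. f x \<partial>M\<bar> \<le> (\<integral>x. \<bar>f x\<bar> \<partial>M)"
    using integral_abs_bound by blast
  also have "\<dots> = Lp_norm M 1 f" by (simp add: Lp_norm_def powr_one' abs_of_nonneg)
  also have "\<dots> \<le> Lp_norm M p f" using Lp_norm_mono_exponent(2)[of 1 p f] assms by simp
  finally show ?thesis .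
qed

lemma Lp_norm_sub_integral_le:
  assumes "1 \<le> p" "f \<in> Lp_space M p"
  shows "Lp_norm M p (\<lambda>x. f x - (\<integral>y. f y \<partial>M)) \<le> 2 * Lp_norm M p f"
  using Lp_norm_triangle_diff[OF assms(1,2) Lp_space_const[of p "\<integral>y. f y \<partial>M"]]
    abs_integral_le_Lp_norm[OF assms] assms(1) by (simp add: Lp_norm_const)

text \<open>
  The \<open>L\<^sup>1\<close> norm is dominated by the \<open>L\<^sup>p\<close> norm, so a subsequence converges almost everywhere. Fatou's
  lemma turns the Cauchy estimate into an estimate for the distance to the pointwise limit.
\<close>

theorem Lp_complete:
  assumes p: "1 \<le> p" and F: "\<And>k. F k \<in> Lp_space M p"
    and Cauchy: "\<And>e. 0 < e \<Longrightarrow> \<exists>N. \<forall>m\<ge>N. \<forall>n\<ge>N. Lp_norm M p (\<lambda>x. F m x - F n x) < e"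
  shows "\<exists>f. Lp_tendsto M p F f"
proof -
  have [measurable]: "F k \<in> borel_measurable M" for k using F by (simp add: Lp_space_def)
  have L1: "(\<integral>x. norm (F m x - F n x) \<partial>M) \<le> Lp_norm M p (\<lambda>x. F m x - F n x)" for m n
    using abs_integral_le_Lp_norm[of p "\<lambda>x. \<bar>F m x - F n x\<bar>"] Lp_space_diff[OF p F[of m] F[of n]] p
    by (auto simp: Lp_space_def)
  obtain r where r: "strict_mono r" and AE_Cauchy: "AE x in M. Cauchy (\<lambda>i. F (r i) x)"
  proof (rule cauchy_L1_AE_cauchy_subseq[of M F])
    show "\<exists>N. \<forall>i\<ge>N. \<forall>j\<ge>N. (\<integral>x. norm (F i x - F j x) \<partial>M) < e" if "0 < e" for e
      using Cauchy[OF that] L1 by (meson le_less_trans)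
  qed (use Lp_space_imp_integrable[OF p F] in auto)
  define f where "f x = lim (\<lambda>i. F (r i) x)" for x
  have [measurable]: "f \<in> borel_measurable M" unfolding f_def by measurable
  have AE_lim: "AE x in M. (\<lambda>i. F (r i) x) \<longlonglongrightarrow> f x"
    using AE_Cauchy by eventually_elim (simp add: f_def convergent_LIMSEQ_iff[symmetric] Cauchy_convergent_iff)
  have key: "(\<lambda>x. F m x - f x) \<in> Lp_space M p \<and> Lp_norm M p (\<lambda>x. F m x - f x) \<le> e"
    if N: "\<And>m n. m \<ge> N \<Longrightarrow> n \<ge> N \<Longrightarrow> Lp_norm M p (\<lambda>x. F m x - F n x) < e" and m: "m \<ge> N" and e: "0 < e"
    for m N e
  proof -
    have "(\<integral>\<^sup>+x. ennreal (\<bar>F m x - f x\<bar> powr p) \<partial>M)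
        = (\<integral>\<^sup>+x. liminf (\<lambda>i. ennreal (\<bar>F m x - F (r i) x\<bar> powr p)) \<partial>M)"
    proof (rule nn_integral_cong_AE)
      show "AE x in M. ennreal (\<bar>F m x - f x\<bar> powr p) = liminf (\<lambda>i. ennreal (\<bar>F m x - F (r i) x\<bar> powr p))"
        using AE_lim
      proof eventually_elim
        case (elim x)
        then have "(\<lambda>i. ennreal (\<bar>F m x - F (r i) x\<bar> powr p)) \<longlonglongrightarrow> ennreal (\<bar>F m x - f x\<bar> powr p)"
          using p by (intro tendsto_ennrealI tendsto_powr2 tendsto_intros) auto
        then show ?case by (metis lim_imp_Liminf trivial_limit_sequentially)
      qed
    qed
    also have "\<dots> \<le> liminf (\<lambda>i. \<integral>\<^sup>+x. ennreal (\<bar>F m x - F (r i) x\<bar> powr p) \<partial>M)"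
      by (rule nn_integral_liminf) auto
    also have "\<dots> \<le> liminf (\<lambda>i. ennreal (e powr p))"
    proof (rule Liminf_mono, unfold eventually_sequentially, intro exI[of _ N] allI impI)
      fix i assume "N \<le> i"
      then have "N \<le> r i" using seq_suble[OF r, of i] by simp
      have "(\<integral>\<^sup>+x. ennreal (\<bar>F m x - F (r i) x\<bar> powr p) \<partial>M) = ennreal (\<integral>x. \<bar>F m x - F (r i) x\<bar> powr p \<partial>M)"
        using Lp_space_diff[OF p F[of m] F[of "r i"]] by (intro nn_integral_eq_integral) (auto simp: Lp_space_def)
      also have "\<dots> \<le> ennreal (e powr p)"
        using N[OF m \<open>N \<le> r i\<close>] p by (intro ennreal_leI integral_powr_le_of_Lp_norm_le) auto
      finally show "(\<integral>\<^sup>+x. ennreal (\<bar>F m x - F (r i) x\<bar> powr p) \<partial>M) \<le> ennreal (e powr p)" .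
    qed
    also have "\<dots> = ennreal (e powr p)" by (simp add: Liminf_const)
    finally have bd: "(\<integral>\<^sup>+x. ennreal (\<bar>F m x - f x\<bar> powr p) \<partial>M) \<le> ennreal (e powr p)" .
    then have int: "integrable M (\<lambda>x. \<bar>F m x - f x\<bar> powr p)"
      by (intro integrableI_nonneg) (auto simp: order_le_less_trans ennreal_less_top)
    have "(\<integral>x. \<bar>F m x - f x\<bar> powr p \<partial>M) \<le> e powr p"
      using bd nn_integral_eq_integral[OF int] by simp
    then show ?thesis using int p e by (auto simp: Lp_space_def intro!: Lp_norm_leI)
  qed
  obtain N1 where "\<And>m n. m \<ge> N1 \<Longrightarrow> n \<ge> N1 \<Longrightarrow> Lp_norm M p (\<lambda>x. F m x - F n x) < 1"
    using Cauchy[of 1] by auto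
  then have "(\<lambda>x. F N1 x - f x) \<in> Lp_space M p" using key[of N1 1 N1] by auto
  then have f: "f \<in> Lp_space M p" using Lp_space_diff[OF p F[of N1]] by fastforce
  have "(\<lambda>k. Lp_norm M p (\<lambda>x. F k x - f x)) \<longlonglongrightarrow> 0"
  proof (rule LIMSEQ_I)
    fix e :: real assume "0 < e"
    then obtain N where N: "\<And>m n. m \<ge> N \<Longrightarrow> n \<ge> N \<Longrightarrow> Lp_norm M p (\<lambda>x. F m x - F n x) < e/2"
      using Cauchy[of "e/2"] by auto
    show "\<exists>N. \<forall>k\<ge>N. norm (Lp_norm M p (\<lambda>x. F k x - f x) - 0) < e"
      using key[of N "e/2"] N \<open>0 < e\<close> by (intro exI[of _ N]) fastforce
  qed
  then show ?thesis using f F by (auto simp: Lp_tendsto_def)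
qed

end

section \<open>Jacobi polynomials in one variable\<close>

text \<open>
  With the weight \<open>w x = (1 - x) powr a * (1 + x) powr b\<close>, this is \<open>q \<mapsto> (w * (1 - x\<^sup>2) * q)' / w\<close>. One derivative
  in Rodrigues' formula amounts to one application, and \<open>raise_poly a b (pderiv q)\<close> is the
  one-dimensional Jacobi operator applied to \<open>q\<close>.
\<close>

definition raise_poly :: "real \<Rightarrow> real \<Rightarrow> real poly \<Rightarrow> real poly" where
  "raise_poly a b q = [:1, 0, -1:] * pderiv q + [:b - a, - (a + b + 2):] * q"

lemma poly_raise_poly:
  "poly (raise_poly a b q) x = (1 - x\<^sup>2) * poly (pderiv q) x + (b - a - (a + b + 2) * x) * poly q x"
  by (simp add: raise_poly_def algebra_simps power2_eq_square)

lemma raise_poly_smult: "raise_poly a b (smult c q) = smult c (raise_poly a b q)"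
  by (simp add: raise_poly_def pderiv_smult smult_add_right)

lemma raise_poly_mult:
  "raise_poly a b (p * q) = raise_poly a b p * q + [:1, 0, -1:] * p * pderiv q"
  by (simp add: raise_poly_def pderiv_mult algebra_simps)

text \<open>
  Because of this commutation relation, \<open>raise_poly a b\<close> maps eigenfunctions for the parameters
  \<open>(a + 1, b + 1)\<close> to eigenfunctions for \<open>(a, b)\<close> and shifts the eigenvalue by \<open>a + b + 2\<close>.
\<close>

lemma pderiv_raise_poly:
  "pderiv (raise_poly a b q) = raise_poly (a + 1) (b + 1) (pderiv q) - smult (a + b + 2) q"
  by (rule poly_ext)
     (simp add: poly_raise_poly raise_poly_def pderiv_mult pderiv_add pderiv_smult pderiv_minus pderiv_pCons
        algebra_simps power2_eq_square)

fun rodrigues_poly :: "real \<Rightarrow> real \<Rightarrow> nat \<Rightarrow> real poly" where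
  "rodrigues_poly a b 0 = 1"
| "rodrigues_poly a b (Suc n) = raise_poly a b (rodrigues_poly (a + 1) (b + 1) n)"

text \<open>
  The shifts \<open>(a + j) + (b + j) + 2\<close> for \<open>j < n\<close> add up to \<open>n * (n + a + b + 1)\<close>.
\<close>

lemma rodrigues_poly_eigen:
  "raise_poly a b (pderiv (rodrigues_poly a b n))
     = smult (- (real n * (real n + a + b + 1))) (rodrigues_poly a b n)"
proof (induction n arbitrary: a b)
  case 0
  then show ?case by (simp add: raise_poly_def)
next
  case (Suc n)
  define r where "r = rodrigues_poly (a + 1) (b + 1) n"
  have "pderiv (raise_poly a b r)
      = smult (- (real n * (real n + (a + 1) + (b + 1) + 1)) - (a + b + 2)) r"
    using Suc.IH[of "a + 1" "b + 1"] by (simp add: pderiv_raise_poly r_def smult_diff_left)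
  also have "- (real n * (real n + (a + 1) + (b + 1) + 1)) - (a + b + 2)
      = - (real (Suc n) * (real (Suc n) + a + b + 1))"
    by (simp add: algebra_simps)
  finally show ?case by (simp only: rodrigues_poly.simps r_def[symmetric] raise_poly_smult)
qed

lemma coeff_raise_poly_top:
  assumes "degree q \<le> n"
  shows "coeff (raise_poly a b q) (Suc n) = - (real n + a + b + 2) * coeff q n"
proof -
  have 0: "coeff q (Suc n) = 0" "coeff q (Suc (Suc n)) = 0"
    using assms by (auto simp: coeff_eq_0)
  show ?thesis
    using 0 by (cases n) (auto simp: raise_poly_def coeff_pCons coeff_pderiv algebra_simps)
qed

lemma degree_raise_poly_le:
  assumes "degree q \<le> n" shows "degree (raise_poly a b q) \<le> Suc n"
proof -
  have "degree ([:1, 0, -1:] * pderiv q) \<le> Suc n"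
  proof (cases "degree q = 0")
    case True
    then have "pderiv q = 0" by (simp add: pderiv_eq_0_iff)
    then show ?thesis by simp
  next
    case False
    have "degree ([:1, 0, -1:] * pderiv q) \<le> 2 + degree (pderiv q)"
      using degree_mult_le[of "[:1, 0, -1:]" "pderiv q"] by simp
    then show ?thesis using False assms by (simp add: degree_pderiv)
  qed
  moreover have "degree ([:b - a, - (a + b + 2):] * q) \<le> Suc n"
    using degree_mult_le[of "[:b - a, - (a + b + 2):]" q] assms
      degree_pCons_le[of "b - a" "[:- (a + b + 2):]"] by simp
  ultimately show ?thesis unfolding raise_poly_def by (rule degree_add_le)
qed

text \<open>
  Each step multiplies the top coefficient by a negative number. So the degree is not smaller than
  expected, and the factor \<open>(-1) ^ n\<close> in Rodrigues' formula makes the leading coefficient positive.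
\<close>

lemma rodrigues_poly_degree_sign:
  assumes "a > -1" "b > -1"
  shows "degree (rodrigues_poly a b n) \<le> n \<and> 0 < (-1) ^ n * coeff (rodrigues_poly a b n) n"
  using assms
proof (induction n arbitrary: a b)
  case (Suc n)
  then have IH: "degree (rodrigues_poly (a + 1) (b + 1) n) \<le> n"
    "0 < (-1) ^ n * coeff (rodrigues_poly (a + 1) (b + 1) n) n"
    using Suc.IH[of "a + 1" "b + 1"] by auto
  have "0 < (real n + a + b + 2) * ((-1) ^ n * coeff (rodrigues_poly (a + 1) (b + 1) n) n)"
    using Suc.prems by (intro mult_pos_pos[OF _ IH(2)]) auto
  then show ?case
    using IH(1) by (simp add: degree_raise_poly_le coeff_raise_poly_top algebra_simps)
qed auto

lemma rodrigues_weight_has_derivative: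
  assumes "x \<in> {-1<..<1}"
  shows "((\<lambda>t. (1 - t) powr (a + 1) * (1 + t) powr (b + 1) * poly q t) has_real_derivative
           (1 - x) powr a * (1 + x) powr b * poly (raise_poly a b q) x) (at x)"
proof -
  have pos: "0 < 1 - x" "0 < 1 + x" using assms by auto
  have *: "(1 - x) powr (a + 1) = (1 - x) powr a * (1 - x)" "(1 + x) powr (b + 1) = (1 + x) powr b * (1 + x)"
    using pos by (simp_all add: powr_add)
  show ?thesis
    using pos
    by (auto intro!: derivative_eq_intros poly_DERIV simp: * poly_raise_poly)
       (simp add: algebra_simps power2_eq_square)
qed

lemma rodrigues_formula:
  assumes "x \<in> {-1<..<1}"
  shows "(deriv ^^ n) (\<lambda>t. (1 - t) powr (a + real n) * (1 + t) powr (b + real n)) x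
           = (1 - x) powr a * (1 + x) powr b * poly (rodrigues_poly a b n) x"
  using assms
proof (induction n arbitrary: a b x)
  case (Suc n)
  let ?w = "\<lambda>t::real. (1 - t) powr (a + real (Suc n)) * (1 + t) powr (b + real (Suc n))"
  let ?h = "\<lambda>t. (1 - t) powr (a + 1) * (1 + t) powr (b + 1) * poly (rodrigues_poly (a + 1) (b + 1) n) t"
  have eq: "(deriv ^^ n) ?w t = ?h t" if "t \<in> {-1<..<1}" for t
    using Suc.IH[OF that, of "a + 1" "b + 1"] by (simp add: algebra_simps)
  have "((deriv ^^ n) ?w has_real_derivative
      (1 - x) powr a * (1 + x) powr b * poly (rodrigues_poly a b (Suc n)) x) (at x)"
    by (rule has_field_derivative_transform_within_open[of ?h _ _ "{-1<..<1}"])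
       (use rodrigues_weight_has_derivative[OF Suc.prems, of a b] Suc.prems eq in auto)
  then show ?case by (simp add: DERIV_imp_deriv)
qed auto

lemma jacobi_density1_nonneg: "a > -1 \<Longrightarrow> b > -1 \<Longrightarrow> 0 \<le> jacobi_density1 a b t"
  by (simp add: jacobi_density1_def Beta_def)

lemma borel_measurable_jacobi_density1 [measurable]: "jacobi_density1 a b \<in> borel_measurable borel"
  unfolding jacobi_density1_def by measurable

lemma sets_jacobi_measure1 [measurable_cong, simp]: "sets (jacobi_measure1 a b) = sets borel"
  by (simp add: jacobi_measure1_def)

text \<open>
  The substitution \<open>x = -1 + 2 * t\<close> leads to Euler's integral for the Beta function.
\<close>

lemma nn_integral_jacobi_density1:
  assumes "a > -1" "b > -1"
  shows "(\<integral>\<^sup>+t. ennreal (jacobi_density1 a b t) \<partial>lborel) = 1"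
proof -
  define Z where "Z = Beta (a + 1) (b + 1)"
  have Z: "0 < Z" using assms by (simp add: Z_def Beta_def)
  have "(\<integral>\<^sup>+t. ennreal (jacobi_density1 a b t) \<partial>lborel)
      = 2 * (\<integral>\<^sup>+t. ennreal (jacobi_density1 a b (-1 + 2 * t)) \<partial>lborel)"
    by (subst nn_integral_real_affine[where c=2 and t="-1"]) auto
  also have "(\<lambda>t. ennreal (jacobi_density1 a b (-1 + 2 * t)))
      = (\<lambda>t. ennreal (indicator {0..1} t * (t powr (b + 1 - 1) * (1 - t) powr (a + 1 - 1) / (2 * Z))))"
  proof (rule ext, rule arg_cong[of _ _ ennreal])
    fix t :: real
    have "(2 - 2 * t) powr a * (2 * t) powr b / (2 powr (a + b + 1) * Z)
        = t powr b * (1 - t) powr a / (2 * Z)" if "t \<in> {0..1}"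
    proof -
      have "(2 - 2 * t) powr a = 2 powr a * (1 - t) powr a"
        using that powr_mult[of 2 "1 - t" a] by (simp add: algebra_simps)
      then show ?thesis using that Z by (simp add: powr_mult powr_add field_simps)
    qed
    then show "jacobi_density1 a b (-1 + 2 * t)
        = indicator {0..1} t * (t powr (b + 1 - 1) * (1 - t) powr (a + 1 - 1) / (2 * Z))"
      by (auto simp: jacobi_density1_def Z_def[symmetric] indicator_def)
  qed
  also have "(\<integral>\<^sup>+t. ennreal (indicator {0..1} t * (t powr (b + 1 - 1) * (1 - t) powr (a + 1 - 1) / (2 * Z))) \<partial>lborel)
      = ennreal (Beta (b + 1) (a + 1) / (2 * Z))"
    by (rule nn_integral_has_integral_lebesgue)
       (use Z assms has_integral_divide[OF has_integral_Beta_real[of "b + 1" "a + 1"]] in auto)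
  also have "Beta (b + 1) (a + 1) / (2 * Z) = 1 / 2"
    using Z by (simp add: Z_def Beta_commute)
  also have "2 * ennreal (1 / 2) = 1"
    by (metis ennreal_1 ennreal_mult' ennreal_numeral mult_2 field_sum_of_halves mult.commute zero_le_numeral mult_1)
  finally show ?thesis .
qed

lemma prob_space_jacobi_measure1:
  assumes "a > -1" "b > -1" shows "prob_space (jacobi_measure1 a b)"
proof
  show "emeasure (jacobi_measure1 a b) (space (jacobi_measure1 a b)) = 1"
    using nn_integral_jacobi_density1[OF assms] by (simp add: jacobi_measure1_def emeasure_density)
qed

lemma AE_jacobi_measure1: "AE x in jacobi_measure1 a b. x \<in> {-1..1}"
  unfolding jacobi_measure1_def
  by (subst AE_density) (auto simp: jacobi_density1_def indicator_def)

lemma poly_bounded_on_interval: "\<exists>B. \<forall>x\<in>{-1..1}. \<bar>poly q x\<bar> \<le> (B::real)"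
proof -
  have "compact (poly q ` {-1..1})" by (intro compact_continuous_image continuous_intros) auto
  then have "bounded (poly q ` {-1..1})" by (rule compact_imp_bounded)
  then show ?thesis unfolding bounded_iff by auto
qed

lemma integrable_poly_jacobi_measure1:
  assumes "a > -1" "b > -1" shows "integrable (jacobi_measure1 a b) (poly q)"
proof -
  interpret prob_space "jacobi_measure1 a b" using assms by (rule prob_space_jacobi_measure1)
  obtain B where B: "\<And>x. x \<in> {-1..1} \<Longrightarrow> \<bar>poly q x\<bar> \<le> B" using poly_bounded_on_interval by blast
  have "AE x in jacobi_measure1 a b. norm (poly q x) \<le> B"
    using AE_jacobi_measure1[of a b] by eventually_elim (use B in simp)
  moreover have "poly q \<in> borel_measurable (jacobi_measure1 a b)"
    by (simp add: jacobi_measure1_def borel_measurable_continuous_onI continuous_on_poly)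
  ultimately show ?thesis by (intro integrable_const_bound[where B=B])
qed

text \<open>
  Up to a constant, the integrand is the derivative of \<open>(1 - x) powr (a + 1) * (1 + x) powr (b + 1) * q x\<close>,
  which vanishes at both endpoints because \<open>a + 1\<close> and \<open>b + 1\<close> are positive. This is the source of all
  integrations by parts below.
\<close>

lemma integral_raise_poly:
  assumes a: "a > -1" and b: "b > -1"
  shows "(\<integral>x. poly (raise_poly a b q) x \<partial>jacobi_measure1 a b) = 0"
proof -
  define Z where "Z = 2 powr (a + b + 1) * Beta (a + 1) (b + 1)"
  have meas: "poly p \<in> borel_measurable borel" for p :: "real poly"
    by (simp add: borel_measurable_continuous_onI continuous_on_poly)
  let ?f = "\<lambda>t. jacobi_density1 a b t * poly (raise_poly a b q) t"
  have int: "integrable lborel ?f"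
    using integrable_poly_jacobi_measure1[OF a b, of "raise_poly a b q"] meas a b
    unfolding jacobi_measure1_def by (subst (asm) integrable_real_density) (auto simp: jacobi_density1_nonneg)
  have "(?f has_integral (\<integral>t. ?f t \<partial>lborel)) UNIV"
    using has_integral_integral_lborel[OF int] .
  moreover have "(?f has_integral 0) UNIV"
  proof -
    let ?H = "\<lambda>t. (1 - t) powr (a + 1) * (1 + t) powr (b + 1) * poly q t"
    let ?h = "\<lambda>t. (1 - t) powr a * (1 + t) powr b * poly (raise_poly a b q) t"
    have "(?h has_integral (?H 1 - ?H (-1))) {-1..1}"
    proof (rule fundamental_theorem_of_calculus_interior)
      show "continuous_on {-1..1} ?H"
        using a b by (intro continuous_on_mult continuous_on_powr' continuous_intros) auto
      show "(?H has_vector_derivative ?h x) (at x)" if "x \<in> {-1<..<1}" for x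
        using rodrigues_weight_has_derivative[OF that] by (simp add: has_real_derivative_iff_has_vector_derivative)
    qed auto
    then have "((\<lambda>t. ?h t / Z) has_integral (0 / Z)) {-1..1}"
      using a b by (intro has_integral_divide) auto
    then have "((\<lambda>t. if t \<in> {-1..1} then ?h t / Z else 0) has_integral 0) UNIV"
      by (subst has_integral_restrict_UNIV) simp
    moreover have "(\<lambda>t. if t \<in> {-1..1} then ?h t / Z else 0) = ?f"
      by (auto simp: jacobi_density1_def Z_def fun_eq_iff)
    ultimately show ?thesis by simp
  qed
  ultimately have "(\<integral>t. ?f t \<partial>lborel) = 0" by (rule has_integral_unique)
  moreover have "(\<integral>x. poly (raise_poly a b q) x \<partial>jacobi_measure1 a b) = (\<integral>t. ?f t \<partial>lborel)"
    unfolding jacobi_measure1_def using meas a b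
    by (subst integral_real_density) (auto simp: jacobi_density1_nonneg)
  ultimately show ?thesis by simp
qed

lemma jacobi_measure1_symmetric:
  assumes "a > -1" "b > -1"
  shows "(\<integral>x. poly (raise_poly a b (pderiv p) * q) x \<partial>jacobi_measure1 a b)
       = (\<integral>x. poly (p * raise_poly a b (pderiv q)) x \<partial>jacobi_measure1 a b)"
proof -
  note int = integrable_poly_jacobi_measure1[OF assms]
  have parts: "(\<integral>x. poly (raise_poly a b (pderiv p) * q) x \<partial>jacobi_measure1 a b)
      = - (\<integral>x. poly ([:1, 0, -1:] * pderiv p * pderiv q) x \<partial>jacobi_measure1 a b)" for p q
  proof -
    have "0 = (\<integral>x. poly (raise_poly a b (pderiv p) * q) x + poly ([:1, 0, -1:] * pderiv p * pderiv q) x \<partial>jacobi_measure1 a b)"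
      using integral_raise_poly[OF assms, of "pderiv p * q"] by (simp only: raise_poly_mult poly_add)
    then show ?thesis by (simp only: Bochner_Integration.integral_add[OF int int])
  qed
  show ?thesis
    using parts[of p q] parts[of q p]
    by (simp only: mult.commute[of p] mult.assoc mult.commute[of "pderiv q" "pderiv p"])
qed

text \<open>
  The density is positive on the open interval, which has positive length, and \<open>q\<close> has only finitely
  many zeros.
\<close>

lemma integral_poly_square_pos:
  assumes a: "a > -1" and b: "b > -1" and q: "q \<noteq> 0"
  shows "0 < (\<integral>x. (poly q x)\<^sup>2 \<partial>jacobi_measure1 a b)"
proof (rule ccontr)
  let ?M = "jacobi_measure1 a b"
  assume "\<not> ?thesis"
  moreover have "0 \<le> (\<integral>x. (poly q x)\<^sup>2 \<partial>?M)" by simp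
  ultimately have "(\<integral>x. (poly q x)\<^sup>2 \<partial>?M) = 0" by linarith
  moreover have "integrable ?M (\<lambda>x. (poly q x)\<^sup>2)"
    using integrable_poly_jacobi_measure1[OF a b, of "q\<^sup>2"] by (simp add: poly_power[abs_def])
  ultimately have "AE x in ?M. poly q x = 0"
    by (simp add: integral_nonneg_eq_0_iff_AE)
  then have "AE x in lborel. 0 < jacobi_density1 a b x \<longrightarrow> poly q x = 0"
    unfolding jacobi_measure1_def by (subst (asm) AE_density) auto
  moreover have "AE x in lborel. x \<notin> {x. poly q x = 0}"
    using poly_roots_finite[OF q] by (intro AE_not_in finite_imp_null_set_lborel)
  ultimately have "AE x in lborel. x \<notin> {-1<..<1::real}"
  proof eventually_elim
    case (elim x)
    have "0 < jacobi_density1 a b x" if "x \<in> {-1<..<1}"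
      using that a b by (simp add: jacobi_density1_def Beta_def)
    then show ?case using elim by auto
  qed
  then have "{-1<..<1::real} \<in> null_sets lborel"
    by (subst AE_iff_null_sets) auto
  then have "emeasure lborel {-1<..<1::real} = 0" by (rule null_setsD1)
  then show False by (subst (asm) emeasure_lborel_Ioo) auto
qed

text \<open>
  Since the weight is nonzero on the open interval, Rodrigues' formula there is an identity between the
  polynomials \<open>c * p\<close> and \<open>K\<close>, the normalized right-hand side; the \<open>L\<^sup>2\<close> condition then forces \<open>c\<close> to be the
  norm of \<open>K\<close>. So the definite description has exactly one solution.
\<close>

lemma jacobi_poly_properties:
  assumes a: "a > -1" and b: "b > -1"
  shows "\<exists>c. c * (-1) ^ n > 0 \<and> jacobi_poly a b n = smult c (rodrigues_poly a b n)
     \<and> (\<integral>x. (poly (jacobi_poly a b n) x)\<^sup>2 \<partial>jacobi_measure1 a b) = 1"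
proof -
  let ?M = "jacobi_measure1 a b"
  define K where "K = smult ((-1) ^ n / (2 ^ n * fact n)) (rodrigues_poly a b n)"
  define N where "N = sqrt (\<integral>x. (poly K x)\<^sup>2 \<partial>?M)"
  have "rodrigues_poly a b n \<noteq> 0"
    using rodrigues_poly_degree_sign[OF a b, of n] by auto
  then have "K \<noteq> 0" by (simp add: K_def)
  then have intpos: "0 < (\<integral>x. (poly K x)\<^sup>2 \<partial>?M)" by (rule integral_poly_square_pos[OF a b])
  then have N: "0 < N" "N\<^sup>2 = (\<integral>x. (poly K x)\<^sup>2 \<partial>?M)" by (auto simp: N_def)
  have norm: "(\<integral>x. (poly (smult s K) x)\<^sup>2 \<partial>?M) = s\<^sup>2 * N\<^sup>2" for s
    by (simp add: power_mult_distrib N)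
  let ?P = "\<lambda>p. \<exists>c>0.
     (\<forall>x\<in>{-1<..<1}. (1 - x) powr a * (1 + x) powr b * c * poly p x =
        (-1) ^ n / (2 ^ n * fact n) *
        (deriv ^^ n) (\<lambda>t. (1 - t) powr (a + real n) * (1 + t) powr (b + real n)) x) \<and>
     (\<integral>x. (poly p x)\<^sup>2 \<partial>?M) = 1"
  have char: "?P p \<longleftrightarrow> (\<exists>c>0. smult c p = K \<and> (\<integral>x. (poly p x)\<^sup>2 \<partial>?M) = 1)" for p
  proof -
    have "(\<forall>x\<in>{-1<..<1}. (1 - x) powr a * (1 + x) powr b * c * poly p x =
        (-1) ^ n / (2 ^ n * fact n) *
        (deriv ^^ n) (\<lambda>t. (1 - t) powr (a + real n) * (1 + t) powr (b + real n)) x)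
      \<longleftrightarrow> smult c p = K" (is "?l \<longleftrightarrow> _") for c
    proof -
      have "?l \<longleftrightarrow> (\<forall>x\<in>{-1<..<1}. poly (smult c p) x = poly K x)"
      proof (rule ball_cong)
        fix x :: real assume x: "x \<in> {-1<..<1}"
        define W where "W = (1 - x) powr a * (1 + x) powr b"
        have "W \<noteq> 0" using x by (auto simp: W_def)
        then have cancel: "W * c * poly p x = k * (W * r) \<longleftrightarrow> c * poly p x = k * r" for k r
          by (auto simp: mult_ac)
        show "(1 - x) powr a * (1 + x) powr b * c * poly p x =
            (-1) ^ n / (2 ^ n * fact n) *
            (deriv ^^ n) (\<lambda>t. (1 - t) powr (a + real n) * (1 + t) powr (b + real n)) x
          \<longleftrightarrow> poly (smult c p) x = poly K x"
          unfolding rodrigues_formula[OF x] W_def[symmetric] cancel by (simp only: K_def poly_smult)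
      qed simp
      also have "\<dots> \<longleftrightarrow> smult c p = K"
      proof
        assume *: "\<forall>x\<in>{-1<..<1}. poly (smult c p) x = poly K x"
        have "infinite {-1<..<1::real}" by (simp add: infinite_Ioo)
        moreover have "{-1<..<1} \<subseteq> {x. poly (smult c p - K) x = 0}" using * by auto
        ultimately have "smult c p - K = 0" using poly_roots_finite finite_subset by blast
        then show "smult c p = K" by simp
      qed simp
      finally show ?thesis .
    qed
    then show ?thesis by presburger
  qed
  have sol: "?P (smult (1/N) K)"
    unfolding char using N norm[of "1/N"] by (intro exI[of _ N]) (auto simp: power_divide simp del: poly_smult)
  have uniq: "p = smult (1/N) K" if P: "?P p" for p
  proof -
    obtain c where c: "c > 0" "smult c p = K" "(\<integral>x. (poly p x)\<^sup>2 \<partial>?M) = 1" using P unfolding char by blast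
    have p: "p = smult (1/c) K" using c by (auto simp flip: c(2))
    have "(1/c)\<^sup>2 * N\<^sup>2 = 1" using norm[of "1/c"] c(3) p by simp
    then have "c\<^sup>2 = N\<^sup>2" using c(1) by (simp add: power_divide)
    then have "c = N" using c(1) N(1) by (simp add: power2_eq_iff)
    then show ?thesis using p by simp
  qed
  have eq: "jacobi_poly a b n = smult (1/N) K"
    unfolding jacobi_poly_def by (rule the_equality) (use sol uniq in blast)+
  show ?thesis
  proof (intro exI[of _ "(1/N) * ((-1) ^ n / (2 ^ n * fact n))"] conjI)
    show "(\<integral>x. (poly (jacobi_poly a b n) x)\<^sup>2 \<partial>?M) = 1"
      unfolding eq using norm[of "1/N"] N intpos by (simp add: power_divide del: poly_smult)
    show "1 / N * ((- 1) ^ n / (2 ^ n * fact n)) * (- 1) ^ n > 0"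
      using N by (simp add: field_simps flip: power_mult_distrib)
  qed (simp add: eq K_def)
qed

lemma jacobi_poly_norm:
  assumes "a > -1" "b > -1"
  shows "(\<integral>x. (poly (jacobi_poly a b n) x)\<^sup>2 \<partial>jacobi_measure1 a b) = 1"
  using jacobi_poly_properties[OF assms] by blast

lemma degree_jacobi_poly:
  assumes "a > -1" "b > -1" shows "degree (jacobi_poly a b n) = n"
proof -
  obtain c where c: "c * (-1) ^ n > 0" "jacobi_poly a b n = smult c (rodrigues_poly a b n)"
    using jacobi_poly_properties[OF assms] by blast
  have "degree (rodrigues_poly a b n) = n"
    using rodrigues_poly_degree_sign[OF assms, of n] by (auto intro!: antisym le_degree)
  then show ?thesis using c by auto
qed

lemma jacobi_poly_0:
  assumes "a > -1" "b > -1" shows "jacobi_poly a b 0 = 1"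
proof -
  interpret prob_space "jacobi_measure1 a b" using assms by (rule prob_space_jacobi_measure1)
  obtain c where c: "c > 0" "jacobi_poly a b 0 = [:c:]"
    using jacobi_poly_properties[OF assms, of 0] by auto
  then have "c\<^sup>2 = 1" using jacobi_poly_norm[OF assms, of 0] by (simp add: prob_space)
  then show ?thesis using c by (simp add: power2_eq_1_iff one_pCons)
qed

lemma jacobi_poly_eigen:
  assumes "a > -1" "b > -1"
  shows "raise_poly a b (pderiv (jacobi_poly a b n))
     = smult (- (real n * (real n + a + b + 1))) (jacobi_poly a b n)"
proof -
  obtain c where "jacobi_poly a b n = smult c (rodrigues_poly a b n)"
    using jacobi_poly_properties[OF assms] by blast
  then show ?thesis
    using rodrigues_poly_eigen[of a b n] by (simp add: pderiv_smult raise_poly_smult mult.commute)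
qed

text \<open>
  The operator is symmetric, and the eigenvalues of different degrees are different.
\<close>

lemma jacobi_poly_orthogonal:
  assumes a: "a > -1" and b: "b > -1" and nm: "n \<noteq> m"
  shows "(\<integral>x. poly (jacobi_poly a b n * jacobi_poly a b m) x \<partial>jacobi_measure1 a b) = 0"
proof -
  define ev where "ev k = real k * (real k + a + b + 1)" for k
  define I where "I = (\<integral>x. poly (jacobi_poly a b n * jacobi_poly a b m) x \<partial>jacobi_measure1 a b)"
  have "- ev n * I = - ev m * I"
    using jacobi_measure1_symmetric[OF a b, of "jacobi_poly a b n" "jacobi_poly a b m"]
    by (simp add: jacobi_poly_eigen[OF a b] I_def ev_def)
  moreover have "ev n \<noteq> ev m"
  proof
    assume "ev n = ev m"
    then have "(real n - real m) * (real n + real m + a + b + 1) = 0"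
      by (simp add: ev_def algebra_simps)
    moreover have "real n + real m \<ge> 1" using nm by (cases n; cases m) auto
    ultimately show False using nm a b by auto
  qed
  ultimately show ?thesis by (auto simp: I_def)
qed

section \<open>The orthonormal basis on the cube\<close>

text \<open>
  Lebesgue measure on \<open>real^'n\<close> is the image of the product measure indexed by the standard basis, and
  \<open>\<lambda>i. axis i 1\<close> identifies the index type with that basis.
\<close>

lemma lborel_vec_prod:
  fixes g :: "'n::finite \<Rightarrow> real \<Rightarrow> real"
  assumes g: "\<And>i. integrable lborel (g i)"
  shows "integrable lborel (\<lambda>x::real^'n. \<Prod>i\<in>UNIV. g i (x $ i))"
    and "(\<integral>x. (\<Prod>i\<in>UNIV. g i (x $ i)) \<partial>(lborel :: (real^'n) measure)) = (\<Prod>i\<in>UNIV. \<integral>t. g i t \<partial>lborel)"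
proof -
  interpret product_sigma_finite "\<lambda>_::real^'n. lborel :: real measure" ..
  let ?B = "Basis :: (real^'n) set"
  let ?P = "\<Pi>\<^sub>M b\<in>?B. (lborel :: real measure)"
  let ?s = "\<lambda>f. \<Sum>b\<in>?B. f b *\<^sub>R b :: real^'n"
  have [measurable]: "g i \<in> borel_measurable borel" for i using g[of i] by simp
  have bij: "bij_betw (\<lambda>i. axis i 1 :: real^'n) UNIV ?B"
    by (auto simp: bij_betw_def inj_on_def axis_eq_axis Basis_vec_def)
  have comp: "?s f $ i = f (axis i 1)" for f i
  proof -
    have "?s f $ i = (\<Sum>j\<in>UNIV. f (axis j 1) * (axis j 1 :: real^'n) $ i)"
      by (simp add: sum.reindex_bij_betw[OF bij, symmetric])
    then show ?thesis by (simp add: axis_def if_distrib cong: if_cong)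
  qed
  have prod_eq: "(\<Prod>i\<in>UNIV. g i (?s f $ i)) = (\<Prod>b\<in>?B. g (axis_index b) (f b))" for f
    unfolding comp by (simp add: prod.reindex_bij_betw[OF bij, symmetric])
  have meas: "?s \<in> measurable ?P borel" by measurable
  have fmeas: "(\<lambda>x::real^'n. \<Prod>i\<in>UNIV. g i (x $ i)) \<in> borel_measurable borel" by measurable
  show "integrable lborel (\<lambda>x::real^'n. \<Prod>i\<in>UNIV. g i (x $ i))"
    unfolding lborel_eq[where 'a="real^'n"] integrable_distr_eq[OF meas fmeas] prod_eq
    by (rule product_integrable_prod) (auto intro: g)
  show "(\<integral>x. (\<Prod>i\<in>UNIV. g i (x $ i)) \<partial>(lborel :: (real^'n) measure)) = (\<Prod>i\<in>UNIV. \<integral>t. g i t \<partial>lborel)"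
    unfolding lborel_eq[where 'a="real^'n"] integral_distr[OF meas fmeas] prod_eq
    by (subst product_integral_prod) (auto intro: g simp: prod.reindex_bij_betw[OF bij, symmetric])
qed

text \<open>
  The rank of \<open>s\<close>, the number of smaller elements, is an order isomorphism from \<open>S\<close> onto the natural
  numbers, and every strictly increasing enumeration of \<open>S\<close> is its inverse.
\<close>

lemma ex1_strict_mono_enumeration:
  fixes S :: "real set"
  assumes inf: "infinite S" and fin: "\<And>t. finite {s \<in> S. s \<le> t}"
  shows "\<exists>!r :: nat \<Rightarrow> real. strict_mono r \<and> range r = S"
proof -
  define rank where "rank s = card {t \<in> S. t < s}" for s
  have fin': "finite {t \<in> S. t < s}" for s
    by (rule finite_subset[OF _ fin[of s]]) auto
  have rank_less: "rank s < rank t" if "s \<in> S" "s < t" for s t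
    unfolding rank_def using that by (intro psubset_card_mono fin') auto
  have inj: "inj_on rank S"
  proof (rule inj_onI)
    fix s t assume "s \<in> S" "t \<in> S" "rank s = rank t"
    then show "s = t" using rank_less[of s t] rank_less[of t s] by (cases s t rule: linorder_cases) auto
  qed
  have surj: "\<exists>s\<in>S. rank s = n" for n
  proof -
    have "infinite (rank ` S)" using inf inj by (simp add: finite_image_iff)
    then obtain s0 where s0: "s0 \<in> S" "n \<le> rank s0"
      unfolding infinite_nat_iff_unbounded_le by auto
    define T where "T = {s \<in> S. s \<le> s0 \<and> n \<le> rank s}"
    have T: "finite T" "T \<noteq> {}"
      unfolding T_def using s0 by (auto intro: finite_subset[OF _ fin[of s0]])
    define s where "s = Min T"
    have sT: "s \<in> T" using Min_in[OF T] by (simp add: s_def)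
    have "rank ` {t \<in> S. t < s} \<subseteq> {..<n}"
    proof clarify
      fix t assume t: "t \<in> S" "t < s"
      then have "t \<notin> T" using Min_le[OF T(1), of t] by (auto simp: s_def)
      then show "rank t < n" using t sT by (auto simp: T_def)
    qed
    then have "card (rank ` {t \<in> S. t < s}) \<le> n" using card_mono[of "{..<n}"] by fastforce
    then have "rank s \<le> n"
      using card_image[OF inj_on_subset[OF inj, of "{t \<in> S. t < s}"]] by (simp add: rank_def)
    then show ?thesis using sT by (auto simp: T_def)
  qed
  define r where "r = inv_into S rank"
  have bij: "rank ` S = UNIV" using surj by (metis UNIV_eq_I imageI)
  have r: "r n \<in> S" "rank (r n) = n" for n
    unfolding r_def using bij by (auto intro: inv_into_into f_inv_into_f)
  have mono: "strict_mono r"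
  proof (rule strict_monoI)
    fix m n :: nat assume "m < n"
    then show "r m < r n"
      using rank_less[of "r n" "r m"] r[of m] r[of n]
      by (cases "r m" "r n" rule: linorder_cases) simp_all
  qed
  have ran: "range r = S"
  proof
    show "S \<subseteq> range r"
    proof
      fix s assume "s \<in> S"
      then have "s = r (rank s)" by (simp add: r_def inj)
      then show "s \<in> range r" by simp
    qed
  qed (use r in auto)
  show ?thesis
  proof (rule ex1I[of _ r])
    fix r' :: "nat \<Rightarrow> real" assume r': "strict_mono r' \<and> range r' = S"
    have "rank (r' n) = n" for n
    proof -
      have "{t \<in> S. t < r' n} = r' ` {..<n}"
        using r' by (auto simp: strict_mono_less)
      then show ?thesis
        unfolding rank_def using card_image[of r' "{..<n}"] strict_mono_imp_inj_on[of r' "{..<n}"] r' by simp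
    qed
    moreover have "r' n \<in> S" for n using r' by auto
    ultimately have "r' n = r n" for n
      using inj_onD[OF inj, of "r' n" "r n"] r[of n] by simp
    then show "r' = r" by auto
  qed (use mono ran in auto)
qed

lemma finite_vec_bounded: "finite {\<kappa>::nat^'n. \<forall>i. \<kappa> $ i \<le> N}"
proof (rule finite_imageD)
  show "inj_on vec_nth {\<kappa>::nat^'n. \<forall>i. \<kappa> $ i \<le> N}" by (auto simp: inj_on_def vec_nth_inject)
  have "vec_nth ` {\<kappa>::nat^'n. \<forall>i. \<kappa> $ i \<le> N} \<subseteq> PiE UNIV (\<lambda>_. {..N})" by auto
  then show "finite (vec_nth ` {\<kappa>::nat^'n. \<forall>i. \<kappa> $ i \<le> N})"
    by (rule finite_subset) (intro finite_PiE; simp)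
qed

definition prod_poly :: "('n \<Rightarrow> real poly) \<Rightarrow> real^'n \<Rightarrow> real" where
  "prod_poly s x = (\<Prod>i\<in>UNIV. poly (s i) (x $ i))"

lemma prod_poly_mult: "prod_poly s x * prod_poly s' x = prod_poly (\<lambda>i. s i * s' i) x"
  by (simp add: prod_poly_def prod.distrib)

lemma prod_poly_update:
  "prod_poly (s(i := q)) x = poly q (x $ i) * (\<Prod>j\<in>UNIV - {i}. poly (s j) (x $ j))"
  unfolding prod_poly_def by (subst prod.remove[of _ i]) auto

text \<open>
  All polynomial functions have this form, and it suits integration over the cube, which factorizes on
  \<open>prod_poly s\<close>. Scalars are absorbed into one of the factors.
\<close>

inductive prod_span :: "(real^'n \<Rightarrow> real) \<Rightarrow> bool" where
  prod: "prod_span (prod_poly s)"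
| add: "prod_span f \<Longrightarrow> prod_span g \<Longrightarrow> prod_span (\<lambda>x. f x + g x)"

lemma prod_span_linear: "prod_span (\<lambda>x::real^'n. c * (x $ i))"
proof -
  have "(\<lambda>x::real^'n. c * (x $ i)) = prod_poly ((\<lambda>_. 1)(i := [:0, c:]))"
    by (rule ext) (simp add: prod_poly_update mult.commute)
  then show ?thesis by (simp add: prod_span.prod)
qed

lemma prod_span_const: "prod_span (\<lambda>x::real^'n. c)"
proof -
  \<comment> \<open>an arbitrary index carries the constant\<close>
  have "(\<lambda>x::real^'n. c) = prod_poly ((\<lambda>_. 1)(undefined := [:c:]))"
    by (rule ext) (simp add: prod_poly_update)
  then show ?thesis by (simp add: prod_span.prod)
qed

lemma prod_span_sum: "finite I \<Longrightarrow> (\<And>i. i \<in> I \<Longrightarrow> prod_span (f i)) \<Longrightarrow> prod_span (\<lambda>x. \<Sum>i\<in>I. f i x)"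
  by (induction I rule: finite_induct) (auto intro: prod_span_const prod_span.add)

lemma prod_span_mult:
  assumes "prod_span f" "prod_span g" shows "prod_span (\<lambda>x. f x * g x)"
  using assms
proof (induction f rule: prod_span.induct)
  case (prod s)
  show ?case using prod
  proof (induction g rule: prod_span.induct)
    case (prod s')
    then show ?case by (simp add: prod_poly_mult prod_span.prod)
  qed (auto simp: distrib_left intro: prod_span.add)
qed (auto simp: distrib_right intro: prod_span.add)

lemma prod_span_of_real_polynomial_function:
  assumes "real_polynomial_function (f :: real^'n \<Rightarrow> real)" shows "prod_span f"
  using assms
proof (induction f rule: real_polynomial_function.induct)
  case (linear f)
  then have lin: "linear f" by (simp add: bounded_linear.linear)
  have eq: "f = (\<lambda>x. \<Sum>i\<in>UNIV. f (axis i 1) * (x $ i))"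
  proof
    fix x
    have "f x = f (\<Sum>i\<in>UNIV. (x $ i) *\<^sub>R axis i 1)"
      using basis_expansion[of x] by (simp add: scalar_mult_eq_scaleR)
    also have "\<dots> = (\<Sum>i\<in>UNIV. f (axis i 1) * (x $ i))"
      by (simp add: linear_sum[OF lin] linear_cmul[OF lin] mult.commute)
    finally show "f x = (\<Sum>i\<in>UNIV. f (axis i 1) * (x $ i))" .
  qed
  show ?case by (subst eq) (intro prod_span_sum prod_span_linear, simp)
qed (auto intro: prod_span_const prod_span.add prod_span_mult)

lemma real_polynomial_function_coordinate: "real_polynomial_function (\<lambda>x::real^'n. x $ i)"
  by (intro real_polynomial_function.intros(1) bounded_linear_vec_nth)

lemma real_polynomial_function_poly:
  "real_polynomial_function f \<Longrightarrow> real_polynomial_function (\<lambda>x. poly q (f x))"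
  by (induction q) (auto intro: real_polynomial_function.intros)

lemma real_polynomial_function_prod_poly: "real_polynomial_function (prod_poly s :: real^'n \<Rightarrow> real)"
  unfolding prod_poly_def[abs_def]
  by (intro real_polynomial_function_prod real_polynomial_function_poly real_polynomial_function_coordinate) auto

lemma real_polynomial_function_of_prod_span: "prod_span f \<Longrightarrow> real_polynomial_function f"
  by (induction rule: prod_span.induct) (auto intro: real_polynomial_function_prod_poly real_polynomial_function.intros(3))

text \<open>
  Induction on the degree: a multiple of \<open>P n\<close> removes the top coefficient.
\<close>

lemma poly_in_span_of_degrees:
  fixes P :: "nat \<Rightarrow> real poly"
  assumes deg: "\<And>k. degree (P k) = k" and P0: "P 0 \<noteq> 0" and q: "degree q \<le> n"
  shows "\<exists>c. q = (\<Sum>k\<le>n. smult (c k) (P k))"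
  using q
proof (induction n arbitrary: q)
  case 0
  obtain u where u: "P 0 = [:u:]" using deg[of 0] degree_eq_zeroE by blast
  obtain v where v: "q = [:v:]" using 0 degree_eq_zeroE by blast
  have "q = smult (v / u) (P 0)" using u v P0 by simp
  then show ?case by (auto intro!: exI[of _ "\<lambda>_. v / u"])
next
  case (Suc n)
  have lc: "coeff (P (Suc n)) (Suc n) \<noteq> 0"
    using deg[of "Suc n"] by (metis degree_0 leading_coeff_0_iff nat.distinct(1))
  define t where "t = coeff q (Suc n) / coeff (P (Suc n)) (Suc n)"
  define q' where "q' = q - smult t (P (Suc n))"
  have "degree q' \<le> n"
  proof (rule degree_le, intro allI impI)
    fix i assume "n < i"
    then consider "i = Suc n" | "Suc n < i" by linarith
    then show "coeff q' i = 0"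
    proof cases
      case 2
      then show ?thesis using Suc.prems deg[of "Suc n"] by (simp add: q'_def coeff_eq_0)
    qed (use lc in \<open>simp add: q'_def t_def\<close>)
  qed
  then obtain c where c: "q' = (\<Sum>k\<le>n. smult (c k) (P k))" using Suc.IH by blast
  have "q = (\<Sum>k\<le>Suc n. smult ((c(Suc n := t)) k) (P k))"
    using c by (simp add: q'_def algebra_simps)
  then show ?case by blast
qed

locale jacobi =
  fixes \<alpha> \<beta> :: "real^'n"
  assumes alpha: "\<And>i. \<alpha> $ i > -1/2" and beta: "\<And>i. \<beta> $ i > -1/2"
begin

abbreviation "\<mu> \<equiv> jacobi_measure \<alpha> \<beta>"
abbreviation "\<phi> \<equiv> jacobi_polyvec \<alpha> \<beta>"
abbreviation "ev \<equiv> jacobi_eigenvalue \<alpha> \<beta>"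
abbreviation "coef \<equiv> jacobi_coeff \<alpha> \<beta>"

lemma gt_minus_1: "\<alpha> $ i > -1" "\<beta> $ i > -1"
  using alpha[of i] beta[of i] by auto

text \<open>
  The parameters exceed \<open>-1/2\<close>, hence \<open>\<alpha> $ i + \<beta> $ i + 1 > 0\<close> for each \<open>i\<close>. This estimate gives both the
  discreteness of the spectrum and the spectral gap.
\<close>

lemma eigenvalue_ge_square: "(real (\<kappa> $ i))\<^sup>2 \<le> ev \<kappa>"
proof -
  have nonneg: "(real (\<kappa> $ j))\<^sup>2 \<le> real (\<kappa> $ j) * (real (\<kappa> $ j) + \<alpha> $ j + \<beta> $ j + 1)" for j
    using alpha[of j] beta[of j] unfolding power2_eq_square by (intro mult_left_mono) auto
  have "(real (\<kappa> $ i))\<^sup>2 \<le> (\<Sum>j\<in>UNIV. (real (\<kappa> $ j))\<^sup>2)"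
    by (rule member_le_sum) auto
  also have "\<dots> \<le> ev \<kappa>"
    unfolding jacobi_eigenvalue_def by (intro sum_mono nonneg)
  finally show ?thesis .
qed

lemma eigenvalue_nonneg: "0 \<le> ev \<kappa>"
  using eigenvalue_ge_square[of \<kappa> undefined] zero_le_power2 order_trans by blast

lemma eigenvalue_0: "ev 0 = 0"
  by (simp add: jacobi_eigenvalue_def)

lemma eigenvalue_ge_1:
  assumes "\<kappa> \<noteq> 0" shows "1 \<le> ev \<kappa>"
proof -
  obtain i where "\<kappa> $ i \<noteq> 0" using assms by (auto simp: vec_eq_iff)
  then have "1 \<le> real (\<kappa> $ i)" by simp
  then have "1 \<le> (real (\<kappa> $ i))\<^sup>2" by (rule one_le_power)
  then show ?thesis using eigenvalue_ge_square[of \<kappa> i] by linarith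
qed

lemma finite_eigenvalue_le: "finite {\<kappa>. ev \<kappa> \<le> t}"
proof (rule finite_subset[OF _ finite_vec_bounded[of "nat \<lceil>t\<rceil>"]], clarify)
  fix \<kappa> i assume "ev \<kappa> \<le> t"
  then have "(real (\<kappa> $ i))\<^sup>2 \<le> t" using eigenvalue_ge_square order_trans by blast
  moreover have "real (\<kappa> $ i) \<le> (real (\<kappa> $ i))\<^sup>2" by (cases "\<kappa> $ i") (auto simp: power2_eq_square)
  ultimately have "real (\<kappa> $ i) \<le> t" by linarith
  then show "\<kappa> $ i \<le> nat \<lceil>t\<rceil>" by linarith
qed

lemma jacobi_level: "strict_mono (jacobi_level \<alpha> \<beta>)" "range (jacobi_level \<alpha> \<beta>) = range ev"
proof -
  have "infinite (range ev)"
  proof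
    assume fin: "finite (range ev)"
    obtain N :: nat where N: "Max (range ev) < real N" using reals_Archimedean2 by blast
    have "real N \<le> (real N)\<^sup>2" by (cases N) (auto simp: power2_eq_square)
    also have "\<dots> \<le> ev (\<chi> i. N)" using eigenvalue_ge_square[of "\<chi> i. N"] by simp
    also have "\<dots> \<le> Max (range ev)" using fin by (intro Max_ge) auto
    finally show False using N by simp
  qed
  moreover have "finite {s \<in> range ev. s \<le> t}" for t
    by (rule finite_subset[OF _ finite_imageI[OF finite_eigenvalue_le[of t], of ev]]) auto
  ultimately have "\<exists>!r :: nat \<Rightarrow> real. strict_mono r \<and> range r = range ev"
    by (rule ex1_strict_mono_enumeration)
  from theI'[OF this] show "strict_mono (jacobi_level \<alpha> \<beta>)" "range (jacobi_level \<alpha> \<beta>) = range ev"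
    unfolding jacobi_level_def by auto
qed

lemma finite_jacobi_index: "finite (jacobi_index \<alpha> \<beta> n)"
  unfolding jacobi_index_def by (rule finite_subset[OF _ finite_eigenvalue_le[of "jacobi_level \<alpha> \<beta> n"]]) auto

lemma sets_jacobi [measurable_cong, simp]: "sets \<mu> = sets borel" and space_jacobi [simp]: "space \<mu> = UNIV"
  by (simp_all add: jacobi_measure_def)

lemma density_nonneg: "0 \<le> (\<Prod>i\<in>UNIV. jacobi_density1 (\<alpha> $ i) (\<beta> $ i) (x $ i))"
  by (intro prod_nonneg ballI jacobi_density1_nonneg gt_minus_1)

lemma integral_prod:
  fixes f :: "'n \<Rightarrow> real \<Rightarrow> real"
  assumes f: "\<And>i. integrable (jacobi_measure1 (\<alpha> $ i) (\<beta> $ i)) (f i)"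
  shows "integrable \<mu> (\<lambda>x. \<Prod>i\<in>UNIV. f i (x $ i))"
    and "(\<integral>x. (\<Prod>i\<in>UNIV. f i (x $ i)) \<partial>\<mu>) = (\<Prod>i\<in>UNIV. \<integral>t. f i t \<partial>jacobi_measure1 (\<alpha> $ i) (\<beta> $ i))"
proof -
  let ?d = "\<lambda>i. jacobi_density1 (\<alpha> $ i) (\<beta> $ i)"
  have [measurable]: "f i \<in> borel_measurable borel" for i
    using borel_measurable_integrable[OF f[of i]] by simp
  have int: "integrable lborel (\<lambda>t. ?d i t * f i t)" for i
    using f[of i] unfolding jacobi_measure1_def
    by (subst (asm) integrable_real_density) (auto simp: jacobi_density1_nonneg gt_minus_1)
  have eq: "(\<integral>t. ?d i t * f i t \<partial>lborel) = (\<integral>t. f i t \<partial>jacobi_measure1 (\<alpha> $ i) (\<beta> $ i))" for i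
    unfolding jacobi_measure1_def
    by (subst integral_real_density) (auto simp: jacobi_density1_nonneg gt_minus_1)
  note L = lborel_vec_prod[of "\<lambda>i t. ?d i t * f i t", OF int]
  show "integrable \<mu> (\<lambda>x. \<Prod>i\<in>UNIV. f i (x $ i))"
    unfolding jacobi_measure_def
    by (subst integrable_real_density) (use L(1) density_nonneg in \<open>auto simp: prod.distrib\<close>)
  show "(\<integral>x. (\<Prod>i\<in>UNIV. f i (x $ i)) \<partial>\<mu>) = (\<Prod>i\<in>UNIV. \<integral>t. f i t \<partial>jacobi_measure1 (\<alpha> $ i) (\<beta> $ i))"
    unfolding jacobi_measure_def
    by (subst integral_real_density) (use L(2) density_nonneg in \<open>auto simp: prod.distrib eq\<close>)
qed

lemma prob_space_jacobi: "prob_space \<mu>"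
proof
  let ?d = "\<lambda>x::real^'n. \<Prod>i\<in>UNIV. jacobi_density1 (\<alpha> $ i) (\<beta> $ i) (x $ i)"
  have d1: "integrable lborel (jacobi_density1 (\<alpha> $ i) (\<beta> $ i))"
    "(\<integral>t. jacobi_density1 (\<alpha> $ i) (\<beta> $ i) t \<partial>lborel) = 1" for i
  proof -
    note nn = nn_integral_jacobi_density1[OF gt_minus_1, of i i]
    show "integrable lborel (jacobi_density1 (\<alpha> $ i) (\<beta> $ i))"
      by (rule integrableI_nonneg) (use nn jacobi_density1_nonneg[OF gt_minus_1] in auto)
    show "(\<integral>t. jacobi_density1 (\<alpha> $ i) (\<beta> $ i) t \<partial>lborel) = 1"
      by (subst integral_eq_nn_integral) (use nn jacobi_density1_nonneg[OF gt_minus_1] in auto)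
  qed
  note L = lborel_vec_prod[OF d1(1)]
  have "emeasure \<mu> (space \<mu>) = (\<integral>\<^sup>+x. ennreal (?d x) \<partial>lborel)"
    by (simp add: jacobi_measure_def emeasure_density)
  also have "\<dots> = ennreal (\<integral>x. ?d x \<partial>lborel)"
    using L(1) density_nonneg by (intro nn_integral_eq_integral) auto
  also have "\<dots> = 1" using L(2) d1(2) by simp
  finally show "emeasure \<mu> (space \<mu>) = 1" .
qed

sublocale prob_space \<mu> by (rule prob_space_jacobi)

lemma AE_cube: "AE x in \<mu>. \<forall>i. x $ i \<in> {-1..1}"
  unfolding jacobi_measure_def
proof (subst AE_density)
  have "0 < (\<Prod>i\<in>UNIV. jacobi_density1 (\<alpha> $ i) (\<beta> $ i) (x $ i)) \<longrightarrow> x $ i \<in> {-1..1}" for x :: "real^'n" and i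
  proof (intro impI, rule ccontr)
    assume pos: "0 < (\<Prod>i\<in>UNIV. jacobi_density1 (\<alpha> $ i) (\<beta> $ i) (x $ i))" and "x $ i \<notin> {-1..1}"
    then have "jacobi_density1 (\<alpha> $ i) (\<beta> $ i) (x $ i) = 0" by (simp add: jacobi_density1_def indicator_def)
    then have "(\<Prod>i\<in>UNIV. jacobi_density1 (\<alpha> $ i) (\<beta> $ i) (x $ i)) = 0" by (intro prod_zero) auto
    then show False using pos by linarith
  qed
  then show "AE x in lborel. 0 < ennreal (\<Prod>i\<in>UNIV. jacobi_density1 (\<alpha> $ i) (\<beta> $ i) (x $ i))
      \<longrightarrow> (\<forall>i. x $ i \<in> {-1..1})" by simp
qed auto

abbreviation cube :: "(real^'n) set" where "cube \<equiv> {x. \<forall>i. x $ i \<in> {-1..1}}"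

lemma cube_eq_cbox: "cube = cbox (\<chi> i. -1) (\<chi> i. 1)"
  by (auto simp: mem_box_cart)

lemma continuous_bounded_on_cube:
  assumes "continuous_on UNIV (f :: real^'n \<Rightarrow> real)"
  obtains B where "0 \<le> B" "\<And>x. x \<in> cube \<Longrightarrow> \<bar>f x\<bar> \<le> B"
proof -
  have "compact (f ` cube)"
    unfolding cube_eq_cbox using assms by (intro compact_continuous_image compact_cbox) (auto intro: continuous_on_subset)
  then have "bounded (f ` cube)" by (rule compact_imp_bounded)
  then obtain B where "\<And>x. x \<in> cube \<Longrightarrow> \<bar>f x\<bar> \<le> B" unfolding bounded_iff by auto
  then show ?thesis using that[of "max 0 B"] by fastforce
qed

lemma continuous_measurable:
  "continuous_on UNIV (f :: real^'n \<Rightarrow> real) \<Longrightarrow> f \<in> borel_measurable \<mu>"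
  using borel_measurable_continuous_onI[of f] by (simp add: measurable_def)

lemma continuous_Lp:
  assumes "continuous_on UNIV (f :: real^'n \<Rightarrow> real)" "0 \<le> p" shows "f \<in> Lp_space \<mu> p"
proof -
  obtain B where B: "\<And>x. x \<in> cube \<Longrightarrow> \<bar>f x\<bar> \<le> B" using continuous_bounded_on_cube[OF assms(1)] by blast
  have "AE x in \<mu>. \<bar>f x\<bar> \<le> B" using AE_cube by eventually_elim (use B in simp)
  then show ?thesis using Lp_space_of_bounded[OF continuous_measurable[OF assms(1)] _ assms(2)] by blast
qed

lemma continuous_integrable:
  assumes "continuous_on UNIV (f :: real^'n \<Rightarrow> real)" shows "integrable \<mu> f"
  using Lp_space_imp_integrable[OF _ continuous_Lp[OF assms], of 1] by simp

lemma polynomial_continuous: "real_polynomial_function (f :: real^'n \<Rightarrow> real) \<Longrightarrow> continuous_on UNIV f"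
  by (simp add: continuous_on_polymonial_function real_polynomial_function_eq)

lemmas polynomial_integrable = continuous_integrable[OF polynomial_continuous]
lemmas polynomial_Lp = continuous_Lp[OF polynomial_continuous]

lemma integral_prod_poly:
  "(\<integral>x. prod_poly s x \<partial>\<mu>) = (\<Prod>i\<in>UNIV. \<integral>t. poly (s i) t \<partial>jacobi_measure1 (\<alpha> $ i) (\<beta> $ i))"
  unfolding prod_poly_def by (rule integral_prod(2)) (rule integrable_poly_jacobi_measure1[OF gt_minus_1])

definition jp :: "nat^'n \<Rightarrow> 'n \<Rightarrow> real poly" where
  "jp \<kappa> i = jacobi_poly (\<alpha> $ i) (\<beta> $ i) (\<kappa> $ i)"

lemma polyvec_eq: "\<phi> \<kappa> = prod_poly (jp \<kappa>)"
  by (rule ext) (simp add: jacobi_polyvec_def prod_poly_def jp_def)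

lemma polyvec_polynomial: "real_polynomial_function (\<phi> \<kappa>)"
  unfolding polyvec_eq by (rule real_polynomial_function_prod_poly)

lemma polyvec_0: "\<phi> 0 = (\<lambda>x. 1)"
  by (rule ext) (simp add: polyvec_eq prod_poly_def jp_def jacobi_poly_0[OF gt_minus_1])

lemma polyvec_orthonormal: "(\<integral>x. \<phi> \<kappa> x * \<phi> \<kappa>' x \<partial>\<mu>) = (if \<kappa> = \<kappa>' then 1 else 0)"
proof -
  have eq: "(\<integral>x. \<phi> \<kappa> x * \<phi> \<kappa>' x \<partial>\<mu>)
      = (\<Prod>i\<in>UNIV. \<integral>t. poly (jp \<kappa> i * jp \<kappa>' i) t \<partial>jacobi_measure1 (\<alpha> $ i) (\<beta> $ i))"
    unfolding polyvec_eq prod_poly_mult by (rule integral_prod_poly)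
  show ?thesis
  proof (cases "\<kappa> = \<kappa>'")
    case True
    then show ?thesis
      unfolding eq using jacobi_poly_norm[OF gt_minus_1]
      by (simp add: jp_def power2_eq_square poly_mult[abs_def])
  next
    case False
    then obtain i where "\<kappa> $ i \<noteq> \<kappa>' $ i" by (auto simp: vec_eq_iff)
    then have "(\<integral>t. poly (jp \<kappa> i * jp \<kappa>' i) t \<partial>jacobi_measure1 (\<alpha> $ i) (\<beta> $ i)) = 0"
      unfolding jp_def by (rule jacobi_poly_orthogonal[OF gt_minus_1])
    then have "(\<Prod>i\<in>UNIV. \<integral>t. poly (jp \<kappa> i * jp \<kappa>' i) t \<partial>jacobi_measure1 (\<alpha> $ i) (\<beta> $ i)) = 0"
      by (intro prod_zero) auto
    then show ?thesis unfolding eq using False by (simp only: if_False)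
  qed
qed

definition comb :: "(nat^'n) set \<Rightarrow> (nat^'n \<Rightarrow> real) \<Rightarrow> real^'n \<Rightarrow> real" where
  "comb K c x = (\<Sum>\<kappa>\<in>K. c \<kappa> * \<phi> \<kappa> x)"

lemma comb_polynomial: "finite K \<Longrightarrow> real_polynomial_function (comb K c)"
  unfolding comb_def[abs_def]
  by (intro real_polynomial_function_sum real_polynomial_function.intros(4) real_polynomial_function.intros(2) polyvec_polynomial)

text \<open>
  Each factor is a combination of the Jacobi polynomials in its variable; multiplying out gives one
  basis function for each multi-index \<open>\<kappa>\<close> with entries up to \<open>N\<close>.
\<close>

lemma prod_poly_comb: "\<exists>K c. finite K \<and> prod_poly s = comb K c"
proof -
  define N where "N = Max (range (\<lambda>i. degree (s i)))"
  have "\<exists>c. s i = (\<Sum>k\<le>N. smult (c k) (jacobi_poly (\<alpha> $ i) (\<beta> $ i) k))" for i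
  proof (rule poly_in_span_of_degrees)
    show "degree (s i) \<le> N" unfolding N_def by (rule Max_ge) auto
    show "jacobi_poly (\<alpha> $ i) (\<beta> $ i) 0 \<noteq> 0" by (simp add: jacobi_poly_0[OF gt_minus_1])
  qed (rule degree_jacobi_poly[OF gt_minus_1])
  then obtain c where c: "\<And>i. s i = (\<Sum>k\<le>N. smult (c i k) (jacobi_poly (\<alpha> $ i) (\<beta> $ i) k))" by metis
  define K where "K = {\<kappa>::nat^'n. \<forall>i. \<kappa> $ i \<le> N}"
  have bij: "bij_betw vec_lambda (PiE UNIV (\<lambda>_. {..N})) K"
    by (rule bij_betwI[where g=vec_nth]) (auto simp: K_def)
  have "prod_poly s = comb K (\<lambda>\<kappa>. \<Prod>i\<in>UNIV. c i (\<kappa> $ i))"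
  proof
    fix x
    have "prod_poly s x = (\<Prod>i\<in>UNIV. \<Sum>k\<le>N. c i k * poly (jacobi_poly (\<alpha> $ i) (\<beta> $ i) k) (x $ i))"
      unfolding prod_poly_def by (subst c) (simp add: poly_sum)
    also have "\<dots> = (\<Sum>g\<in>PiE UNIV (\<lambda>_. {..N}). \<Prod>i\<in>UNIV. c i (g i) * poly (jacobi_poly (\<alpha> $ i) (\<beta> $ i) (g i)) (x $ i))"
      by (rule prod_sum_PiE) auto
    also have "\<dots> = (\<Sum>\<kappa>\<in>K. \<Prod>i\<in>UNIV. c i (\<kappa> $ i) * poly (jacobi_poly (\<alpha> $ i) (\<beta> $ i) (\<kappa> $ i)) (x $ i))"
      by (subst sum.reindex_bij_betw[OF bij, symmetric]) simp
    also have "\<dots> = comb K (\<lambda>\<kappa>. \<Prod>i\<in>UNIV. c i (\<kappa> $ i)) x"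
      by (simp add: comb_def jacobi_polyvec_def prod.distrib)
    finally show "prod_poly s x = comb K (\<lambda>\<kappa>. \<Prod>i\<in>UNIV. c i (\<kappa> $ i)) x" .
  qed
  moreover have "finite K" unfolding K_def by (rule finite_vec_bounded)
  ultimately show ?thesis by blast
qed

lemma comb_extend:
  assumes "finite L" "K \<subseteq> L" shows "comb K c = comb L (\<lambda>\<kappa>. if \<kappa> \<in> K then c \<kappa> else 0)"
  unfolding comb_def using assms by (auto intro!: ext sum.mono_neutral_cong_left)

lemma polynomial_comb:
  assumes "real_polynomial_function f" shows "\<exists>K c. finite K \<and> f = comb K c"
  using prod_span_of_real_polynomial_function[OF assms]
proof (induction rule: prod_span.induct)
  case (prod s)
  then show ?case by (rule prod_poly_comb)
next
  case (add f g)
  then obtain K c K' c' where *: "finite K" "f = comb K c" "finite K'" "g = comb K' c'" by blast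
  then have "finite (K \<union> K')" by simp
  moreover have "(\<lambda>x. f x + g x) = comb (K \<union> K')
      (\<lambda>\<kappa>. (if \<kappa> \<in> K then c \<kappa> else 0) + (if \<kappa> \<in> K' then c' \<kappa> else 0))"
    using comb_extend[of "K \<union> K'" K c] comb_extend[of "K \<union> K'" K' c'] *
    by (auto simp: fun_eq_iff comb_def distrib_right sum.distrib)
  ultimately show ?case by blast
qed

lemma coeff_comb:
  assumes "finite K" shows "coef (comb K c) \<kappa> = (if \<kappa> \<in> K then c \<kappa> else 0)"
proof -
  have "coef (comb K c) \<kappa> = (\<integral>x. (\<Sum>\<kappa>'\<in>K. c \<kappa>' * (\<phi> \<kappa>' x * \<phi> \<kappa> x)) \<partial>\<mu>)"
    by (simp add: jacobi_coeff_def comb_def sum_distrib_right mult.assoc)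
  also have "\<dots> = (\<Sum>\<kappa>'\<in>K. c \<kappa>' * (\<integral>x. \<phi> \<kappa>' x * \<phi> \<kappa> x \<partial>\<mu>))"
    by (subst Bochner_Integration.integral_sum)
       (auto intro!: polynomial_integrable real_polynomial_function.intros(4) real_polynomial_function.intros(2) polyvec_polynomial)
  also have "\<dots> = (if \<kappa> \<in> K then c \<kappa> else 0)"
    using assms by (simp add: polyvec_orthonormal if_distrib cong: if_cong)
  finally show ?thesis .
qed

lemma polynomial_expansion:
  assumes "real_polynomial_function f"
  obtains K where "finite K" "\<And>\<kappa>. \<kappa> \<notin> K \<Longrightarrow> coef f \<kappa> = 0" "f = comb K (coef f)"
proof -
  obtain K c where "finite K" "f = comb K c" using polynomial_comb[OF assms] by blast
  then show ?thesis
    by (intro that[of K]) (auto simp: coeff_comb comb_def)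
qed

lemma comb_mono_neutral:
  assumes "finite L" "K \<subseteq> L" "\<And>\<kappa>. \<kappa> \<notin> K \<Longrightarrow> c \<kappa> = 0" shows "comb K c = comb L c"
  unfolding comb_def using assms by (auto intro!: ext sum.mono_neutral_left)

end

section \<open>The Jacobi operator, integration by parts and the Poincare inequality\<close>

definition partial_deriv :: "'n \<Rightarrow> (real^'n \<Rightarrow> real) \<Rightarrow> real^'n \<Rightarrow> real" where
  "partial_deriv i f x = deriv (\<lambda>t. f (x + t *\<^sub>R axis i 1)) 0"

lemma partial_deriv_prod_poly:
  "((\<lambda>t. prod_poly s (x + t *\<^sub>R axis i 1)) has_real_derivative prod_poly (s(i := pderiv (s i))) x) (at 0)"
proof -
  have eq: "prod_poly s (x + t *\<^sub>R axis i 1)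
      = poly (s i) (x $ i + t) * (\<Prod>j\<in>UNIV - {i}. poly (s j) (x $ j))" for t
  proof -
    have "(\<Prod>j\<in>UNIV - {i}. poly (s j) ((x + t *\<^sub>R axis i 1) $ j)) = (\<Prod>j\<in>UNIV - {i}. poly (s j) (x $ j))"
      by (rule prod.cong) (auto simp: axis_def)
    moreover have "(x + t *\<^sub>R axis i 1) $ i = x $ i + t" by (simp add: axis_def)
    ultimately show ?thesis
      using prod_poly_update[of s i "s i" "x + t *\<^sub>R axis i 1"] by simp
  qed
  show ?thesis
    unfolding eq prod_poly_update
    by (auto intro!: derivative_eq_intros poly_DERIV)
qed

lemma polynomial_has_partial_deriv:
  assumes "real_polynomial_function (f :: real^'n \<Rightarrow> real)"
  shows "((\<lambda>t. f (x + t *\<^sub>R axis i 1)) has_real_derivative partial_deriv i f x) (at 0)"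
    and "real_polynomial_function (partial_deriv i f)"
proof -
  have "\<exists>g. prod_span g \<and> (\<forall>x. ((\<lambda>t. f (x + t *\<^sub>R axis i 1)) has_real_derivative g x) (at 0))"
    using prod_span_of_real_polynomial_function[OF assms]
  proof (induction rule: prod_span.induct)
    case (prod s)
    then show ?case using partial_deriv_prod_poly prod_span.prod by metis
  next
    case (add f h)
    then obtain f' h' where "prod_span f'" "prod_span h'"
      "\<forall>x. ((\<lambda>t. f (x + t *\<^sub>R axis i 1)) has_real_derivative f' x) (at 0)"
      "\<forall>x. ((\<lambda>t. h (x + t *\<^sub>R axis i 1)) has_real_derivative h' x) (at 0)" by blast
    then show ?case
      by (intro exI[of _ "\<lambda>x. f' x + h' x"]) (auto intro: prod_span.add DERIV_add)
  qed
  then obtain g where g: "prod_span g" "\<And>x. ((\<lambda>t. f (x + t *\<^sub>R axis i 1)) has_real_derivative g x) (at 0)"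
    by blast
  then have "partial_deriv i f = g"
    by (auto simp: partial_deriv_def DERIV_imp_deriv)
  then show "((\<lambda>t. f (x + t *\<^sub>R axis i 1)) has_real_derivative partial_deriv i f x) (at 0)"
    "real_polynomial_function (partial_deriv i f)"
    using g by (auto intro: real_polynomial_function_of_prod_span)
qed

lemma partial_deriv_prod_poly_eq: "partial_deriv i (prod_poly s) = prod_poly (s(i := pderiv (s i)))"
  using partial_deriv_prod_poly by (auto simp: partial_deriv_def fun_eq_iff intro!: DERIV_imp_deriv)

lemma partial_deriv_add:
  assumes "real_polynomial_function f" "real_polynomial_function g"
  shows "partial_deriv i (\<lambda>x. f x + g x) = (\<lambda>x. partial_deriv i f x + partial_deriv i g x)"
  using polynomial_has_partial_deriv(1)[OF assms(1)] polynomial_has_partial_deriv(1)[OF assms(2)]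
  by (auto simp: partial_deriv_def[of _ "\<lambda>x. f x + g x"] fun_eq_iff intro!: DERIV_imp_deriv DERIV_add)

lemma partial_deriv_cmult:
  assumes "real_polynomial_function f"
  shows "partial_deriv i (\<lambda>x. c * f x) = (\<lambda>x. c * partial_deriv i f x)"
  using polynomial_has_partial_deriv(1)[OF assms(1)]
  by (auto simp: partial_deriv_def[of _ "\<lambda>x. c * f x"] fun_eq_iff intro!: DERIV_imp_deriv DERIV_cmult)

lemma partial_deriv_mult:
  assumes "real_polynomial_function f" "real_polynomial_function g"
  shows "partial_deriv i (\<lambda>x. f x * g x) = (\<lambda>x. partial_deriv i f x * g x + f x * partial_deriv i g x)"
proof
  fix x
  have "((\<lambda>t. f (x + t *\<^sub>R axis i 1) * g (x + t *\<^sub>R axis i 1)) has_real_derivative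
      partial_deriv i f x * g x + f x * partial_deriv i g x) (at 0)"
    using DERIV_mult[OF polynomial_has_partial_deriv(1)[OF assms(1), of x i] polynomial_has_partial_deriv(1)[OF assms(2), of x i]]
    by (simp add: mult.commute)
  then show "partial_deriv i (\<lambda>x. f x * g x) x = partial_deriv i f x * g x + f x * partial_deriv i g x"
    by (simp add: partial_deriv_def[of _ "\<lambda>x. f x * g x"] DERIV_imp_deriv)
qed

lemma partial_deriv_poly_compose:
  assumes "real_polynomial_function f"
  shows "partial_deriv i (\<lambda>x. poly q (f x)) = (\<lambda>x. poly (pderiv q) (f x) * partial_deriv i f x)"
proof
  fix x
  have "((\<lambda>t. poly q (f (x + t *\<^sub>R axis i 1))) has_real_derivative
      poly (pderiv q) (f x) * partial_deriv i f x) (at 0)"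
    using DERIV_chain2[OF poly_DERIV polynomial_has_partial_deriv(1)[OF assms, of x i], of q] by simp
  then show "partial_deriv i (\<lambda>x. poly q (f x)) x = poly (pderiv q) (f x) * partial_deriv i f x"
    by (simp add: partial_deriv_def[of _ "\<lambda>x. poly q (f x)"] DERIV_imp_deriv)
qed

lemma pderiv_sum_monom: "pderiv (\<Sum>i\<in>I. f i) = (\<Sum>i\<in>I. pderiv (f i))"
  by (induction I rule: infinite_finite_induct) (auto simp: pderiv_add)

lemma ex_poly_antiderivative: "\<exists>Q :: real poly. pderiv Q = q \<and> poly Q 0 = c"
proof -
  define Q where "Q = (\<Sum>i\<le>degree q. monom (coeff q i / real (Suc i)) (Suc i)) + [:c:]"
  have "pderiv Q = (\<Sum>i\<le>degree q. monom (coeff q i) i)"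
    by (simp add: Q_def pderiv_add pderiv_sum_monom pderiv_monom pderiv_pCons del: of_nat_Suc)
  also have "\<dots> = q" by (rule poly_as_sum_of_monoms)
  finally show ?thesis
    by (intro exI[of _ Q]) (simp add: Q_def poly_sum poly_monom)
qed

lemma polynomial_function_real_eq_poly:
  assumes "real_polynomial_function (g :: real \<Rightarrow> real)" shows "\<exists>q. g = poly q"
proof -
  obtain a n where "g = (\<lambda>x. \<Sum>i\<le>n. a i * x ^ i)"
    using assms real_polynomial_function_iff_sum by blast
  then have "g = poly (\<Sum>i\<le>n. monom (a i) i)" by (simp add: fun_eq_iff poly_sum poly_monom)
  then show ?thesis by blast
qed

text \<open>
  A uniform approximation of the derivative, integrated from \<open>0\<close>, also approximates the function.
\<close>

lemma C1_approximation_by_polynomials: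
  fixes h h' :: "real \<Rightarrow> real"
  assumes deriv: "\<And>y. (h has_real_derivative h' y) (at y)" and cont: "continuous_on UNIV h'" and M: "0 \<le> M"
  obtains Q :: "nat \<Rightarrow> real poly" where
    "\<And>n y. \<bar>y\<bar> \<le> M \<Longrightarrow> \<bar>poly (Q n) y - h y\<bar> \<le> M / real (Suc n)"
    "\<And>n y. \<bar>y\<bar> \<le> M \<Longrightarrow> \<bar>poly (pderiv (Q n)) y - h' y\<bar> \<le> 1 / real (Suc n)"
proof -
  have "\<exists>Q. \<forall>y. \<bar>y\<bar> \<le> M \<longrightarrow> \<bar>poly Q y - h y\<bar> \<le> M / real (Suc n) \<and> \<bar>poly (pderiv Q) y - h' y\<bar> \<le> 1 / real (Suc n)" for n
  proof -
    obtain g where g: "real_polynomial_function g" "\<And>y. y \<in> {-M..M} \<Longrightarrow> \<bar>h' y - g y\<bar> < 1 / real (Suc n)"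
      using Stone_Weierstrass_real_polynomial_function[of "{-M..M}" h' "1 / real (Suc n)"]
        continuous_on_subset[OF cont] by auto
    obtain q where q: "g = poly q" using polynomial_function_real_eq_poly[OF g(1)] by blast
    obtain Q where Q: "pderiv Q = q" "poly Q 0 = h 0" using ex_poly_antiderivative by blast
    have d: "\<bar>poly (pderiv Q) y - h' y\<bar> \<le> 1 / real (Suc n)" if "\<bar>y\<bar> \<le> M" for y
    proof -
      have "y \<in> {-M..M}" using that by (auto simp: abs_le_iff)
      from g(2)[OF this] show ?thesis using Q q by (simp add: abs_minus_commute)
    qed
    have "\<bar>poly Q y - h y\<bar> \<le> M / real (Suc n)" if y: "\<bar>y\<bar> \<le> M" for y
    proof -
      have "norm ((poly Q y - h y) - (poly Q 0 - h 0)) \<le> 1 / real (Suc n) * norm (y - 0)"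
      proof (rule field_differentiable_bound[of "{-M..M}" _ "\<lambda>y. poly (pderiv Q) y - h' y"])
        show "((\<lambda>y. poly Q y - h y) has_field_derivative poly (pderiv Q) z - h' z) (at z within {-M..M})" for z
          by (intro DERIV_subset[OF DERIV_diff[OF poly_DERIV deriv]]) auto
      qed (use d y M in auto)
      also have "\<dots> \<le> 1 / real (Suc n) * M"
        using y by (intro mult_left_mono) auto
      finally show ?thesis using Q by simp
    qed
    then show ?thesis using d by blast
  qed
  then show ?thesis using that by metis
qed

context jacobi
begin

text \<open>
  Minus the adjoint of \<open>partial_deriv i\<close>, if derivatives are measured with the additional weight
  \<open>1 - (x $ i)\<^sup>2\<close>; so composing it with \<open>partial_deriv i\<close> gives a symmetric operator.
\<close>

definition weighted_div :: "'n \<Rightarrow> (real^'n \<Rightarrow> real) \<Rightarrow> real^'n \<Rightarrow> real" where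
  "weighted_div i g x = (1 - (x $ i)\<^sup>2) * partial_deriv i g x
     + (\<beta> $ i - \<alpha> $ i - (\<alpha> $ i + \<beta> $ i + 2) * (x $ i)) * g x"

definition jacobi_op :: "(real^'n \<Rightarrow> real) \<Rightarrow> real^'n \<Rightarrow> real" where
  "jacobi_op f x = (\<Sum>i\<in>UNIV. weighted_div i (partial_deriv i f) x)"

definition carre_du_champ :: "(real^'n \<Rightarrow> real) \<Rightarrow> (real^'n \<Rightarrow> real) \<Rightarrow> real^'n \<Rightarrow> real" where
  "carre_du_champ f g x = (\<Sum>i\<in>UNIV. (1 - (x $ i)\<^sup>2) * (partial_deriv i f x * partial_deriv i g x))"

lemma weighted_div_prod_poly:
  "weighted_div i (prod_poly s) = prod_poly (s(i := raise_poly (\<alpha> $ i) (\<beta> $ i) (s i)))"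
  using prod_poly_update[of s i "s i"]
  by (auto simp: fun_eq_iff weighted_div_def partial_deriv_prod_poly_eq prod_poly_update poly_raise_poly algebra_simps)

lemma weighted_div_polynomial: "real_polynomial_function g \<Longrightarrow> real_polynomial_function (weighted_div i g)"
  unfolding weighted_div_def[abs_def] power2_eq_square
  by (intro real_polynomial_function.intros(2-4) real_polynomial_function_diff
      polynomial_has_partial_deriv(2) real_polynomial_function_coordinate)

lemma weighted_div_add:
  assumes "real_polynomial_function f" "real_polynomial_function g"
  shows "weighted_div i (\<lambda>x. f x + g x) = (\<lambda>x. weighted_div i f x + weighted_div i g x)"
  by (auto simp: fun_eq_iff weighted_div_def partial_deriv_add[OF assms] algebra_simps)

text \<open>
  On a product of one-variable polynomials only the factor with index \<open>i\<close> changes, and its integral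
  vanishes by \<open>integral_raise_poly\<close>.
\<close>

lemma integral_weighted_div:
  assumes "real_polynomial_function g" shows "(\<integral>x. weighted_div i g x \<partial>\<mu>) = 0"
  using prod_span_of_real_polynomial_function[OF assms]
proof (induction rule: prod_span.induct)
  case (prod s)
  let ?s = "s(i := raise_poly (\<alpha> $ i) (\<beta> $ i) (s i))"
  have "(\<integral>t. poly (?s i) t \<partial>jacobi_measure1 (\<alpha> $ i) (\<beta> $ i)) = 0"
    using integral_raise_poly[OF gt_minus_1] by simp
  then have "(\<Prod>j\<in>UNIV. \<integral>t. poly (?s j) t \<partial>jacobi_measure1 (\<alpha> $ j) (\<beta> $ j)) = 0"
    by (intro prod_zero) auto
  then show ?case by (simp only: weighted_div_prod_poly integral_prod_poly)
next
  case (add f g)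
  note poly = real_polynomial_function_of_prod_span[OF add.hyps(1)] real_polynomial_function_of_prod_span[OF add.hyps(2)]
  have "(\<integral>x. weighted_div i f x + weighted_div i g x \<partial>\<mu>) = (\<integral>x. weighted_div i f x \<partial>\<mu>) + (\<integral>x. weighted_div i g x \<partial>\<mu>)"
    by (intro Bochner_Integration.integral_add polynomial_integrable weighted_div_polynomial poly)
  then show ?case using add.IH by (simp add: weighted_div_add[OF poly])
qed

lemma jacobi_op_polynomial: "real_polynomial_function f \<Longrightarrow> real_polynomial_function (jacobi_op f)"
  unfolding jacobi_op_def[abs_def]
  by (intro real_polynomial_function_sum weighted_div_polynomial polynomial_has_partial_deriv(2)) auto

lemma carre_du_champ_polynomial:
  "real_polynomial_function f \<Longrightarrow> real_polynomial_function g \<Longrightarrow> real_polynomial_function (carre_du_champ f g)"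
  unfolding carre_du_champ_def[abs_def] power2_eq_square
  by (intro real_polynomial_function_sum real_polynomial_function.intros(2-4) real_polynomial_function_diff
      polynomial_has_partial_deriv(2) real_polynomial_function_coordinate) auto

lemma jacobi_op_polyvec: "jacobi_op (\<phi> \<kappa>) x = - ev \<kappa> * \<phi> \<kappa> x"
proof -
  have "weighted_div i (partial_deriv i (\<phi> \<kappa>)) x
      = - (real (\<kappa> $ i) * (real (\<kappa> $ i) + \<alpha> $ i + \<beta> $ i + 1)) * \<phi> \<kappa> x" for i
  proof -
    have "weighted_div i (partial_deriv i (\<phi> \<kappa>))
        = prod_poly ((jp \<kappa>)(i := raise_poly (\<alpha> $ i) (\<beta> $ i) (pderiv (jp \<kappa> i))))"
      by (simp add: polyvec_eq partial_deriv_prod_poly_eq weighted_div_prod_poly)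
    also have "\<dots> = prod_poly ((jp \<kappa>)(i := smult (- (real (\<kappa> $ i) * (real (\<kappa> $ i) + \<alpha> $ i + \<beta> $ i + 1))) (jp \<kappa> i)))"
      by (simp only: jp_def jacobi_poly_eigen[OF gt_minus_1])
    finally show ?thesis
      using prod_poly_update[of "jp \<kappa>" i "jp \<kappa> i" x] by (simp add: prod_poly_update polyvec_eq)
  qed
  then show ?thesis
    by (simp add: jacobi_op_def jacobi_eigenvalue_def sum_distrib_right sum_negf)
qed

lemma jacobi_op_add:
  assumes "real_polynomial_function f" "real_polynomial_function g"
  shows "jacobi_op (\<lambda>x. f x + g x) x = jacobi_op f x + jacobi_op g x"
  using assms by (simp add: jacobi_op_def partial_deriv_add weighted_div_add polynomial_has_partial_deriv(2) sum.distrib)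

lemma jacobi_op_cmult:
  assumes "real_polynomial_function f"
  shows "jacobi_op (\<lambda>x. c * f x) x = c * jacobi_op f x"
  using assms
  by (simp add: jacobi_op_def weighted_div_def partial_deriv_cmult polynomial_has_partial_deriv(2) sum_distrib_left algebra_simps)

lemma jacobi_op_comb:
  assumes "finite K" shows "jacobi_op (comb K c) x = comb K (\<lambda>\<kappa>. - ev \<kappa> * c \<kappa>) x"
  using assms
proof (induction K arbitrary: x rule: finite_induct)
  case empty
  have "comb {} c = (\<lambda>x. 0 * \<phi> 0 x)" by (auto simp: comb_def fun_eq_iff)
  then show ?case using jacobi_op_cmult[OF polyvec_polynomial, of 0 0 x] by (simp add: comb_def)
next
  case (insert \<kappa> K)
  have "comb (insert \<kappa> K) c = (\<lambda>x. c \<kappa> * \<phi> \<kappa> x + comb K c x)"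
    using insert by (auto simp: comb_def fun_eq_iff)
  then have "jacobi_op (comb (insert \<kappa> K) c) x = jacobi_op (\<lambda>x. c \<kappa> * \<phi> \<kappa> x) x + jacobi_op (comb K c) x"
    using insert.hyps
    by (simp add: jacobi_op_add comb_polynomial polyvec_polynomial real_polynomial_function.intros)
  then show ?case
    using insert.hyps insert.IH[of x]
    by (simp add: jacobi_op_cmult[OF polyvec_polynomial] jacobi_op_polyvec) (simp add: comb_def)
qed

text \<open>
  By the product rule, \<open>jacobi_op u * v + carre_du_champ u v\<close> is the sum of
  \<open>weighted_div i (v * partial_deriv i u)\<close>.
\<close>

lemma integration_by_parts:
  assumes u: "real_polynomial_function u" and v: "real_polynomial_function v"
  shows "(\<integral>x. - jacobi_op u x * v x \<partial>\<mu>) = (\<integral>x. carre_du_champ u v x \<partial>\<mu>)"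
proof -
  let ?g = "\<lambda>i x. v x * partial_deriv i u x"
  have g: "real_polynomial_function (?g i)" for i
    by (intro real_polynomial_function.intros(4) v polynomial_has_partial_deriv(2) u)
  have "jacobi_op u x * v x + carre_du_champ u v x = (\<Sum>i\<in>UNIV. weighted_div i (?g i) x)" for x
    unfolding jacobi_op_def carre_du_champ_def sum_distrib_right sum.distrib[symmetric]
    by (rule sum.cong) (auto simp: weighted_div_def partial_deriv_mult[OF v polynomial_has_partial_deriv(2)[OF u]] algebra_simps)
  then have "(\<integral>x. jacobi_op u x * v x + carre_du_champ u v x \<partial>\<mu>) = (\<Sum>i\<in>UNIV. \<integral>x. weighted_div i (?g i) x \<partial>\<mu>)"
    by (simp add: Bochner_Integration.integral_sum polynomial_integrable weighted_div_polynomial g)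
  also have "\<dots> = 0" by (simp add: integral_weighted_div[OF g])
  also have "(\<integral>x. jacobi_op u x * v x + carre_du_champ u v x \<partial>\<mu>)
      = (\<integral>x. jacobi_op u x * v x \<partial>\<mu>) + (\<integral>x. carre_du_champ u v x \<partial>\<mu>)"
    by (intro Bochner_Integration.integral_add polynomial_integrable carre_du_champ_polynomial
        real_polynomial_function.intros(4) jacobi_op_polynomial u v)
  finally show ?thesis by simp
qed

lemma carre_du_champ_poly_right:
  assumes "real_polynomial_function u"
  shows "carre_du_champ v (\<lambda>x. poly q (u x)) x = poly (pderiv q) (u x) * carre_du_champ v u x"
  unfolding carre_du_champ_def partial_deriv_poly_compose[OF assms] sum_distrib_left
  by (rule sum.cong) (auto simp: mult_ac)

lemma carre_du_champ_poly_both: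
  assumes "real_polynomial_function u"
  shows "carre_du_champ (\<lambda>x. poly q (u x)) (\<lambda>x. poly q (u x)) x = (poly (pderiv q) (u x))\<^sup>2 * carre_du_champ u u x"
  unfolding carre_du_champ_def partial_deriv_poly_compose[OF assms] sum_distrib_left
  by (rule sum.cong) (auto simp: mult_ac power2_eq_square)

text \<open>
  Dominated convergence; the measure is concentrated on the cube, so the hypotheses are needed only
  there.
\<close>

lemma integral_limit_on_cube:
  assumes F: "\<And>n. F n \<in> borel_measurable \<mu>" and f: "f \<in> borel_measurable \<mu>"
    and lim: "\<And>x. x \<in> cube \<Longrightarrow> (\<lambda>n. F n x) \<longlonglongrightarrow> f x"
    and bd: "\<And>n x. x \<in> cube \<Longrightarrow> \<bar>F n x\<bar> \<le> B"
  shows "(\<lambda>n. \<integral>x. F n x \<partial>\<mu>) \<longlonglongrightarrow> (\<integral>x. f x \<partial>\<mu> :: real)"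
proof (rule integral_dominated_convergence[where w="\<lambda>_. B"])
  show "AE x in \<mu>. (\<lambda>n. F n x) \<longlonglongrightarrow> f x" using AE_cube by eventually_elim (use lim in auto)
  show "AE x in \<mu>. norm (F n x) \<le> B" for n using AE_cube by eventually_elim (use bd in auto)
qed (use F f in auto)

text \<open>
  Integration by parts and the Poincare inequality are available for polynomials. Replacing a function
  \<open>h\<close> of \<open>u\<close> by polynomials in \<open>u\<close>, which approximate together with the derivative, extends them to
  \<open>h (u x)\<close>.
\<close>

lemma C1_compose_approximation:
  fixes h h' :: "real \<Rightarrow> real"
  assumes u: "real_polynomial_function u"
    and deriv: "\<And>y. (h has_real_derivative h' y) (at y)" and cont: "continuous_on UNIV h'"
  shows "\<exists>Q B. \<forall>x\<in>cube. (\<lambda>n. poly (Q n) (u x)) \<longlonglongrightarrow> h (u x)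
      \<and> (\<lambda>n. poly (pderiv (Q n)) (u x)) \<longlonglongrightarrow> h' (u x)
      \<and> (\<forall>n. \<bar>poly (Q n) (u x)\<bar> \<le> B \<and> \<bar>poly (pderiv (Q n)) (u x)\<bar> \<le> B)"
proof -
  have cu: "continuous_on UNIV u" by (rule polynomial_continuous[OF u])
  obtain M where M: "0 \<le> M" "\<And>x. x \<in> cube \<Longrightarrow> \<bar>u x\<bar> \<le> M" using continuous_bounded_on_cube[OF cu] by blast
  have ch: "continuous_on UNIV h"
    by (rule DERIV_continuous_on) (rule has_field_derivative_at_within[OF deriv])
  have chu: "continuous_on UNIV (\<lambda>x. h (u x))" "continuous_on UNIV (\<lambda>x. h' (u x))"
    using continuous_on_compose2[OF ch cu] continuous_on_compose2[OF cont cu] by auto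
  obtain B1 where B1: "0 \<le> B1" "\<And>x. x \<in> cube \<Longrightarrow> \<bar>h (u x)\<bar> \<le> B1" using continuous_bounded_on_cube[OF chu(1)] by blast
  obtain B2 where B2: "0 \<le> B2" "\<And>x. x \<in> cube \<Longrightarrow> \<bar>h' (u x)\<bar> \<le> B2" using continuous_bounded_on_cube[OF chu(2)] by blast
  obtain Q :: "nat \<Rightarrow> real poly" where
    Q: "\<And>n y. \<bar>y\<bar> \<le> M \<Longrightarrow> \<bar>poly (Q n) y - h y\<bar> \<le> M / real (Suc n)"
    and Q': "\<And>n y. \<bar>y\<bar> \<le> M \<Longrightarrow> \<bar>poly (pderiv (Q n)) y - h' y\<bar> \<le> 1 / real (Suc n)"
    using C1_approximation_by_polynomials[OF deriv cont M(1)] by blast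
  have small: "1 / real (Suc n) \<le> 1" "M / real (Suc n) \<le> M" for n
    using divide_left_mono[of 1 "real (Suc n)" M] M(1) by (auto simp: divide_simps)
  show ?thesis
  proof (intro exI[of _ Q] exI[of _ "(B1 + M) + (B2 + 1)"] ballI conjI allI)
    fix x assume x: "x \<in> cube"
    have z: "(\<lambda>n. c / real (Suc n)) \<longlonglongrightarrow> 0" for c
      using tendsto_mult[OF tendsto_const[of c] LIMSEQ_inverse_real_of_nat] by (simp add: divide_inverse)
    have "(\<lambda>n. poly (Q n) (u x) - h (u x)) \<longlonglongrightarrow> 0"
      by (rule Lim_null_comparison[OF _ z[of M]]) (use Q M x in auto)
    then show "(\<lambda>n. poly (Q n) (u x)) \<longlonglongrightarrow> h (u x)" by (simp add: LIM_zero_iff)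
    have "(\<lambda>n. poly (pderiv (Q n)) (u x) - h' (u x)) \<longlonglongrightarrow> 0"
      by (rule Lim_null_comparison[OF _ z[of 1]]) (use Q' M x in auto)
    then show "(\<lambda>n. poly (pderiv (Q n)) (u x)) \<longlonglongrightarrow> h' (u x)" by (simp add: LIM_zero_iff)
    fix n
    show "\<bar>poly (Q n) (u x)\<bar> \<le> (B1 + M) + (B2 + 1)"
      using Q[OF M(2)[OF x], of n] B1(2)[OF x] B2(1) small(2)[of n] by linarith
    show "\<bar>poly (pderiv (Q n)) (u x)\<bar> \<le> (B1 + M) + (B2 + 1)"
      using Q'[OF M(2)[OF x], of n] B2(2)[OF x] B1(1) M(1) small(1)[of n] by linarith
  qed
qed

lemma poly_compose_continuous:
  "real_polynomial_function u \<Longrightarrow> continuous_on UNIV (\<lambda>x::real^'n. poly q (u x))"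
  by (intro polynomial_continuous real_polynomial_function_poly)

lemma integration_by_parts_C1:
  fixes h h' :: "real \<Rightarrow> real"
  assumes u: "real_polynomial_function u"
    and deriv: "\<And>y. (h has_real_derivative h' y) (at y)" and cont: "continuous_on UNIV h'"
  shows "(\<integral>x. - jacobi_op u x * h (u x) \<partial>\<mu>) = (\<integral>x. h' (u x) * carre_du_champ u u x \<partial>\<mu>)"
proof -
  obtain Q B where QB: "\<forall>x\<in>cube. (\<lambda>n. poly (Q n) (u x)) \<longlonglongrightarrow> h (u x)
      \<and> (\<lambda>n. poly (pderiv (Q n)) (u x)) \<longlonglongrightarrow> h' (u x)
      \<and> (\<forall>n. \<bar>poly (Q n) (u x)\<bar> \<le> B \<and> \<bar>poly (pderiv (Q n)) (u x)\<bar> \<le> B)"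
    using C1_compose_approximation[OF u deriv cont] by blast
  have Q: "(\<lambda>n. poly (Q n) (u x)) \<longlonglongrightarrow> h (u x)" "(\<lambda>n. poly (pderiv (Q n)) (u x)) \<longlonglongrightarrow> h' (u x)"
    "\<bar>poly (Q n) (u x)\<bar> \<le> B" "\<bar>poly (pderiv (Q n)) (u x)\<bar> \<le> B" if "x \<in> cube" for n x
    using bspec[OF QB that] by auto
  have cu: "continuous_on UNIV u" by (rule polynomial_continuous[OF u])
  have ch: "continuous_on UNIV h"
    by (rule DERIV_continuous_on) (rule has_field_derivative_at_within[OF deriv])
  have chu: "continuous_on UNIV (\<lambda>x. h (u x))" "continuous_on UNIV (\<lambda>x. h' (u x))"
    using continuous_on_compose2[OF ch cu] continuous_on_compose2[OF cont cu] by auto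
  have cL: "continuous_on UNIV (jacobi_op u)" by (rule polynomial_continuous[OF jacobi_op_polynomial[OF u]])
  have cG: "continuous_on UNIV (carre_du_champ u u)" by (rule polynomial_continuous[OF carre_du_champ_polynomial[OF u u]])
  obtain C where C: "0 \<le> C" "\<And>x. x \<in> cube \<Longrightarrow> \<bar>jacobi_op u x\<bar> \<le> C" using continuous_bounded_on_cube[OF cL] by blast
  obtain D where D: "0 \<le> D" "\<And>x. x \<in> cube \<Longrightarrow> \<bar>carre_du_champ u u x\<bar> \<le> D" using continuous_bounded_on_cube[OF cG] by blast
  have "0 \<in> cube" by simp
  then have B: "0 \<le> B" using Q(3)[of 0 0] abs_ge_zero order_trans by blast
  note pc = poly_compose_continuous[OF u]
  have "(\<lambda>n. \<integral>x. - jacobi_op u x * poly (Q n) (u x) \<partial>\<mu>) \<longlonglongrightarrow> (\<integral>x. - jacobi_op u x * h (u x) \<partial>\<mu>)"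
  proof (rule integral_limit_on_cube[where B="C * B"])
    show "\<bar>- jacobi_op u x * poly (Q n) (u x)\<bar> \<le> C * B" if "x \<in> cube" for n x
      unfolding abs_mult abs_minus_cancel using C Q(3) that by (intro mult_mono) auto
  qed (intro continuous_measurable continuous_intros cL chu pc tendsto_mult tendsto_const Q(1); assumption)+
  moreover have "(\<lambda>n. \<integral>x. poly (pderiv (Q n)) (u x) * carre_du_champ u u x \<partial>\<mu>) \<longlonglongrightarrow> (\<integral>x. h' (u x) * carre_du_champ u u x \<partial>\<mu>)"
  proof (rule integral_limit_on_cube[where B="B * D"])
    show "\<bar>poly (pderiv (Q n)) (u x) * carre_du_champ u u x\<bar> \<le> B * D" if "x \<in> cube" for n x
      unfolding abs_mult using B D Q(4)[OF that] that by (intro mult_mono) auto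
  qed (intro continuous_measurable continuous_intros cG chu pc tendsto_mult tendsto_const Q(2); assumption)+
  moreover have "(\<integral>x. - jacobi_op u x * poly (Q n) (u x) \<partial>\<mu>) = (\<integral>x. poly (pderiv (Q n)) (u x) * carre_du_champ u u x \<partial>\<mu>)" for n
    by (simp only: integration_by_parts[OF u real_polynomial_function_poly[OF u]] carre_du_champ_poly_right[OF u])
  ultimately show ?thesis by (auto dest: LIMSEQ_unique)
qed

lemma integral_comb_mult:
  assumes "finite K"
  shows "(\<integral>x. comb K c x * comb K d x \<partial>\<mu>) = (\<Sum>\<kappa>\<in>K. c \<kappa> * d \<kappa>)"
proof -
  have "(\<integral>x. comb K c x * comb K d x \<partial>\<mu>) = (\<integral>x. (\<Sum>\<kappa>\<in>K. d \<kappa> * (comb K c x * \<phi> \<kappa> x)) \<partial>\<mu>)"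
    by (simp add: comb_def[of K d] sum_distrib_left mult_ac)
  also have "\<dots> = (\<Sum>\<kappa>\<in>K. d \<kappa> * (\<integral>x. comb K c x * \<phi> \<kappa> x \<partial>\<mu>))"
    by (subst Bochner_Integration.integral_sum)
       (auto intro!: polynomial_integrable real_polynomial_function.intros(2-4) polyvec_polynomial comb_polynomial assms)
  also have "\<dots> = (\<Sum>\<kappa>\<in>K. c \<kappa> * d \<kappa>)"
    by (rule sum.cong) (use coeff_comb[OF assms, of c] in \<open>auto simp: jacobi_coeff_def\<close>)
  finally show ?thesis .
qed

lemma coef_0: "coef f 0 = (\<integral>x. f x \<partial>\<mu>)"
  by (simp add: jacobi_coeff_def polyvec_0)

text \<open>
  Parseval's identity turns the two sides into the sums of \<open>c\<^sup>2\<close> and \<open>ev \<kappa> * c\<^sup>2\<close> over the coefficients \<open>c\<close>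
  with \<open>\<kappa> \<noteq> 0\<close>, and there \<open>ev \<kappa> \<ge> 1\<close>.
\<close>

lemma Poincare_polynomial:
  assumes v: "real_polynomial_function v"
  shows "(\<integral>x. (v x - (\<integral>y. v y \<partial>\<mu>))\<^sup>2 \<partial>\<mu>) \<le> (\<integral>x. carre_du_champ v v x \<partial>\<mu>)"
proof -
  obtain K where K: "finite K" "\<And>\<kappa>. \<kappa> \<notin> K \<Longrightarrow> coef v \<kappa> = 0" "v = comb K (coef v)"
    using polynomial_expansion[OF v] by blast
  define L where "L = insert 0 K"
  have L: "finite L" "0 \<in> L" "v = comb L (coef v)"
    using K comb_mono_neutral[of L K "coef v"] by (auto simp: L_def)
  define d where "d \<kappa> = (if \<kappa> = 0 then 0 else coef v \<kappa>)" for \<kappa>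
  have "v x - (\<integral>y. v y \<partial>\<mu>) = comb L d x" for x
  proof -
    have "comb L (coef v) x = coef v 0 * \<phi> 0 x + (\<Sum>\<kappa>\<in>L - {0}. coef v \<kappa> * \<phi> \<kappa> x)"
      unfolding comb_def using L by (subst sum.remove[of _ 0]) auto
    moreover have "comb L d x = (\<Sum>\<kappa>\<in>L - {0}. coef v \<kappa> * \<phi> \<kappa> x)"
      unfolding comb_def using L by (subst sum.remove[of _ 0]) (auto simp: d_def intro: sum.cong)
    ultimately show ?thesis using fun_cong[OF L(3), of x] by (simp add: coef_0 polyvec_0)
  qed
  then have "(\<integral>x. (v x - (\<integral>y. v y \<partial>\<mu>))\<^sup>2 \<partial>\<mu>) = (\<Sum>\<kappa>\<in>L. d \<kappa> * d \<kappa>)"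
    by (simp add: power2_eq_square integral_comb_mult[OF L(1)])
  also have "\<dots> \<le> (\<Sum>\<kappa>\<in>L. (ev \<kappa> * coef v \<kappa>) * coef v \<kappa>)"
  proof (rule sum_mono)
    fix \<kappa>
    have "1 * (coef v \<kappa> * coef v \<kappa>) \<le> ev \<kappa> * (coef v \<kappa> * coef v \<kappa>)" if "\<kappa> \<noteq> 0"
      using eigenvalue_ge_1[OF that] by (intro mult_right_mono) auto
    then show "d \<kappa> * d \<kappa> \<le> (ev \<kappa> * coef v \<kappa>) * coef v \<kappa>"
      by (auto simp: d_def eigenvalue_0 mult.assoc)
  qed
  also have "\<dots> = (\<integral>x. comb L (\<lambda>\<kappa>. ev \<kappa> * coef v \<kappa>) x * comb L (coef v) x \<partial>\<mu>)"
    by (simp add: integral_comb_mult[OF L(1)])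
  also have "\<dots> = (\<integral>x. - jacobi_op v x * v x \<partial>\<mu>)"
  proof -
    have "jacobi_op v x = - comb L (\<lambda>\<kappa>. ev \<kappa> * coef v \<kappa>) x" for x
      using jacobi_op_comb[OF L(1), of "coef v" x] L(3) by (simp add: comb_def sum_negf)
    then show ?thesis using L(3) by simp
  qed
  also have "\<dots> = (\<integral>x. carre_du_champ v v x \<partial>\<mu>)" by (rule integration_by_parts[OF v v])
  finally show ?thesis .
qed

lemma Poincare_C1:
  fixes h h' :: "real \<Rightarrow> real"
  assumes u: "real_polynomial_function u"
    and deriv: "\<And>y. (h has_real_derivative h' y) (at y)" and cont: "continuous_on UNIV h'"
  shows "(\<integral>x. (h (u x) - (\<integral>y. h (u y) \<partial>\<mu>))\<^sup>2 \<partial>\<mu>) \<le> (\<integral>x. (h' (u x))\<^sup>2 * carre_du_champ u u x \<partial>\<mu>)"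
proof -
  obtain Q B where QB: "\<forall>x\<in>cube. (\<lambda>n. poly (Q n) (u x)) \<longlonglongrightarrow> h (u x)
      \<and> (\<lambda>n. poly (pderiv (Q n)) (u x)) \<longlonglongrightarrow> h' (u x)
      \<and> (\<forall>n. \<bar>poly (Q n) (u x)\<bar> \<le> B \<and> \<bar>poly (pderiv (Q n)) (u x)\<bar> \<le> B)"
    using C1_compose_approximation[OF u deriv cont] by blast
  have Q: "(\<lambda>n. poly (Q n) (u x)) \<longlonglongrightarrow> h (u x)" "(\<lambda>n. poly (pderiv (Q n)) (u x)) \<longlonglongrightarrow> h' (u x)"
    "\<bar>poly (Q n) (u x)\<bar> \<le> B" "\<bar>poly (pderiv (Q n)) (u x)\<bar> \<le> B" if "x \<in> cube" for n x
    using bspec[OF QB that] by auto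
  have cu: "continuous_on UNIV u" by (rule polynomial_continuous[OF u])
  have ch: "continuous_on UNIV h"
    by (rule DERIV_continuous_on) (rule has_field_derivative_at_within[OF deriv])
  have chu: "continuous_on UNIV (\<lambda>x. h (u x))" "continuous_on UNIV (\<lambda>x. h' (u x))"
    using continuous_on_compose2[OF ch cu] continuous_on_compose2[OF cont cu] by auto
  have cG: "continuous_on UNIV (carre_du_champ u u)" by (rule polynomial_continuous[OF carre_du_champ_polynomial[OF u u]])
  obtain D where D: "0 \<le> D" "\<And>x. x \<in> cube \<Longrightarrow> \<bar>carre_du_champ u u x\<bar> \<le> D" using continuous_bounded_on_cube[OF cG] by blast
  have "0 \<in> cube" by simp
  then have B: "0 \<le> B" using Q(3)[of 0 0] abs_ge_zero order_trans by blast
  note pc = poly_compose_continuous[OF u]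
  have m: "(\<lambda>n. \<integral>y. poly (Q n) (u y) \<partial>\<mu>) \<longlonglongrightarrow> (\<integral>y. h (u y) \<partial>\<mu>)"
    by (rule integral_limit_on_cube[where B=B]) (intro continuous_measurable pc chu Q; assumption)+
  have mB: "\<bar>\<integral>y. poly (Q n) (u y) \<partial>\<mu>\<bar> \<le> B" for n
  proof -
    have "AE x in \<mu>. \<bar>poly (Q n) (u x)\<bar> \<le> B" using AE_cube by eventually_elim (use Q(3) in simp)
    then have "Lp_norm \<mu> 1 (\<lambda>x. poly (Q n) (u x)) \<le> B"
      using B by (intro Lp_norm_le_of_bounded continuous_measurable pc) auto
    then show ?thesis using abs_integral_le_Lp_norm[OF _ continuous_Lp[OF pc[of "Q n"]], of 1] by auto
  qed
  have "(\<lambda>n. \<integral>x. (poly (Q n) (u x) - (\<integral>y. poly (Q n) (u y) \<partial>\<mu>))\<^sup>2 \<partial>\<mu>)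
      \<longlonglongrightarrow> (\<integral>x. (h (u x) - (\<integral>y. h (u y) \<partial>\<mu>))\<^sup>2 \<partial>\<mu>)"
  proof (rule integral_limit_on_cube[where B="(2 * B)\<^sup>2"])
    show "\<bar>(poly (Q n) (u x) - (\<integral>y. poly (Q n) (u y) \<partial>\<mu>))\<^sup>2\<bar> \<le> (2 * B)\<^sup>2" if "x \<in> cube" for n x
    proof -
      have "\<bar>poly (Q n) (u x) - (\<integral>y. poly (Q n) (u y) \<partial>\<mu>)\<bar> \<le> 2 * B"
        using Q(3)[OF that, of n] mB[of n] by linarith
      then show ?thesis using abs_le_square_iff B by (metis abs_of_nonneg abs_power2 mult_nonneg_nonneg zero_le_numeral)
    qed
  qed (intro continuous_measurable continuous_intros pc chu tendsto_power tendsto_diff Q(1) m; assumption)+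
  moreover have "(\<lambda>n. \<integral>x. (poly (pderiv (Q n)) (u x))\<^sup>2 * carre_du_champ u u x \<partial>\<mu>)
      \<longlonglongrightarrow> (\<integral>x. (h' (u x))\<^sup>2 * carre_du_champ u u x \<partial>\<mu>)"
  proof (rule integral_limit_on_cube[where B="B\<^sup>2 * D"])
    show "\<bar>(poly (pderiv (Q n)) (u x))\<^sup>2 * carre_du_champ u u x\<bar> \<le> B\<^sup>2 * D" if "x \<in> cube" for n x
      unfolding abs_mult abs_power2 using D Q(4)[OF that, of n] that
      by (intro mult_mono) (auto simp: abs_le_square_iff[symmetric])
  qed (intro continuous_measurable continuous_intros pc chu cG tendsto_mult tendsto_power tendsto_const Q(2); assumption)+
  moreover have "(\<integral>x. (poly (Q n) (u x) - (\<integral>y. poly (Q n) (u y) \<partial>\<mu>))\<^sup>2 \<partial>\<mu>)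
      \<le> (\<integral>x. (poly (pderiv (Q n)) (u x))\<^sup>2 * carre_du_champ u u x \<partial>\<mu>)" for n
    using Poincare_polynomial[OF real_polynomial_function_poly[OF u], of "Q n"]
    by (simp only: carre_du_champ_poly_both[OF u])
  ultimately show ?thesis by (blast intro: LIMSEQ_le)
qed

end

section \<open>Spectral multipliers on polynomials\<close>

definition signed_powr :: "real \<Rightarrow> real \<Rightarrow> real" where
  "signed_powr s y = sgn y * \<bar>y\<bar> powr s"

text \<open>
  The value \<open>0 powr 0 = 0\<close> would make \<open>\<bar>y\<bar> powr r\<close> discontinuous for \<open>r = 0\<close>, which is the case \<open>p = 2\<close> of the energy
  estimate; so \<open>r = 0\<close> is treated separately.
\<close>

definition abs_powr :: "real \<Rightarrow> real \<Rightarrow> real" where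
  "abs_powr r y = (if r = 0 then 1 else \<bar>y\<bar> powr r)"

lemma abs_signed_powr: "\<bar>signed_powr s y\<bar> = \<bar>y\<bar> powr s"
  by (simp add: signed_powr_def abs_mult abs_sgn_eq)

lemma mult_signed_powr: "y * signed_powr s y = \<bar>y\<bar> powr (s + 1)"
proof -
  have "y * signed_powr s y = \<bar>y\<bar> * \<bar>y\<bar> powr s" by (simp add: signed_powr_def mult.assoc[symmetric] flip: abs_sgn)
  then show ?thesis by (simp add: powr_add mult.commute)
qed

lemma signed_powr_inverse: "0 < s \<Longrightarrow> signed_powr s (signed_powr (1 / s) y) = y"
  by (cases y "0::real" rule: linorder_cases) (auto simp: signed_powr_def powr_powr abs_mult sgn_mult)

lemma abs_powr_continuous:
  assumes "0 \<le> r" shows "continuous_on UNIV (abs_powr r)"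
proof (cases "r = 0")
  case True
  then show ?thesis by (simp add: abs_powr_def[abs_def])
next
  case False
  then have "continuous_on UNIV (\<lambda>y::real. \<bar>y\<bar> powr r)"
    using assms by (intro continuous_on_powr' continuous_intros) auto
  then show ?thesis using False by (simp add: abs_powr_def[abs_def])
qed

lemma abs_powr_half_square: "(abs_powr (r / 2) y)\<^sup>2 = abs_powr r y"
  by (auto simp: abs_powr_def power2_eq_square simp flip: powr_add)

lemma continuous_on_signed_powr:
  assumes "0 < s" shows "continuous_on UNIV (signed_powr s)"
proof -
  have eq: "signed_powr s = (\<lambda>y. max y 0 powr s - max (- y) 0 powr s)"
    by (rule ext) (auto simp: signed_powr_def max_def sgn_if)
  show ?thesis unfolding eq
    using assms by (intro continuous_on_powr' continuous_intros) auto
qed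

lemma signed_powr_has_derivative:
  assumes s: "1 \<le> s" shows "(signed_powr s has_real_derivative s * abs_powr (s - 1) y) (at y)"
proof -
  have abs_powr_nz: "abs_powr (s - 1) z = \<bar>z\<bar> powr (s - 1)" if "z \<noteq> 0" for z
    using that by (simp add: abs_powr_def)
  consider "0 < y" | "y < 0" | "y = 0" by linarith
  then show ?thesis
  proof cases
    case 1
    have "((\<lambda>y. y powr s) has_real_derivative s * abs_powr (s - 1) y) (at y)"
      using has_real_derivative_powr[OF 1, of s] 1 abs_powr_nz[of y] by simp
    then show ?thesis
      by (rule has_field_derivative_transform_within_open[of _ _ _ "{0<..}"])
         (use 1 in \<open>auto simp: signed_powr_def\<close>)
  next
    case 2
    have "((\<lambda>y. - ((- y) powr s)) has_real_derivative - (s * (- y) powr (s - 1) * - 1)) (at y)"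
      by (rule DERIV_minus[OF DERIV_chain2[OF has_real_derivative_powr DERIV_minus[OF DERIV_ident]]])
         (use 2 in simp)
    then have "((\<lambda>y. - ((- y) powr s)) has_real_derivative s * abs_powr (s - 1) y) (at y)"
      using 2 abs_powr_nz[of y] by simp
    then show ?thesis
      by (rule has_field_derivative_transform_within_open[of _ _ _ "{..<0}"])
         (use 2 in \<open>auto simp: signed_powr_def\<close>)
  next
    case 3
    have lim: "abs_powr (s - 1) \<midarrow>0\<rightarrow> abs_powr (s - 1) 0"
      using abs_powr_continuous[of "s - 1"] s by (simp add: continuous_on_eq_continuous_at isCont_def)
    have quot: "(signed_powr s h - signed_powr s 0) / h = abs_powr (s - 1) h" if "h \<noteq> 0" for h
    proof -
      have "\<bar>h\<bar> powr s = \<bar>h\<bar> powr (s - 1) * \<bar>h\<bar>" using that by (simp add: powr_diff)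
      then have "signed_powr s h = (sgn h * \<bar>h\<bar>) * \<bar>h\<bar> powr (s - 1)" by (simp add: signed_powr_def)
      also have "sgn h * \<bar>h\<bar> = h" by (rule sgn_mult_abs)
      finally show ?thesis using that abs_powr_nz[OF that] by (simp add: signed_powr_def[of s 0])
    qed
    have "\<forall>\<^sub>F h in at 0. abs_powr (s - 1) h = (signed_powr s h - signed_powr s 0) / h"
      unfolding eventually_at_filter by (rule always_eventually) (simp add: quot)
    with lim have "(\<lambda>h. (signed_powr s h - signed_powr s 0) / h) \<midarrow>0\<rightarrow> abs_powr (s - 1) 0"
      by (rule Lim_transform_eventually)
    moreover have "s * abs_powr (s - 1) 0 = abs_powr (s - 1) 0"
      by (simp add: abs_powr_def)
    ultimately show ?thesis by (simp only: 3 DERIV_def add_0)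
  qed
qed

lemma powr_add_le_of_ge_1:
  fixes a b s :: real
  assumes "1 \<le> s" "0 \<le> a" "0 \<le> b" shows "a powr s + b powr s \<le> (a + b) powr s"
proof (cases "a + b = 0")
  case False
  then have pos: "0 < a + b" using assms by simp
  have bound: "t powr s \<le> (a + b) powr (s - 1) * t" if "0 \<le> t" "t \<le> a + b" for t
  proof (cases "t = 0")
    case False
    then have "t powr s = t powr (s - 1) * t" using that by (simp add: powr_diff)
    also have "\<dots> \<le> (a + b) powr (s - 1) * t"
      using that assms by (intro mult_right_mono powr_mono2) auto
    finally show ?thesis .
  qed simp
  have "a powr s + b powr s \<le> (a + b) powr (s - 1) * a + (a + b) powr (s - 1) * b"
    using assms by (intro add_mono bound) auto
  also have "\<dots> = (a + b) powr (s - 1) * (a + b)" by (simp add: distrib_left)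
  also have "\<dots> = (a + b) powr s" using pos by (simp add: powr_diff)
  finally show ?thesis .
next
  case True
  then have "a = 0" "b = 0" using assms by linarith+
  then show ?thesis by simp
qed

text \<open>
  For equal signs this is the superadditivity of \<open>t powr s\<close>, for opposite signs the bound of a sum by
  twice the maximum.
\<close>

lemma abs_diff_powr_le_signed_powr:
  assumes s: "1 \<le> s" shows "\<bar>a - b\<bar> powr s \<le> 2 powr s * \<bar>signed_powr s a - signed_powr s b\<bar>"
proof -
  have one: "1 \<le> (2::real) powr s" using s by (intro ge_one_powr_ge_zero) auto
  have same: "(x - y) powr s \<le> 2 powr s * \<bar>x powr s - y powr s\<bar>" if "0 \<le> y" "y \<le> x" for x y
  proof -
    have "(x - y) powr s \<le> x powr s - y powr s"
      using powr_add_le_of_ge_1[OF s, of "x - y" y] that by simp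
    also have "\<dots> \<le> 2 powr s * \<bar>x powr s - y powr s\<bar>"
    proof -
      have "1 * \<bar>x powr s - y powr s\<bar> \<le> 2 powr s * \<bar>x powr s - y powr s\<bar>"
        using one by (intro mult_right_mono) auto
      then show ?thesis unfolding mult_1 by (rule order_trans[OF abs_ge_self])
    qed
    finally show ?thesis .
  qed
  have opp: "(x + y) powr s \<le> 2 powr s * (x powr s + y powr s)" if "0 \<le> x" "0 \<le> y" for x y
    using abs_add_powr_le[OF s, of x y] that by simp
  have pos: "signed_powr s x = x powr s" if "0 \<le> x" for x
    using that by (cases "x = 0") (simp_all add: signed_powr_def)
  have neg: "signed_powr s x = - ((- x) powr s)" if "x \<le> 0" for x
    using that by (cases "x = 0") (simp_all add: signed_powr_def)
  have ordered: "(x - y) powr s \<le> 2 powr s * \<bar>signed_powr s x - signed_powr s y\<bar>" if "y \<le> x" for x y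
  proof -
    consider "0 \<le> y" | "x \<le> 0" | "y \<le> 0" "0 \<le> x" by linarith
    then show ?thesis
    proof cases
      case 1
      then show ?thesis using same[of y x] that by (simp add: pos)
    next
      case 2
      then show ?thesis using same[of "- x" "- y"] that by (simp add: neg)
    next
      case 3
      have "0 \<le> x powr s + (- y) powr s" by simp
      then show ?thesis using opp[of x "- y"] 3 by (simp add: pos neg)
    qed
  qed
  show ?thesis
  proof (cases "b \<le> a")
    case True
    then show ?thesis using ordered[of b a] by simp
  next
    case False
    then show ?thesis using ordered[of a b] by (simp add: abs_minus_commute[of a b] abs_minus_commute[of "signed_powr s a"])
  qed
qed

context jacobi
begin

lemma prob_UNIV [simp]: "prob UNIV = 1"
  using prob_space by simp

text \<open>
  The Poincare inequality is applied to \<open>G u\<close>, where \<open>G y = sgn y * \<bar>y\<bar> powr (p / 2)\<close>; its right-hand side is a multiple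
  of the energy, because the square of \<open>G'\<close> is a multiple of the derivative of \<open>signed_powr (p - 1)\<close>. The
  mean of \<open>G u\<close> is \<open>G n\<close> for some constant \<open>n\<close>, and \<open>\<bar>u - n\<bar> powr p\<close> is at most a multiple of \<open>(G u - G n)\<^sup>2\<close>. Finally
  \<open>u\<close> has mean zero, so \<open>\<bar>n\<bar>\<close>, the absolute value of the mean of \<open>u - n\<close>, is bounded by the norm of \<open>u - n\<close>,
  and \<open>n\<close> can be removed.
\<close>

lemma integral_powr_le_energy:
  assumes p: "2 \<le> p" and u: "real_polynomial_function u" and mean: "(\<integral>x. u x \<partial>\<mu>) = 0"
  shows "(\<integral>x. \<bar>u x\<bar> powr p \<partial>\<mu>)
    \<le> 4 powr p * (p\<^sup>2 / (4 * (p - 1))) * (\<integral>x. - jacobi_op u x * signed_powr (p - 1) (u x) \<partial>\<mu>)"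
proof -
  define s where "s = p / 2"
  have s: "1 \<le> s" "2 * s = p" using p by (auto simp: s_def)
  define G where "G = signed_powr s"
  define m where "m = (\<integral>x. G (u x) \<partial>\<mu>)"
  \<comment> \<open>\<open>G\<close> is a bijection, so its mean along \<open>u\<close> is a value of \<open>G\<close>\<close>
  define n where "n = signed_powr (1 / s) m"
  have n: "G n = m" using s by (simp add: n_def G_def signed_powr_inverse)
  have cu: "continuous_on UNIV u" by (rule polynomial_continuous[OF u])
  have cG: "continuous_on UNIV (\<lambda>x. G (u x))"
    unfolding G_def using continuous_on_compose2[OF continuous_on_signed_powr cu] s by auto
  have uL: "u \<in> Lp_space \<mu> p" using continuous_Lp[OF cu] p by simp
  have unL: "(\<lambda>x. u x - n) \<in> Lp_space \<mu> p" using p by (intro continuous_Lp continuous_intros cu) auto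
  have "(\<integral>x. \<bar>u x - n\<bar> powr p \<partial>\<mu>) \<le> (\<integral>x. 2 powr p * (G (u x) - m)\<^sup>2 \<partial>\<mu>)"
  proof (rule integral_mono)
    show "integrable \<mu> (\<lambda>x. \<bar>u x - n\<bar> powr p)" using unL by (simp add: Lp_space_def)
    show "integrable \<mu> (\<lambda>x. 2 powr p * (G (u x) - m)\<^sup>2)"
      by (intro continuous_integrable continuous_intros cG)
    fix x
    have sq: "(t powr s)\<^sup>2 = t powr p" for t :: real
      using s by (simp add: power2_eq_square flip: powr_add)
    have "(\<bar>u x - n\<bar> powr s)\<^sup>2 \<le> (2 powr s * \<bar>G (u x) - G n\<bar>)\<^sup>2"
      unfolding G_def by (intro power_mono abs_diff_powr_le_signed_powr s) auto
    then show "\<bar>u x - n\<bar> powr p \<le> 2 powr p * (G (u x) - m)\<^sup>2"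
      unfolding power_mult_distrib sq n by simp
  qed
  also have "\<dots> = 2 powr p * (\<integral>x. (G (u x) - m)\<^sup>2 \<partial>\<mu>)" by simp
  also have "\<dots> \<le> 2 powr p * (\<integral>x. (s * abs_powr (s - 1) (u x))\<^sup>2 * carre_du_champ u u x \<partial>\<mu>)"
    unfolding G_def m_def
    using s by (intro mult_left_mono Poincare_C1[OF u signed_powr_has_derivative] continuous_intros abs_powr_continuous) auto
  also have "(\<lambda>x. (s * abs_powr (s - 1) (u x))\<^sup>2 * carre_du_champ u u x)
      = (\<lambda>x. (s\<^sup>2 / (p - 1)) * (((p - 1) * abs_powr (p - 2) (u x)) * carre_du_champ u u x))"
  proof
    fix x
    have "s - 1 = (p - 2) / 2" by (simp add: s_def)
    then have "(s * abs_powr (s - 1) (u x))\<^sup>2 = s\<^sup>2 * abs_powr (p - 2) (u x)"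
      by (simp only: power_mult_distrib abs_powr_half_square)
    then show "(s * abs_powr (s - 1) (u x))\<^sup>2 * carre_du_champ u u x
        = (s\<^sup>2 / (p - 1)) * (((p - 1) * abs_powr (p - 2) (u x)) * carre_du_champ u u x)"
      using p by simp
  qed
  also have "(\<integral>x. (s\<^sup>2 / (p - 1)) * (((p - 1) * abs_powr (p - 2) (u x)) * carre_du_champ u u x) \<partial>\<mu>)
      = (s\<^sup>2 / (p - 1)) * (\<integral>x. ((p - 1) * abs_powr (p - 2) (u x)) * carre_du_champ u u x \<partial>\<mu>)" by (rule integral_mult_right_zero)
  also have "(\<integral>x. ((p - 1) * abs_powr (p - 2) (u x)) * carre_du_champ u u x \<partial>\<mu>)
      = (\<integral>x. - jacobi_op u x * signed_powr (p - 1) (u x) \<partial>\<mu>)"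
  proof (rule integration_by_parts_C1[symmetric, OF u])
    show "(signed_powr (p - 1) has_real_derivative (p - 1) * abs_powr (p - 2) y) (at y)" for y
      using signed_powr_has_derivative[of "p - 1" y] p by simp
    show "continuous_on UNIV (\<lambda>y. (p - 1) * abs_powr (p - 2) y)"
      using p by (intro continuous_intros abs_powr_continuous) auto
  qed
  finally have main: "(\<integral>x. \<bar>u x - n\<bar> powr p \<partial>\<mu>)
    \<le> 2 powr p * ((s\<^sup>2 / (p - 1)) * (\<integral>x. - jacobi_op u x * signed_powr (p - 1) (u x) \<partial>\<mu>))" .
  have "Lp_norm \<mu> p u \<le> 2 * Lp_norm \<mu> p (\<lambda>x. u x - n)"
  proof -
    have "(\<integral>x. u x - n \<partial>\<mu>) = - n"
      using mean continuous_integrable[OF cu] by (simp add: prob_space)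
    then have "\<bar>n\<bar> \<le> Lp_norm \<mu> p (\<lambda>x. u x - n)"
      using abs_integral_le_Lp_norm[OF _ unL] p by simp
    moreover have "Lp_norm \<mu> p (\<lambda>x. (u x - n) + n) \<le> Lp_norm \<mu> p (\<lambda>x. u x - n) + \<bar>n\<bar>"
      using Lp_norm_triangle[OF _ unL Lp_space_const[of p n]] p by (simp add: Lp_norm_const)
    ultimately show ?thesis by simp
  qed
  then have "Lp_norm \<mu> p u powr p \<le> (2 * Lp_norm \<mu> p (\<lambda>x. u x - n)) powr p"
    using p by (intro powr_mono2) auto
  then have "(\<integral>x. \<bar>u x\<bar> powr p \<partial>\<mu>) \<le> 2 powr p * (\<integral>x. \<bar>u x - n\<bar> powr p \<partial>\<mu>)"
    using p by (simp add: Lp_norm_powr powr_mult)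
  also have "\<dots> \<le> 2 powr p * (2 powr p * ((s\<^sup>2 / (p - 1)) * (\<integral>x. - jacobi_op u x * signed_powr (p - 1) (u x) \<partial>\<mu>)))"
    by (intro mult_left_mono main) auto
  also have "\<dots> = 4 powr p * (p\<^sup>2 / (4 * (p - 1))) * (\<integral>x. - jacobi_op u x * signed_powr (p - 1) (u x) \<partial>\<mu>)"
    using powr_mult[of 2 2 p] by (simp add: s_def power_divide)
  finally show ?thesis .
qed

text \<open>
  The inverse of the constant in the energy estimate.
\<close>

definition gap :: "real \<Rightarrow> real" where
  "gap p = 1 / (4 powr p * (p\<^sup>2 / (4 * (p - 1))))"

lemma gap_pos: "2 \<le> p \<Longrightarrow> 0 < gap p"
  unfolding gap_def by (intro divide_pos_pos mult_pos_pos) auto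

text \<open>
  Test \<open>u - e * jacobi_op u\<close> against \<open>signed_powr (p - 1) (u x)\<close>: from below by the energy estimate, from above by
  Hoelder's inequality, where the norm of the test function is the norm of \<open>u\<close> to the power \<open>p - 1\<close>.
\<close>

lemma resolvent_gap:
  assumes p: "2 \<le> p" and u: "real_polynomial_function u" and mean: "(\<integral>x. u x \<partial>\<mu>) = 0" and e: "0 \<le> e"
  shows "(1 + e * gap p) * Lp_norm \<mu> p u \<le> Lp_norm \<mu> p (\<lambda>x. u x - e * jacobi_op u x)"
proof (cases "Lp_norm \<mu> p u = 0")
  case False
  then have pos: "0 < Lp_norm \<mu> p u" by (simp add: order.not_eq_order_implies_strict)
  let ?f = "\<lambda>x. u x - e * jacobi_op u x"
  define q where "q = p / (p - 1)"
  have q: "1 < q" "1 / p + 1 / q = 1" "(p - 1) * q = p" using p by (auto simp: q_def field_simps)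
  have cu: "continuous_on UNIV u" by (rule polynomial_continuous[OF u])
  have cL: "continuous_on UNIV (jacobi_op u)" by (rule polynomial_continuous[OF jacobi_op_polynomial[OF u]])
  have cs: "continuous_on UNIV (\<lambda>x. signed_powr (p - 1) (u x))"
    using continuous_on_compose2[OF continuous_on_signed_powr cu] p by auto
  have fL: "?f \<in> Lp_space \<mu> p" using p by (intro continuous_Lp continuous_intros cu cL) auto
  have sL: "(\<lambda>x. signed_powr (p - 1) (u x)) \<in> Lp_space \<mu> q" using q by (intro continuous_Lp cs) auto
  define N where "N = Lp_norm \<mu> p u"
  have Np: "(\<integral>x. \<bar>u x\<bar> powr p \<partial>\<mu>) = N powr p" using p by (simp add: N_def Lp_norm_powr)
  have snorm: "Lp_norm \<mu> q (\<lambda>x. signed_powr (p - 1) (u x)) = N powr (p - 1)"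
  proof -
    have "Lp_norm \<mu> q (\<lambda>x. signed_powr (p - 1) (u x)) = (N powr p) powr (1 / q)"
      unfolding Lp_norm_def abs_signed_powr powr_powr q(3) Np ..
    also have "p * (1 / q) = p - 1" using p by (simp add: q_def)
    then have "(N powr p) powr (1 / q) = N powr (p - 1)" by (simp only: powr_powr)
    finally show ?thesis .
  qed
  have energy: "gap p * N powr p \<le> (\<integral>x. - jacobi_op u x * signed_powr (p - 1) (u x) \<partial>\<mu>)"
  proof -
    define C where "C = 4 powr p * (p\<^sup>2 / (4 * (p - 1)))"
    have C: "0 < C" unfolding C_def using p by (intro mult_pos_pos divide_pos_pos) auto
    show ?thesis
      using integral_powr_le_energy[OF p u mean] C unfolding Np gap_def C_def[symmetric]
      by (simp add: divide_simps mult.commute)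
  qed
  have "(1 + e * gap p) * N powr p \<le> N powr p + e * (\<integral>x. - jacobi_op u x * signed_powr (p - 1) (u x) \<partial>\<mu>)"
    using mult_left_mono[OF energy e] by (simp add: algebra_simps)
  also have "\<dots> = (\<integral>x. \<bar>u x\<bar> powr p + e * (- jacobi_op u x * signed_powr (p - 1) (u x)) \<partial>\<mu>)"
    unfolding Np[symmetric] using continuous_Lp[OF cu, of p] p
    by (subst Bochner_Integration.integral_add)
       (auto simp: Lp_space_def intro!: continuous_integrable continuous_intros cL cs)
  also have "\<dots> = (\<integral>x. ?f x * signed_powr (p - 1) (u x) \<partial>\<mu>)"
  proof -
    have "\<bar>u x\<bar> powr p + e * (- jacobi_op u x * signed_powr (p - 1) (u x)) = ?f x * signed_powr (p - 1) (u x)" for x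
      using mult_signed_powr[of "u x" "p - 1"] by (simp add: algebra_simps)
    then show ?thesis by simp
  qed
  also have "\<dots> \<le> Lp_norm \<mu> p ?f * N powr (p - 1)"
    using Hoelder_inequality(2)[OF _ q(1,2) fL sL] p by (simp add: snorm)
  finally have "(1 + e * gap p) * N * N powr (p - 1) \<le> Lp_norm \<mu> p ?f * N powr (p - 1)"
    using pos by (simp add: N_def powr_diff)
  then show ?thesis using pos by (simp add: N_def)
qed simp

text \<open>
  Meant for polynomials, which have only finitely many nonzero coefficients.
\<close>

definition multiplier :: "(nat^'n \<Rightarrow> real) \<Rightarrow> (real^'n \<Rightarrow> real) \<Rightarrow> real^'n \<Rightarrow> real" where
  "multiplier m f x = (\<Sum>\<kappa> | coef f \<kappa> \<noteq> 0. m \<kappa> * coef f \<kappa> * \<phi> \<kappa> x)"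

lemma multiplier_eq_comb:
  assumes "finite K" "\<And>\<kappa>. \<kappa> \<notin> K \<Longrightarrow> coef f \<kappa> = 0"
  shows "multiplier m f = comb K (\<lambda>\<kappa>. m \<kappa> * coef f \<kappa>)"
  unfolding multiplier_def comb_def using assms by (auto intro!: ext sum.mono_neutral_left)

lemma multiplier_polynomial: "real_polynomial_function f \<Longrightarrow> real_polynomial_function (multiplier m f)"
  by (metis polynomial_expansion multiplier_eq_comb comb_polynomial)

lemma coef_multiplier: "real_polynomial_function f \<Longrightarrow> coef (multiplier m f) \<kappa> = m \<kappa> * coef f \<kappa>"
proof -
  assume "real_polynomial_function f"
  then obtain K where K: "finite K" "\<And>\<kappa>. \<kappa> \<notin> K \<Longrightarrow> coef f \<kappa> = 0" "f = comb K (coef f)"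
    using polynomial_expansion by blast
  show ?thesis using K(1,2) by (simp add: multiplier_eq_comb[OF K(1,2)] coeff_comb)
qed

lemma polynomial_eqI:
  assumes f: "real_polynomial_function f" and g: "real_polynomial_function g" and eq: "\<And>\<kappa>. coef f \<kappa> = coef g \<kappa>"
  shows "f = g"
proof -
  obtain K where K: "finite K" "\<And>\<kappa>. \<kappa> \<notin> K \<Longrightarrow> coef f \<kappa> = 0" "f = comb K (coef f)"
    using polynomial_expansion[OF f] by blast
  obtain L where L: "finite L" "\<And>\<kappa>. \<kappa> \<notin> L \<Longrightarrow> coef g \<kappa> = 0" "g = comb L (coef g)"
    using polynomial_expansion[OF g] by blast
  have c: "coef f = coef g" using eq by auto
  have "comb K (coef f) = comb (K \<union> L) (coef f)" by (rule comb_mono_neutral) (use K L in auto)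
  moreover have "comb L (coef g) = comb (K \<union> L) (coef g)" by (rule comb_mono_neutral) (use K L in auto)
  ultimately show ?thesis using K(3) L(3) c by metis
qed

lemma coef_add:
  assumes "real_polynomial_function f" "real_polynomial_function g"
  shows "coef (\<lambda>x. f x + g x) \<kappa> = coef f \<kappa> + coef g \<kappa>"
  unfolding jacobi_coeff_def distrib_right
  by (intro Bochner_Integration.integral_add polynomial_integrable real_polynomial_function.intros(4) assms polyvec_polynomial)

lemma coef_cmult: "coef (\<lambda>x. c * f x) \<kappa> = c * coef f \<kappa>"
  by (simp add: jacobi_coeff_def mult.assoc)

lemma coef_diff:
  assumes "real_polynomial_function f" "real_polynomial_function g"
  shows "coef (\<lambda>x. f x - g x) \<kappa> = coef f \<kappa> - coef g \<kappa>"
  using coef_add[OF assms(1) real_polynomial_function.intros(4)[OF real_polynomial_function.intros(2)[of "-1"] assms(2)]]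
    coef_cmult[of "-1" g] by simp

lemma coef_const: "coef (\<lambda>_. c) \<kappa> = (if \<kappa> = 0 then c else 0)"
  using polyvec_orthonormal[of 0 \<kappa>] by (simp add: jacobi_coeff_def polyvec_0)

lemma coef_jacobi_op: "real_polynomial_function f \<Longrightarrow> coef (jacobi_op f) \<kappa> = - ev \<kappa> * coef f \<kappa>"
proof -
  assume f: "real_polynomial_function f"
  then obtain K where K: "finite K" "\<And>\<kappa>. \<kappa> \<notin> K \<Longrightarrow> coef f \<kappa> = 0" "f = comb K (coef f)"
    using polynomial_expansion by blast
  have "jacobi_op f = comb K (\<lambda>\<kappa>. - ev \<kappa> * coef f \<kappa>)"
    using jacobi_op_comb[OF K(1), of "coef f"] K(3) by auto
  then show ?thesis using K by (simp add: coeff_comb)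
qed

lemmas poly_intros = real_polynomial_function.intros(2-4) real_polynomial_function_diff multiplier_polynomial

lemma multiplier_mult:
  assumes f: "real_polynomial_function f" shows "multiplier m (multiplier m' f) = multiplier (\<lambda>\<kappa>. m \<kappa> * m' \<kappa>) f"
  using f by (intro polynomial_eqI) (auto simp: coef_multiplier multiplier_polynomial)

lemma multiplier_diff:
  assumes f: "real_polynomial_function f" and g: "real_polynomial_function g"
  shows "multiplier m (\<lambda>x. f x - g x) = (\<lambda>x. multiplier m f x - multiplier m g x)"
  using f g by (intro polynomial_eqI poly_intros) (auto simp: coef_multiplier coef_diff multiplier_polynomial real_polynomial_function_diff algebra_simps)

lemma multiplier_one: "real_polynomial_function f \<Longrightarrow> (\<And>\<kappa>. coef f \<kappa> \<noteq> 0 \<Longrightarrow> m \<kappa> = 1) \<Longrightarrow> multiplier m f = f"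
  by (intro polynomial_eqI poly_intros) (auto simp: coef_multiplier)

lemma multiplier_add_left: "multiplier (\<lambda>\<kappa>. m \<kappa> + m' \<kappa>) f x = multiplier m f x + multiplier m' f x"
  unfolding multiplier_def distrib_right sum.distrib ..

lemma multiplier_cmult_left: "multiplier (\<lambda>\<kappa>. c * m \<kappa>) f x = c * multiplier m f x"
  unfolding multiplier_def sum_distrib_left by (simp add: mult_ac)

definition multiplier_bounded :: "real \<Rightarrow> (nat^'n \<Rightarrow> real) \<Rightarrow> real \<Rightarrow> bool" where
  "multiplier_bounded p m C \<longleftrightarrow> 0 \<le> C \<and> (\<forall>f. real_polynomial_function f \<longrightarrow> Lp_norm \<mu> p (multiplier m f) \<le> C * Lp_norm \<mu> p f)"

text \<open>
  Only finitely many values of a multiplier matter for a given polynomial, so pointwise convergence of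
  the multipliers suffices.
\<close>

lemma multiplier_bounded_limit:
  assumes p: "1 \<le> p" and bd: "\<And>n. multiplier_bounded p (M n) C" and lim: "\<And>\<kappa>. (\<lambda>n. M n \<kappa>) \<longlonglongrightarrow> m \<kappa>"
  shows "multiplier_bounded p m C"
  unfolding multiplier_bounded_def
proof (intro conjI allI impI)
  show "0 \<le> C" using bd by (simp add: multiplier_bounded_def)
  fix f :: "real^'n \<Rightarrow> real" assume f: "real_polynomial_function f"
  obtain K where K: "finite K" "\<And>\<kappa>. \<kappa> \<notin> K \<Longrightarrow> coef f \<kappa> = 0" "f = comb K (coef f)"
    using polynomial_expansion[OF f] by blast
  have L: "real_polynomial_function g \<Longrightarrow> g \<in> Lp_space \<mu> p" for g using polynomial_Lp p by simp
  have term_bd: "Lp_norm \<mu> p (comb J c) \<le> (\<Sum>\<kappa>\<in>J. \<bar>c \<kappa>\<bar> * Lp_norm \<mu> p (\<phi> \<kappa>))" if "finite J" for J c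
    using that
  proof (induction J rule: finite_induct)
    case empty
    then show ?case using p Lp_norm_const[of p 0] by (simp add: comb_def[abs_def])
  next
    case (insert \<kappa> J)
    have "comb (insert \<kappa> J) c = (\<lambda>x. c \<kappa> * \<phi> \<kappa> x + comb J c x)"
      using insert by (auto simp: comb_def)
    moreover have "Lp_norm \<mu> p (\<lambda>x. c \<kappa> * \<phi> \<kappa> x + comb J c x) \<le> Lp_norm \<mu> p (\<lambda>x. c \<kappa> * \<phi> \<kappa> x) + Lp_norm \<mu> p (comb J c)"
      using insert by (intro Lp_norm_triangle[OF p] L poly_intros polyvec_polynomial comb_polynomial)
    moreover have "Lp_norm \<mu> p (\<lambda>x. c \<kappa> * \<phi> \<kappa> x) = \<bar>c \<kappa>\<bar> * Lp_norm \<mu> p (\<phi> \<kappa>)"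
      using p by (intro Lp_norm_cmult) simp
    ultimately have "Lp_norm \<mu> p (comb (insert \<kappa> J) c) \<le> \<bar>c \<kappa>\<bar> * Lp_norm \<mu> p (\<phi> \<kappa>) + Lp_norm \<mu> p (comb J c)"
      by simp
    then show ?case using insert by simp
  qed
  have "Lp_norm \<mu> p (multiplier m f) \<le> C * Lp_norm \<mu> p f + (\<Sum>\<kappa>\<in>K. \<bar>(m \<kappa> - M n \<kappa>) * coef f \<kappa>\<bar> * Lp_norm \<mu> p (\<phi> \<kappa>))" for n
  proof -
    have "Lp_norm \<mu> p (\<lambda>x. multiplier (M n) f x + comb K (\<lambda>\<kappa>. (m \<kappa> - M n \<kappa>) * coef f \<kappa>) x)
        \<le> Lp_norm \<mu> p (multiplier (M n) f) + Lp_norm \<mu> p (comb K (\<lambda>\<kappa>. (m \<kappa> - M n \<kappa>) * coef f \<kappa>))"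
      by (intro Lp_norm_triangle[OF p] L poly_intros comb_polynomial f K)
    moreover have "(\<lambda>x. multiplier (M n) f x + comb K (\<lambda>\<kappa>. (m \<kappa> - M n \<kappa>) * coef f \<kappa>) x) = multiplier m f"
      by (auto simp: multiplier_eq_comb[OF K(1,2)] comb_def fun_eq_iff algebra_simps simp flip: sum.distrib)
    moreover have "Lp_norm \<mu> p (multiplier (M n) f) \<le> C * Lp_norm \<mu> p f"
      using bd f by (auto simp: multiplier_bounded_def)
    ultimately show ?thesis using term_bd[OF K(1), of "\<lambda>\<kappa>. (m \<kappa> - M n \<kappa>) * coef f \<kappa>"] by simp
  qed
  moreover have "(\<lambda>n. C * Lp_norm \<mu> p f + (\<Sum>\<kappa>\<in>K. \<bar>(m \<kappa> - M n \<kappa>) * coef f \<kappa>\<bar> * Lp_norm \<mu> p (\<phi> \<kappa>)))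
      \<longlonglongrightarrow> C * Lp_norm \<mu> p f + (\<Sum>\<kappa>\<in>K. \<bar>(m \<kappa> - m \<kappa>) * coef f \<kappa>\<bar> * Lp_norm \<mu> p (\<phi> \<kappa>))"
    by (intro tendsto_intros lim)
  ultimately show "Lp_norm \<mu> p (multiplier m f) \<le> C * Lp_norm \<mu> p f"
    by (intro LIMSEQ_le_const[where X="\<lambda>n. C * Lp_norm \<mu> p f + (\<Sum>\<kappa>\<in>K. \<bar>(m \<kappa> - M n \<kappa>) * coef f \<kappa>\<bar> * Lp_norm \<mu> p (\<phi> \<kappa>))"]) auto
qed

text \<open>
  The multiplier of the \<open>k\<close>-th power of the resolvent with parameter \<open>e\<close>. It vanishes at \<open>\<kappa> = 0\<close>, since the
  resolvent fixes constants and contracts strictly only on functions of mean zero.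
\<close>

definition resolvent_pow :: "real \<Rightarrow> nat \<Rightarrow> nat^'n \<Rightarrow> real" where
  "resolvent_pow e k \<kappa> = (if \<kappa> = 0 then 0 else (1 / (1 + e * ev \<kappa>)) ^ k)"

text \<open>
  The power \<open>0\<close> subtracts the mean, which costs the factor \<open>2\<close>; every further power gains a factor by
  \<open>resolvent_gap\<close>.
\<close>

lemma resolvent_pow_bounded:
  assumes p: "2 \<le> p" and e: "0 \<le> e"
  shows "multiplier_bounded p (resolvent_pow e k) (2 * (1 / (1 + e * gap p)) ^ k)"
proof -
  define \<rho> where "\<rho> = 1 / (1 + e * gap p)"
  have eg: "0 \<le> e * gap p" using e gap_pos[OF p] by simp
  have \<rho>: "0 \<le> \<rho>" using eg by (simp add: \<rho>_def)
  have "Lp_norm \<mu> p (multiplier (resolvent_pow e k) f) \<le> 2 * \<rho> ^ k * Lp_norm \<mu> p f"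
    if f: "real_polynomial_function f" for f :: "real^'n \<Rightarrow> real"
  proof (induction k)
    case 0
    have "multiplier (resolvent_pow e 0) f = (\<lambda>x. f x - (\<integral>y. f y \<partial>\<mu>))"
      using f by (intro polynomial_eqI poly_intros)
        (auto simp: coef_multiplier coef_diff coef_const resolvent_pow_def coef_0 real_polynomial_function.intros)
    then show ?case using Lp_norm_sub_integral_le[OF _ polynomial_Lp[OF f], of p] p by simp
  next
    case (Suc k)
    let ?u = "multiplier (resolvent_pow e (Suc k)) f"
    have u: "real_polynomial_function ?u" by (rule multiplier_polynomial[OF f])
    have "(\<lambda>x. ?u x - e * jacobi_op ?u x) = multiplier (resolvent_pow e k) f"
    proof (rule polynomial_eqI)
      fix \<kappa>
      have ne: "1 + e * ev \<kappa> \<noteq> 0" using mult_nonneg_nonneg[OF e eigenvalue_nonneg[of \<kappa>]] by linarith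
      have "coef (\<lambda>x. ?u x - e * jacobi_op ?u x) \<kappa> = (1 + e * ev \<kappa>) * resolvent_pow e (Suc k) \<kappa> * coef f \<kappa>"
        using u f by (simp add: coef_diff coef_cmult coef_jacobi_op jacobi_op_polynomial real_polynomial_function.intros coef_multiplier algebra_simps)
      also have "(1 + e * ev \<kappa>) * resolvent_pow e (Suc k) \<kappa> = resolvent_pow e k \<kappa>"
        using ne by (simp add: resolvent_pow_def)
      finally show "coef (\<lambda>x. ?u x - e * jacobi_op ?u x) \<kappa> = coef (multiplier (resolvent_pow e k) f) \<kappa>"
        by (simp add: coef_multiplier[OF f])
    qed (intro poly_intros jacobi_op_polynomial u f)+
    moreover have "(\<integral>x. ?u x \<partial>\<mu>) = 0"
      using coef_multiplier[OF f, of "resolvent_pow e (Suc k)" 0] by (simp add: coef_0 resolvent_pow_def)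
    ultimately have "(1 + e * gap p) * Lp_norm \<mu> p ?u \<le> Lp_norm \<mu> p (multiplier (resolvent_pow e k) f)"
      using resolvent_gap[OF p u _ e] by simp
    then have "Lp_norm \<mu> p ?u \<le> \<rho> * Lp_norm \<mu> p (multiplier (resolvent_pow e k) f)"
      using eg by (simp add: \<rho>_def field_simps)
    also have "\<dots> \<le> \<rho> * (2 * \<rho> ^ k * Lp_norm \<mu> p f)"
      by (intro mult_left_mono Suc.IH \<rho>)
    finally show ?case by (simp add: mult_ac)
  qed
  then show ?thesis using \<rho> by (simp add: multiplier_bounded_def flip: \<rho>_def)
qed

lemma resolvent_series_bounded:
  assumes p: "2 \<le> p" and e: "0 \<le> e" and \<rho>: "1 / (1 + e * gap p) \<le> \<rho>"
    and summable: "summable (\<lambda>k. \<bar>a k\<bar> * \<rho> ^ k)"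
    and sums: "\<And>\<kappa>. \<kappa> \<noteq> 0 \<Longrightarrow> (\<lambda>k. a k * (1 / (1 + e * ev \<kappa>)) ^ k) sums m \<kappa>" and m0: "m 0 = 0"
  shows "multiplier_bounded p m (2 * (\<Sum>k. \<bar>a k\<bar> * \<rho> ^ k))"
proof (rule multiplier_bounded_limit)
  show "1 \<le> p" using p by simp
  have eg: "0 \<le> e * gap p" using e gap_pos[OF p] by simp
  have \<rho>0: "0 \<le> \<rho>" using \<rho> eg by (meson divide_nonneg_nonneg order_trans add_nonneg_nonneg zero_le_one)
  show "(\<lambda>n. \<Sum>k<n. a k * resolvent_pow e k \<kappa>) \<longlonglongrightarrow> m \<kappa>" for \<kappa>
    using sums[of \<kappa>] m0 by (cases "\<kappa> = 0") (auto simp: resolvent_pow_def sums_def)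
  show "multiplier_bounded p (\<lambda>\<kappa>. \<Sum>k<n. a k * resolvent_pow e k \<kappa>) (2 * (\<Sum>k. \<bar>a k\<bar> * \<rho> ^ k))" for n
    unfolding multiplier_bounded_def
  proof (intro conjI allI impI)
    show "0 \<le> 2 * (\<Sum>k. \<bar>a k\<bar> * \<rho> ^ k)"
      using \<rho>0 summable by (intro mult_nonneg_nonneg suminf_nonneg) auto
    fix f :: "real^'n \<Rightarrow> real" assume f: "real_polynomial_function f"
    have L: "real_polynomial_function g \<Longrightarrow> g \<in> Lp_space \<mu> p" for g using polynomial_Lp p by simp
    have partial: "Lp_norm \<mu> p (multiplier (\<lambda>\<kappa>. \<Sum>k<n. a k * resolvent_pow e k \<kappa>) f)
        \<le> (\<Sum>k<n. \<bar>a k\<bar> * \<rho> ^ k) * (2 * Lp_norm \<mu> p f)"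
    proof (induction n)
      case 0
      then show ?case using p Lp_norm_const[of p 0] by (simp add: multiplier_def[abs_def])
    next
      case (Suc n)
      have "multiplier (\<lambda>\<kappa>. \<Sum>k<Suc n. a k * resolvent_pow e k \<kappa>) f
          = (\<lambda>x. multiplier (\<lambda>\<kappa>. \<Sum>k<n. a k * resolvent_pow e k \<kappa>) f x + a n * multiplier (resolvent_pow e n) f x)"
        by (simp add: fun_eq_iff multiplier_add_left multiplier_cmult_left)
      moreover have "Lp_norm \<mu> p (\<lambda>x. multiplier (\<lambda>\<kappa>. \<Sum>k<n. a k * resolvent_pow e k \<kappa>) f x + a n * multiplier (resolvent_pow e n) f x)
          \<le> Lp_norm \<mu> p (multiplier (\<lambda>\<kappa>. \<Sum>k<n. a k * resolvent_pow e k \<kappa>) f) + Lp_norm \<mu> p (\<lambda>x. a n * multiplier (resolvent_pow e n) f x)"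
        using p by (intro Lp_norm_triangle L poly_intros f) auto
      moreover have "Lp_norm \<mu> p (\<lambda>x. a n * multiplier (resolvent_pow e n) f x) \<le> \<bar>a n\<bar> * (2 * \<rho> ^ n * Lp_norm \<mu> p f)"
      proof -
        have "Lp_norm \<mu> p (multiplier (resolvent_pow e n) f) \<le> 2 * (1 / (1 + e * gap p)) ^ n * Lp_norm \<mu> p f"
          using resolvent_pow_bounded[OF p e] f by (auto simp: multiplier_bounded_def)
        also have "\<dots> \<le> 2 * \<rho> ^ n * Lp_norm \<mu> p f"
          using \<rho> eg by (intro mult_right_mono mult_left_mono power_mono) auto
        finally show ?thesis using p by (simp add: Lp_norm_cmult mult_left_mono)
      qed
      ultimately show ?case using Suc.IH by (simp add: algebra_simps)
    qed
    also have "\<dots> \<le> (\<Sum>k. \<bar>a k\<bar> * \<rho> ^ k) * (2 * Lp_norm \<mu> p f)"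
      using \<rho>0 by (intro mult_right_mono sum_le_suminf summable) auto
    finally show "Lp_norm \<mu> p (multiplier (\<lambda>\<kappa>. \<Sum>k<n. a k * resolvent_pow e k \<kappa>) f) \<le> 2 * (\<Sum>k. \<bar>a k\<bar> * \<rho> ^ k) * Lp_norm \<mu> p f"
      by (simp add: mult_ac)
  qed
qed

text \<open>
  With \<open>x = 1 / (1 + ev \<kappa>)\<close> the multiplier is \<open>(1 - x) powr s\<close>, a binomial series in \<open>x\<close>. On functions of mean zero
  the powers of the resolvent decay geometrically with a ratio \<open>\<rho> < 1\<close>, inside the disc of convergence,
  whatever the sign of \<open>s\<close>.
\<close>

lemma ratio_mult_bounded_ge_2:
  assumes p: "2 \<le> p"
  shows "\<exists>C. multiplier_bounded p (\<lambda>\<kappa>. if \<kappa> = 0 then 0 else (ev \<kappa> / (1 + ev \<kappa>)) powr s) C"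
proof -
  define \<rho> where "\<rho> = 1 / (1 + gap p)"
  have \<rho>: "0 < \<rho>" "\<rho> < 1" using gap_pos[OF p] by (auto simp: \<rho>_def)
  define a where "a k = (s gchoose k) * (-1) ^ k" for k
  have sums: "(\<lambda>k. a k * x ^ k) sums (1 - x) powr s" if "0 \<le> x" "x < 1" for x
  proof -
    have "(\<lambda>k. (s gchoose k) * (- x) ^ k) sums (1 + - x) powr s" by (rule gen_binomial_real) (use that in auto)
    also have "(\<lambda>k. (s gchoose k) * (- x) ^ k) = (\<lambda>k. a k * x ^ k)"
      by (auto simp: a_def fun_eq_iff mult.assoc simp flip: power_mult_distrib)
    finally show ?thesis by simp
  qed
  \<comment> \<open>convergence at a point beyond \<open>\<rho>\<close> gives absolute convergence at \<open>\<rho>\<close>\<close>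
  have "summable (\<lambda>k. a k * ((1 + \<rho>) / 2) ^ k)" using sums[of "(1 + \<rho>) / 2"] \<rho> by (auto simp: sums_iff)
  then have "summable (\<lambda>k. norm (a k * \<rho> ^ k))" by (rule powser_insidea) (use \<rho> in auto)
  then have summable: "summable (\<lambda>k. \<bar>a k\<bar> * \<rho> ^ k)" using \<rho> by (simp add: abs_mult)
  have "multiplier_bounded p (\<lambda>\<kappa>. if \<kappa> = 0 then 0 else (ev \<kappa> / (1 + ev \<kappa>)) powr s) (2 * (\<Sum>k. \<bar>a k\<bar> * \<rho> ^ k))"
  proof (rule resolvent_series_bounded[OF p, of 1])
    fix \<kappa> :: "nat^'n" assume "\<kappa> \<noteq> 0"
    then have ge: "1 \<le> ev \<kappa>" by (rule eigenvalue_ge_1)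
    then have "1 - 1 / (1 + 1 * ev \<kappa>) = ev \<kappa> / (1 + ev \<kappa>)" by (simp add: field_simps)
    then show "(\<lambda>k. a k * (1 / (1 + 1 * ev \<kappa>)) ^ k) sums (if \<kappa> = 0 then 0 else (ev \<kappa> / (1 + ev \<kappa>)) powr s)"
      using sums[of "1 / (1 + 1 * ev \<kappa>)"] ge \<open>\<kappa> \<noteq> 0\<close> by simp
  qed (use summable in \<open>auto simp: \<rho>_def\<close>)
  then show ?thesis by blast
qed

text \<open>
  The series used for the ratio is not available, since \<open>x powr s\<close> is not analytic at \<open>x = 0\<close>, where the points
  \<open>1 / (1 + ev \<kappa>)\<close> accumulate. Instead, \<open>(1 + \<lambda>) powr (- s)\<close> is the limit for \<open>e \<longlonglongrightarrow> 0\<close> of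
  \<open>((1 + e * \<lambda>) / (1 + \<lambda>)) powr s = e powr s * (1 - (1 - e) * y) powr (- s)\<close> with \<open>y = 1 / (1 + e * \<lambda>)\<close>. This is a
  binomial series in the resolvent with parameter \<open>e\<close>. Its coefficients are nonnegative, so the sum of
  their absolute values is the value at \<open>y = 1\<close>, which is \<open>1\<close> for every \<open>e\<close>.
\<close>

lemma bessel_mult_bounded_ge_2:
  assumes p: "2 \<le> p" and s: "0 < s"
  shows "multiplier_bounded p (\<lambda>\<kappa>. if \<kappa> = 0 then 0 else (1 + ev \<kappa>) powr (- s)) 2"
proof (rule multiplier_bounded_limit)
  show "1 \<le> p" using p by simp
  \<comment> \<open>any null sequence between \<open>0\<close> and \<open>1\<close> would do\<close>
  define e where "e n = 1 / (real n + 2)" for n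
  have e: "0 < e n" "e n < 1" for n by (auto simp: e_def)
  have e0: "e \<longlonglongrightarrow> 0"
    unfolding e_def using LIMSEQ_ignore_initial_segment[OF lim_1_over_n[where 'a=real], of 2]
    by (simp add: add.commute)
  show "multiplier_bounded p (\<lambda>\<kappa>. if \<kappa> = 0 then 0 else ((1 + e n * ev \<kappa>) / (1 + ev \<kappa>)) powr s) 2" for n
  proof -
    define a where "a k = e n powr s * (((- s) gchoose k) * (-1) ^ k * (1 - e n) ^ k)" for k
    have sums: "(\<lambda>k. a k * x ^ k) sums (e n powr s * (1 - (1 - e n) * x) powr (- s))" if "0 \<le> x" "x \<le> 1" for x
    proof -
      have "(1 - e n) * x \<le> 1 - e n" using mult_left_mono[of x 1 "1 - e n"] that e[of n] by simp
      also have "1 - e n < 1" using e[of n] by simp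
      finally have "(1 - e n) * x < 1" .
      moreover have "0 \<le> (1 - e n) * x" using that e[of n] by simp
      ultimately have "(\<lambda>k. (- s gchoose k) * (- ((1 - e n) * x)) ^ k) sums (1 + - ((1 - e n) * x)) powr (- s)"
        by (intro gen_binomial_real) auto
      moreover have "e n powr s * ((- s gchoose k) * (- ((1 - e n) * x)) ^ k) = a k * x ^ k" for k
        unfolding a_def power_minus[of "(1 - e n) * x"] power_mult_distrib by (simp only: mult_ac)
      ultimately show ?thesis
        using sums_mult[of "\<lambda>k. (- s gchoose k) * (- ((1 - e n) * x)) ^ k" _ "e n powr s"] by simp
    qed
    have "0 \<le> ((- s) gchoose k) * (-1) ^ k" for k
    proof -
      have "((- s) gchoose k) * (-1) ^ k = ((-1) ^ k * (-1) ^ k) * (pochhammer s k / fact k)"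
        by (simp add: gbinomial_pochhammer)
      also have "(-1) ^ k * (-1) ^ k = (1::real)" by (simp flip: power_mult_distrib)
      finally show ?thesis using pochhammer_nonneg[OF s, of k] by simp
    qed
    then have a0: "0 \<le> a k" for k
      unfolding a_def using e[of n] by (intro mult_nonneg_nonneg[OF _ mult_nonneg_nonneg]) auto
    have "(\<lambda>k. a k) sums (e n powr s * e n powr (- s))" using sums[of 1] by simp
    also have "e n powr s * e n powr (- s) = 1" using e[of n] by (simp flip: powr_add)
    finally have one: "summable a" "(\<Sum>k. a k) = 1" by (auto simp: sums_iff)
    have "multiplier_bounded p (\<lambda>\<kappa>. if \<kappa> = 0 then 0 else ((1 + e n * ev \<kappa>) / (1 + ev \<kappa>)) powr s) (2 * (\<Sum>k. \<bar>a k\<bar> * 1 ^ k))"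
    proof (rule resolvent_series_bounded[OF p, of "e n"])
      fix \<kappa> :: "nat^'n" assume nz: "\<kappa> \<noteq> 0"
      then have ge: "1 \<le> ev \<kappa>" by (rule eigenvalue_ge_1)
      have pos: "0 < 1 + e n * ev \<kappa>" using mult_pos_pos[OF e(1)[of n], of "ev \<kappa>"] ge by linarith
      have base: "1 - (1 - e n) * (1 / (1 + e n * ev \<kappa>)) = e n * ((1 + ev \<kappa>) / (1 + e n * ev \<kappa>))"
        using pos by (simp add: field_simps)
      have "e n powr s * (1 - (1 - e n) * (1 / (1 + e n * ev \<kappa>))) powr (- s)
          = (e n powr s * e n powr (- s)) * ((1 + ev \<kappa>) / (1 + e n * ev \<kappa>)) powr (- s)"
      proof -
        have "(e n * t) powr (- s) = e n powr (- s) * t powr (- s)" if "0 \<le> t" for t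
          using that e[of n] by (simp add: powr_mult)
        moreover have "0 \<le> (1 + ev \<kappa>) / (1 + e n * ev \<kappa>)" using pos ge by simp
        ultimately show ?thesis unfolding base by (simp only: mult.assoc)
      qed
      also have "\<dots> = ((1 + e n * ev \<kappa>) / (1 + ev \<kappa>)) powr s"
        using e[of n] pos ge by (simp add: powr_minus powr_divide field_simps)
      finally show "(\<lambda>k. a k * (1 / (1 + e n * ev \<kappa>)) ^ k) sums (if \<kappa> = 0 then 0 else ((1 + e n * ev \<kappa>) / (1 + ev \<kappa>)) powr s)"
        using sums[of "1 / (1 + e n * ev \<kappa>)"] pos nz e(1)[of n] ge by simp
    qed (use one a0 e[of n] gap_pos[OF p] in \<open>auto simp: divide_le_eq_1\<close>)
    then show ?thesis using one a0 by simp
  qed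
  show "(\<lambda>n. if \<kappa> = 0 then 0 else ((1 + e n * ev \<kappa>) / (1 + ev \<kappa>)) powr s) \<longlonglongrightarrow> (if \<kappa> = 0 then 0 else (1 + ev \<kappa>) powr (- s))" for \<kappa>
  proof (cases "\<kappa> = 0")
    case False
    have pos: "0 < 1 + ev \<kappa>" using eigenvalue_nonneg[of \<kappa>] by linarith
    have "(\<lambda>n. ((1 + e n * ev \<kappa>) / (1 + ev \<kappa>)) powr s) \<longlonglongrightarrow> ((1 + 0 * ev \<kappa>) / (1 + ev \<kappa>)) powr s"
      using pos by (intro tendsto_intros e0) auto
    also have "((1 + 0 * ev \<kappa>) / (1 + ev \<kappa>)) powr s = (1 + ev \<kappa>) powr (- s)"
      using pos by (simp add: powr_divide powr_minus_divide)
    finally show ?thesis using False by simp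
  qed simp
qed

lemma multiplier_self_adjoint:
  assumes f: "real_polynomial_function f" and g: "real_polynomial_function g"
  shows "(\<integral>x. multiplier m f x * g x \<partial>\<mu>) = (\<integral>x. f x * multiplier m g x \<partial>\<mu>)"
proof -
  obtain K where K: "finite K" "\<And>\<kappa>. \<kappa> \<notin> K \<Longrightarrow> coef f \<kappa> = 0" "f = comb K (coef f)"
    using polynomial_expansion[OF f] by blast
  obtain L where L: "finite L" "\<And>\<kappa>. \<kappa> \<notin> L \<Longrightarrow> coef g \<kappa> = 0" "g = comb L (coef g)"
    using polynomial_expansion[OF g] by blast
  define J where "J = K \<union> L"
  have J: "finite J" "\<And>\<kappa>. \<kappa> \<notin> J \<Longrightarrow> coef f \<kappa> = 0" "\<And>\<kappa>. \<kappa> \<notin> J \<Longrightarrow> coef g \<kappa> = 0"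
    using K L by (auto simp: J_def)
  have fJ: "f = comb J (coef f)" and gJ: "g = comb J (coef g)"
    using K L comb_mono_neutral[of J K "coef f"] comb_mono_neutral[of J L "coef g"] J(1) by (auto simp: J_def)
  have mf: "multiplier m f = comb J (\<lambda>\<kappa>. m \<kappa> * coef f \<kappa>)" by (rule multiplier_eq_comb[OF J(1,2)])
  have mg: "multiplier m g = comb J (\<lambda>\<kappa>. m \<kappa> * coef g \<kappa>)" by (rule multiplier_eq_comb[OF J(1,3)])
  have "(\<integral>x. multiplier m f x * g x \<partial>\<mu>) = (\<Sum>\<kappa>\<in>J. (m \<kappa> * coef f \<kappa>) * coef g \<kappa>)"
    using integral_comb_mult[OF J(1), of "\<lambda>\<kappa>. m \<kappa> * coef f \<kappa>" "coef g"]
    unfolding gJ[symmetric] mf .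
  also have "\<dots> = (\<Sum>\<kappa>\<in>J. coef f \<kappa> * (m \<kappa> * coef g \<kappa>))" by (simp add: mult_ac)
  also have "\<dots> = (\<integral>x. f x * multiplier m g x \<partial>\<mu>)"
    using integral_comb_mult[OF J(1), of "coef f" "\<lambda>\<kappa>. m \<kappa> * coef g \<kappa>"]
    unfolding fJ[symmetric] mg by (rule sym)
  finally show ?thesis .
qed

text \<open>
  Multipliers are self-adjoint. The norm of \<open>w = multiplier m f\<close> is found by integrating \<open>w\<close> against
  \<open>signed_powr (p - 1) (w x)\<close>. Replacing this test function by a polynomial in \<open>w\<close> that is uniformly close, the
  multiplier can be moved to the other side, where the bound for the exponent \<open>q\<close> applies.
\<close>

lemma multiplier_bounded_dual:
  assumes p: "1 < p" and q: "1 < q" and pq: "1 / p + 1 / q = 1" and bd: "multiplier_bounded q m C"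
  shows "multiplier_bounded p m C"
  unfolding multiplier_bounded_def
proof (intro conjI allI impI)
  show C: "0 \<le> C" using bd by (simp add: multiplier_bounded_def)
  fix f :: "real^'n \<Rightarrow> real" assume f: "real_polynomial_function f"
  define w where "w = multiplier m f"
  have w: "real_polynomial_function w" unfolding w_def by (rule multiplier_polynomial[OF f])
  have cw: "continuous_on UNIV w" by (rule polynomial_continuous[OF w])
  let ?h = "\<lambda>x. signed_powr (p - 1) (w x)"
  have ch: "continuous_on UNIV ?h"
    using continuous_on_compose2[OF continuous_on_signed_powr cw] p by auto
  have hL: "?h \<in> Lp_space \<mu> q" using q by (intro continuous_Lp ch) auto
  define W where "W = Lp_norm \<mu> p w"
  have Wp: "(\<integral>x. \<bar>w x\<bar> powr p \<partial>\<mu>) = W powr p" using p by (simp add: W_def Lp_norm_powr)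
  have hq: "(p - 1) * q = p" "p * (1 / q) = p - 1"
    using pq p q by (auto simp: field_simps)
  have hnorm: "Lp_norm \<mu> q ?h = W powr (p - 1)"
    unfolding Lp_norm_def abs_signed_powr powr_powr hq(1) Wp by (simp only: powr_powr hq(2))
  obtain M where M: "0 \<le> M" "\<And>x. x \<in> cube \<Longrightarrow> \<bar>w x\<bar> \<le> M" using continuous_bounded_on_cube[OF cw] by blast
  have approx: "W powr p \<le> C * Lp_norm \<mu> p f * (W powr (p - 1)) + e * (C * Lp_norm \<mu> p f + W)" if e: "0 < e" for e
  proof -
    obtain g where g: "real_polynomial_function g" "\<And>y. y \<in> {-M..M} \<Longrightarrow> \<bar>signed_powr (p - 1) y - g y\<bar> < e"
      using Stone_Weierstrass_real_polynomial_function[of "{-M..M}" "signed_powr (p - 1)" e]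
        continuous_on_subset[OF continuous_on_signed_powr] p e by auto
    obtain r where r: "g = poly r" using polynomial_function_real_eq_poly[OF g(1)] by blast
    define k where "k x = poly r (w x)" for x
    have k: "real_polynomial_function k" unfolding k_def[abs_def] by (rule real_polynomial_function_poly[OF w])
    have ck: "continuous_on UNIV k" by (rule polynomial_continuous[OF k])
    have kL: "k \<in> Lp_space \<mu> q" using q by (intro continuous_Lp ck) auto
    have close: "\<bar>?h x - k x\<bar> \<le> e" if "x \<in> cube" for x
      using g(2)[of "w x"] M(2)[OF that] by (auto simp: k_def r abs_le_iff)
    have AE_close: "AE x in \<mu>. \<bar>?h x - k x\<bar> \<le> e" using AE_cube by eventually_elim (use close in simp)
    have kh: "Lp_norm \<mu> q (\<lambda>x. k x - ?h x) \<le> e"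
      using AE_close q e
      by (intro Lp_norm_le_of_bounded continuous_measurable continuous_intros ck ch) (auto simp: abs_minus_commute)
    have "Lp_norm \<mu> q (\<lambda>x. (k x - ?h x) + ?h x) \<le> Lp_norm \<mu> q (\<lambda>x. k x - ?h x) + Lp_norm \<mu> q ?h"
      using q by (intro Lp_norm_triangle Lp_space_diff kL hL) auto
    then have knorm: "Lp_norm \<mu> q k \<le> e + W powr (p - 1)" using kh hnorm by simp
    have wL: "w \<in> Lp_space \<mu> p" using p by (intro continuous_Lp cw) auto
    have fL: "f \<in> Lp_space \<mu> p" using p by (intro polynomial_Lp f) auto
    have "W powr p = (\<integral>x. w x * ?h x \<partial>\<mu>)" using mult_signed_powr[of _ "p - 1"] by (simp add: Wp[symmetric])
    also have "\<dots> \<le> (\<integral>x. w x * k x + e * \<bar>w x\<bar> \<partial>\<mu>)"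
    proof (rule integral_mono_AE)
      show "AE x in \<mu>. w x * ?h x \<le> w x * k x + e * \<bar>w x\<bar>"
        using AE_close
      proof eventually_elim
        case (elim x)
        have "w x * (?h x - k x) \<le> \<bar>w x\<bar> * \<bar>?h x - k x\<bar>" by (metis abs_ge_self abs_mult)
        also have "\<dots> \<le> \<bar>w x\<bar> * e" by (intro mult_left_mono elim) auto
        finally show ?case by (simp add: algebra_simps)
      qed
    qed (intro continuous_integrable continuous_intros cw ch ck)+
    also have "\<dots> = (\<integral>x. w x * k x \<partial>\<mu>) + e * (\<integral>x. \<bar>w x\<bar> \<partial>\<mu>)"
      by (subst Bochner_Integration.integral_add) (auto intro!: continuous_integrable continuous_intros cw ck)
    also have "(\<integral>x. w x * k x \<partial>\<mu>) = (\<integral>x. f x * multiplier m k x \<partial>\<mu>)"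
      unfolding w_def by (rule multiplier_self_adjoint[OF f k])
    also have "\<dots> \<le> Lp_norm \<mu> p f * Lp_norm \<mu> q (multiplier m k)"
      using Hoelder_inequality(2)[OF p q pq fL, of "multiplier m k"] polynomial_Lp[OF multiplier_polynomial[OF k], of q] q by auto
    also have "\<dots> \<le> Lp_norm \<mu> p f * (C * (e + W powr (p - 1)))"
    proof -
      have "Lp_norm \<mu> q (multiplier m k) \<le> C * Lp_norm \<mu> q k" using bd k by (auto simp: multiplier_bounded_def)
      also have "\<dots> \<le> C * (e + W powr (p - 1))" by (intro mult_left_mono knorm C)
      finally show ?thesis by (intro mult_left_mono) auto
    qed
    also have "e * (\<integral>x. \<bar>w x\<bar> \<partial>\<mu>) \<le> e * W"
      using abs_integral_le_Lp_norm[of p "\<lambda>x. \<bar>w x\<bar>"] continuous_Lp[of "\<lambda>x. \<bar>w x\<bar>" p] cw p e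
      by (intro mult_left_mono) (auto simp: W_def intro!: continuous_intros)
    finally show ?thesis by (simp add: algebra_simps)
  qed
  have "W powr p \<le> C * Lp_norm \<mu> p f * (W powr (p - 1))"
  proof (rule tendsto_le[where F="at_right (0::real)"])
    show "((\<lambda>e. C * Lp_norm \<mu> p f * (W powr (p - 1)) + e * (C * Lp_norm \<mu> p f + W)) \<longlongrightarrow> C * Lp_norm \<mu> p f * (W powr (p - 1))) (at_right 0)"
      by (auto intro!: tendsto_eq_intros)
    show "\<forall>\<^sub>F e in at_right 0. W powr p \<le> C * Lp_norm \<mu> p f * (W powr (p - 1)) + e * (C * Lp_norm \<mu> p f + W)"
      using approx by (auto simp: eventually_at_right_field intro!: exI[of _ 1])
  qed auto
  then have "W \<le> C * Lp_norm \<mu> p f"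
  proof (cases "W = 0")
    case False
    then have "0 < W" using Lp_norm_nonneg[of \<mu> p w] unfolding W_def by linarith
    moreover assume "W powr p \<le> C * Lp_norm \<mu> p f * (W powr (p - 1))"
    ultimately show ?thesis by (simp add: powr_diff field_simps)
  qed (use C in simp)
  then show "Lp_norm \<mu> p (multiplier m f) \<le> C * Lp_norm \<mu> p f" by (simp add: W_def w_def)
qed

lemma multiplier_bounded_from_ge_2:
  assumes p: "1 < p" and bd: "\<And>q. 2 \<le> q \<Longrightarrow> \<exists>C. multiplier_bounded q m C"
  shows "\<exists>C. multiplier_bounded p m C"
proof (cases "2 \<le> p")
  case False
  define q where "q = p / (p - 1)"
  have q: "2 \<le> q" "1 < q" "1 / p + 1 / q = 1" using p False by (auto simp: q_def field_simps)
  then show ?thesis using bd[OF q(1)] multiplier_bounded_dual[OF p q(2,3)] by blast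
qed (use bd in auto)

theorem ratio_mult_bounded:
  "1 < p \<Longrightarrow> \<exists>C. multiplier_bounded p (\<lambda>\<kappa>. if \<kappa> = 0 then 0 else (ev \<kappa> / (1 + ev \<kappa>)) powr s) C"
  using multiplier_bounded_from_ge_2 ratio_mult_bounded_ge_2 by blast

theorem bessel_mult_bounded:
  "1 < p \<Longrightarrow> 0 < s \<Longrightarrow> \<exists>C. multiplier_bounded p (\<lambda>\<kappa>. if \<kappa> = 0 then 0 else (1 + ev \<kappa>) powr (- s)) C"
  using multiplier_bounded_from_ge_2 bessel_mult_bounded_ge_2 by blast

end

section \<open>Density of polynomials and extension of multipliers\<close>

context jacobi
begin

lemma Lp_dominated_convergence:
  assumes p: "0 < p" and F: "\<And>i. F i \<in> borel_measurable \<mu>" and f: "f \<in> borel_measurable \<mu>"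
    and lim: "\<And>x. (\<lambda>i. F i x) \<longlonglongrightarrow> f x"
    and w: "integrable \<mu> w" and bd: "\<And>i x. \<bar>F i x - f x\<bar> powr p \<le> w x"
  shows "(\<lambda>i. Lp_norm \<mu> p (\<lambda>x. F i x - f x)) \<longlonglongrightarrow> 0"
proof -
  have [measurable]: "F i \<in> borel_measurable \<mu>" "f \<in> borel_measurable \<mu>" for i using F f by auto
  have "(\<lambda>i. \<integral>x. \<bar>F i x - f x\<bar> powr p \<partial>\<mu>) \<longlonglongrightarrow> (\<integral>x. 0 \<partial>\<mu>)"
  proof (rule integral_dominated_convergence[where w=w])
    show "AE x in \<mu>. (\<lambda>i. \<bar>F i x - f x\<bar> powr p) \<longlonglongrightarrow> 0"
    proof (rule AE_I2)
      fix x
      have "(\<lambda>i. \<bar>F i x - f x\<bar>) \<longlonglongrightarrow> 0" using lim[of x] by (simp add: LIM_zero tendsto_rabs_zero)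
      then show "(\<lambda>i. \<bar>F i x - f x\<bar> powr p) \<longlonglongrightarrow> 0"
        using p by (intro tendsto_zero_powrI[OF _ tendsto_const]) auto
    qed
  qed (use w bd in auto)
  then have "(\<lambda>i. (\<integral>x. \<bar>F i x - f x\<bar> powr p \<partial>\<mu>) powr (1 / p)) \<longlonglongrightarrow> 0"
    using p by (intro tendsto_zero_powrI[OF _ tendsto_const]) auto
  then show ?thesis by (simp add: Lp_norm_def)
qed

definition poly_approximable :: "real \<Rightarrow> (real^'n \<Rightarrow> real) \<Rightarrow> bool" where
  "poly_approximable p f \<longleftrightarrow> f \<in> Lp_space \<mu> p \<and>
     (\<forall>e>0. \<exists>P. real_polynomial_function P \<and> Lp_norm \<mu> p (\<lambda>x. f x - P x) < e)"

lemma poly_approximable_continuous: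
  assumes p: "1 \<le> p" and f: "continuous_on UNIV f" shows "poly_approximable p f"
  unfolding poly_approximable_def
proof (intro conjI allI impI)
  show "f \<in> Lp_space \<mu> p" using continuous_Lp[OF f] p by simp
  fix e :: real assume e: "0 < e"
  have "compact cube" unfolding cube_eq_cbox by (rule compact_cbox)
  then obtain P where P: "real_polynomial_function P" "\<And>x. x \<in> cube \<Longrightarrow> \<bar>f x - P x\<bar> < e / 2"
    using Stone_Weierstrass_real_polynomial_function[of cube f "e / 2"] continuous_on_subset[OF f] e by auto
  have "Lp_norm \<mu> p (\<lambda>x. f x - P x) \<le> e / 2"
  proof (rule Lp_norm_le_of_bounded)
    show "(\<lambda>x. f x - P x) \<in> borel_measurable \<mu>"
      by (intro continuous_measurable continuous_intros f polynomial_continuous P)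
    show "AE x in \<mu>. \<bar>f x - P x\<bar> \<le> e / 2" using AE_cube by eventually_elim (use P(2) less_imp_le in blast)
  qed (use p e in auto)
  then show "\<exists>P. real_polynomial_function P \<and> Lp_norm \<mu> p (\<lambda>x. f x - P x) < e"
    using P(1) e by (intro exI[of _ P]) auto
qed

lemma poly_approximable_add:
  assumes p: "1 \<le> p" and f: "poly_approximable p f" and g: "poly_approximable p g"
  shows "poly_approximable p (\<lambda>x. f x + g x)"
  unfolding poly_approximable_def
proof (intro conjI allI impI)
  have L: "f \<in> Lp_space \<mu> p" "g \<in> Lp_space \<mu> p" using f g by (auto simp: poly_approximable_def)
  show "(\<lambda>x. f x + g x) \<in> Lp_space \<mu> p" by (rule Lp_space_add[OF p L])
  fix e :: real assume e: "0 < e"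
  obtain P where P: "real_polynomial_function P" "Lp_norm \<mu> p (\<lambda>x. f x - P x) < e / 2"
    using f e unfolding poly_approximable_def by (meson half_gt_zero)
  obtain Q where Q: "real_polynomial_function Q" "Lp_norm \<mu> p (\<lambda>x. g x - Q x) < e / 2"
    using g e unfolding poly_approximable_def by (meson half_gt_zero)
  have PQ: "P \<in> Lp_space \<mu> p" "Q \<in> Lp_space \<mu> p" using polynomial_Lp[OF P(1)] polynomial_Lp[OF Q(1)] p by auto
  have "Lp_norm \<mu> p (\<lambda>x. (f x - P x) + (g x - Q x)) \<le> Lp_norm \<mu> p (\<lambda>x. f x - P x) + Lp_norm \<mu> p (\<lambda>x. g x - Q x)"
    by (intro Lp_norm_triangle p Lp_space_diff L PQ)
  then show "\<exists>P. real_polynomial_function P \<and> Lp_norm \<mu> p (\<lambda>x. f x + g x - P x) < e"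
    using P Q by (intro exI[of _ "\<lambda>x. P x + Q x"]) (auto simp: algebra_simps intro: real_polynomial_function.intros)
qed

lemma poly_approximable_cmult:
  assumes p: "1 \<le> p" and f: "poly_approximable p f"
  shows "poly_approximable p (\<lambda>x. c * f x)"
  unfolding poly_approximable_def
proof (intro conjI allI impI)
  show "(\<lambda>x. c * f x) \<in> Lp_space \<mu> p" using f by (auto simp: poly_approximable_def intro: Lp_space_cmult)
  fix e :: real assume e: "0 < e"
  then have "0 < e / (\<bar>c\<bar> + 1)" by (intro divide_pos_pos) auto
  then obtain P where P: "real_polynomial_function P" "Lp_norm \<mu> p (\<lambda>x. f x - P x) < e / (\<bar>c\<bar> + 1)"
    using f unfolding poly_approximable_def by blast
  have "Lp_norm \<mu> p (\<lambda>x. c * f x - c * P x) = \<bar>c\<bar> * Lp_norm \<mu> p (\<lambda>x. f x - P x)"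
    using Lp_norm_cmult[of p \<mu> c "\<lambda>x. f x - P x"] p by (simp add: right_diff_distrib)
  also have "\<dots> \<le> (\<bar>c\<bar> + 1) * Lp_norm \<mu> p (\<lambda>x. f x - P x)" by (intro mult_right_mono) auto
  also have "\<dots> < e" using P(2) by (simp add: pos_less_divide_eq mult.commute)
  finally show "\<exists>P. real_polynomial_function P \<and> Lp_norm \<mu> p (\<lambda>x. c * f x - P x) < e"
    using P(1) by (intro exI[of _ "\<lambda>x. c * P x"]) (auto intro: real_polynomial_function.intros)
qed

lemma poly_approximable_limit:
  assumes p: "1 \<le> p" and f: "f \<in> Lp_space \<mu> p" and F: "\<And>i. poly_approximable p (F i)"
    and lim: "(\<lambda>i. Lp_norm \<mu> p (\<lambda>x. F i x - f x)) \<longlonglongrightarrow> 0"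
  shows "poly_approximable p f"
  unfolding poly_approximable_def
proof (intro conjI allI impI f)
  fix e :: real assume e: "0 < e"
  have "\<forall>\<^sub>F i in sequentially. Lp_norm \<mu> p (\<lambda>x. F i x - f x) < e / 2"
    using lim e by (intro order_tendstoD) auto
  then obtain i where i: "Lp_norm \<mu> p (\<lambda>x. F i x - f x) < e / 2"
    by (auto simp: eventually_sequentially)
  obtain P where P: "real_polynomial_function P" "Lp_norm \<mu> p (\<lambda>x. F i x - P x) < e / 2"
    using F[of i] e unfolding poly_approximable_def by (meson half_gt_zero)
  have "F i \<in> Lp_space \<mu> p" "P \<in> Lp_space \<mu> p"
    using F[of i] polynomial_Lp[OF P(1)] p by (auto simp: poly_approximable_def)
  then have "Lp_norm \<mu> p (\<lambda>x. f x - P x) \<le> Lp_norm \<mu> p (\<lambda>x. f x - F i x) + Lp_norm \<mu> p (\<lambda>x. F i x - P x)"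
    using f by (intro Lp_norm_triangle_mid p)
  then show "\<exists>P. real_polynomial_function P \<and> Lp_norm \<mu> p (\<lambda>x. f x - P x) < e"
    using i P by (intro exI[of _ P]) (auto simp: Lp_norm_minus_commute[of \<mu> p f])
qed

lemma poly_approximable_sum:
  assumes p: "1 \<le> p" and "finite I" "\<And>i. i \<in> I \<Longrightarrow> poly_approximable p (f i)"
  shows "poly_approximable p (\<lambda>x. \<Sum>i\<in>I. f i x)"
  using assms(2,3)
proof (induction I rule: finite_induct)
  case empty
  show ?case using poly_approximable_continuous[OF p continuous_on_const[of UNIV 0]] by simp
next
  case (insert i I)
  then show ?case using poly_approximable_add[OF p, of "f i" "\<lambda>x. \<Sum>i\<in>I. f i x"] by simp
qed

lemma poly_approximable_bounded_limit:
  assumes p: "1 \<le> p" and F: "\<And>i. poly_approximable p (F i)" and f: "f \<in> borel_measurable \<mu>"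
    and lim: "\<And>x. (\<lambda>i. F i x) \<longlonglongrightarrow> f x" and bd: "\<And>i x. \<bar>F i x\<bar> \<le> B" "\<And>x. \<bar>f x\<bar> \<le> B"
  shows "poly_approximable p f"
proof (rule poly_approximable_limit[OF p _ F])
  show "f \<in> Lp_space \<mu> p" using bd p by (intro Lp_space_of_bounded[OF f, of B]) auto
  show "(\<lambda>i. Lp_norm \<mu> p (\<lambda>x. F i x - f x)) \<longlonglongrightarrow> 0"
  proof (rule Lp_dominated_convergence[OF _ _ f lim])
    show "F i \<in> borel_measurable \<mu>" for i using F[of i] by (simp add: poly_approximable_def Lp_space_def)
    show "integrable \<mu> (\<lambda>_. (2 * B) powr p)" by simp
    show "\<bar>F i x - f x\<bar> powr p \<le> (2 * B) powr p" for i x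
      using bd(1)[of i x] bd(2)[of x] p by (intro powr_mono2) auto
  qed (use p in auto)
qed

lemma poly_approximable_closed_indicator:
  assumes p: "1 \<le> p" and C: "closed (C :: (real^'n) set)"
  shows "poly_approximable p (indicator C)"
proof (cases "C = {}")
  case True
  then show ?thesis using poly_approximable_continuous[OF p continuous_on_const[of UNIV 0]]
    by (simp add: indicator_def[abs_def])
next
  case False
  let ?F = "\<lambda>i x. max 0 (1 - real i * infdist x C)"
  show ?thesis
  proof (rule poly_approximable_bounded_limit[OF p])
    show "poly_approximable p (?F i)" for i
      by (intro poly_approximable_continuous p continuous_intros)
    show "indicator C \<in> borel_measurable \<mu>" using C by (intro borel_measurable_indicator) (simp add: borel_closed)
    show "(\<lambda>i. ?F i x) \<longlonglongrightarrow> indicator C x" for x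
    proof (cases "x \<in> C")
      case True
      then have "infdist x C = 0" by simp
      then show ?thesis using True by simp
    next
      case nin: False
      then have pos: "0 < infdist x C"
        using False C by (meson infdist_pos_not_in_closed)
      obtain N :: nat where N: "1 / infdist x C < real N" using reals_Archimedean2 by blast
      have "?F i x = 0" if "N \<le> i" for i
      proof -
        have "1 / infdist x C < real i" using N that by linarith
        then have "1 < real i * infdist x C" using pos by (simp add: pos_divide_less_eq)
        then show ?thesis by simp
      qed
      then have "\<forall>\<^sub>F i in sequentially. ?F i x = indicator C x"
        using nin unfolding eventually_sequentially by (intro exI[of _ N]) auto
      then show ?thesis by (rule tendsto_eventually)
    qed
    show "\<bar>?F i x\<bar> \<le> 1" for i x using infdist_nonneg[of x C] by (auto simp: max_def)
    show "\<bar>indicator C x :: real\<bar> \<le> 1" for x by (simp add: indicator_def)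
  qed
qed

lemma poly_approximable_indicator:
  assumes p: "1 \<le> p" and A: "A \<in> sets \<mu>" shows "poly_approximable p (indicator A)"
proof -
  have "Int_stable (Collect closed :: (real^'n) set set)" "Collect closed \<subseteq> Pow (UNIV :: (real^'n) set)"
    by (auto simp: Int_stable_def)
  moreover have "A \<in> sigma_sets UNIV (Collect closed)"
    using A borel_eq_closed by (metis sets_jacobi sets_measure_of top_greatest Pow_UNIV)
  ultimately show ?thesis
  proof (induction rule: sigma_sets_induct_disjoint)
    case (basic A)
    then show ?case using poly_approximable_closed_indicator[OF p] by simp
  next
    case empty
    show ?case by (rule poly_approximable_closed_indicator[OF p]) simp
  next
    case (compl A)
    have eq: "(\<lambda>x. 1 + (- 1) * indicator A x :: real) = indicator (UNIV - A)"
      by (auto simp: fun_eq_iff indicator_def)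
    show ?case
      using poly_approximable_add[OF p poly_approximable_continuous[OF p continuous_on_const[of UNIV 1]]
          poly_approximable_cmult[OF p compl.IH, of "-1"]] unfolding eq .
  next
    case (union A)
    have meas: "A i \<in> sets \<mu>" for i
      using union.hyps(2) borel_eq_closed by (metis range_subsetD sets_jacobi sets_measure_of top_greatest Pow_UNIV)
    show ?case
    proof (rule poly_approximable_bounded_limit[OF p])
      show "poly_approximable p (\<lambda>x. \<Sum>i<n. indicator (A i) x)" for n
        by (rule poly_approximable_sum[OF p]) (use union.IH in auto)
      show "indicator (\<Union>i. A i) \<in> borel_measurable \<mu>" using meas by auto
      show "\<bar>indicator (\<Union>i. A i) x :: real\<bar> \<le> 1" for x by (simp add: indicator_def)
      have part: "(\<Sum>i<n. indicator (A i) x :: real) = indicator (\<Union>i<n. A i) x" for n x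
        using union.hyps(1) by (subst indicator_UN_disjoint) (auto simp: disjoint_family_on_def)
      show "\<bar>\<Sum>i<n. indicator (A i) x :: real\<bar> \<le> 1" for n x unfolding part by (simp add: indicator_def)
      show "(\<lambda>n. \<Sum>i<n. indicator (A i) x :: real) \<longlonglongrightarrow> indicator (\<Union>i. A i) x" for x
      proof (cases "x \<in> (\<Union>i. A i)")
        case True
        then obtain k where k: "x \<in> A k" by auto
        have "\<forall>\<^sub>F n in sequentially. (\<Sum>i<n. indicator (A i) x :: real) = indicator (\<Union>i. A i) x"
          unfolding eventually_sequentially part
          by (rule exI[of _ "Suc k"]) (use k in \<open>auto simp: indicator_def\<close>)
        then show ?thesis by (rule tendsto_eventually)
      qed (auto simp: indicator_def)
    qed
  qed
qed

text \<open>
  The approximable functions contain the continuous ones by the Stone-Weierstrass theorem, and they are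
  closed under linear combinations and limits. So they contain the indicators of closed sets, by
  Dynkin's lemma those of all Borel sets, hence all simple functions and their limits.
\<close>

theorem polynomials_dense:
  assumes p: "1 \<le> p" and f: "f \<in> Lp_space \<mu> p"
  shows "poly_approximable p f"
proof -
  have fm: "f \<in> borel_measurable \<mu>" using f by (simp add: Lp_space_def)
  obtain F where F: "\<And>i. simple_function \<mu> (F i)" "\<And>x. x \<in> space \<mu> \<Longrightarrow> (\<lambda>i. F i x) \<longlonglongrightarrow> f x"
    "\<And>i x. x \<in> space \<mu> \<Longrightarrow> dist (F i x) 0 \<le> 2 * dist (f x) 0"
    using borel_measurable_implies_sequence_metric[OF fm, of 0] by blast
  show ?thesis
  proof (rule poly_approximable_limit[OF p f])
    show "poly_approximable p (F i)" for i
    proof -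
      have fin: "finite (F i ` space \<mu>)" using F(1) by (rule simple_functionD)
      have "F i = (\<lambda>x. \<Sum>y\<in>F i ` space \<mu>. y * indicator (F i -` {y} \<inter> space \<mu>) x)"
      proof
        fix x
        have "(\<Sum>y\<in>F i ` space \<mu>. y * indicator (F i -` {y} \<inter> space \<mu>) x) = (\<Sum>y\<in>F i ` space \<mu>. if y = F i x then y else 0)"
          by (rule sum.cong) (auto simp: indicator_def)
        then show "F i x = (\<Sum>y\<in>F i ` space \<mu>. y * indicator (F i -` {y} \<inter> space \<mu>) x)"
          using fin by simp
      qed
      moreover have "poly_approximable p (\<lambda>x. \<Sum>y\<in>F i ` space \<mu>. y * indicator (F i -` {y} \<inter> space \<mu>) x)"
        using F(1)[of i] fin
        by (intro poly_approximable_sum p poly_approximable_cmult poly_approximable_indicator simple_functionD(2))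
      ultimately show ?thesis by simp
    qed
    show "(\<lambda>i. Lp_norm \<mu> p (\<lambda>x. F i x - f x)) \<longlonglongrightarrow> 0"
    proof (rule Lp_dominated_convergence[OF _ _ fm])
      show "F i \<in> borel_measurable \<mu>" for i using F(1) by (rule borel_measurable_simple_function)
      show "integrable \<mu> (\<lambda>x. 3 powr p * \<bar>f x\<bar> powr p)" using f by (simp add: Lp_space_def)
      show "\<bar>F i x - f x\<bar> powr p \<le> 3 powr p * \<bar>f x\<bar> powr p" for i x
      proof -
        have "\<bar>F i x - f x\<bar> \<le> 3 * \<bar>f x\<bar>" using F(3)[of x i] by simp
        then have "\<bar>F i x - f x\<bar> powr p \<le> (3 * \<bar>f x\<bar>) powr p" using p by (intro powr_mono2) auto
        then show ?thesis by (simp add: powr_mult)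
      qed
    qed (use F(2) p in auto)
  qed
qed

lemma polynomial_sequence_tendsto:
  assumes p: "1 \<le> p" and f: "f \<in> Lp_space \<mu> p"
  obtains P where "\<And>k. real_polynomial_function (P k)" "Lp_tendsto \<mu> p P f"
proof -
  have "\<exists>P. real_polynomial_function P \<and> Lp_norm \<mu> p (\<lambda>x. f x - P x) < 1 / real (Suc k)" for k
    using polynomials_dense[OF p f] unfolding poly_approximable_def by simp
  then obtain P where P: "\<And>k. real_polynomial_function (P k)" "\<And>k. Lp_norm \<mu> p (\<lambda>x. f x - P k x) < 1 / real (Suc k)"
    by metis
  have "(\<lambda>k. Lp_norm \<mu> p (\<lambda>x. P k x - f x)) \<longlonglongrightarrow> 0"
    by (rule tendsto_sandwich[OF _ _ tendsto_const LIMSEQ_inverse_real_of_nat])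
       (use less_imp_le[OF P(2)] in \<open>auto simp: Lp_norm_minus_commute[of \<mu> p _ f] inverse_eq_divide\<close>)
  then have "Lp_tendsto \<mu> p P f" using f polynomial_Lp[OF P(1)] p by (auto simp: Lp_tendsto_def)
  then show ?thesis using that P(1) by blast
qed

lemma Lp_times_polynomial_integrable:
  assumes p: "1 < p" and f: "f \<in> Lp_space \<mu> p" and g: "real_polynomial_function g"
  shows "integrable \<mu> (\<lambda>x. f x * g x)"
proof -
  define q where "q = p / (p - 1)"
  have "1 < q" "1 / p + 1 / q = 1" using p by (auto simp: q_def field_simps)
  then show ?thesis using Hoelder_inequality(1)[OF p _ _ f polynomial_Lp[OF g]] by simp
qed

lemma coef_diff_Lp:
  assumes "1 < p" "f \<in> Lp_space \<mu> p" "g \<in> Lp_space \<mu> p"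
  shows "coef (\<lambda>x. f x - g x) \<kappa> = coef f \<kappa> - coef g \<kappa>"
  unfolding jacobi_coeff_def left_diff_distrib
  by (intro Bochner_Integration.integral_diff Lp_times_polynomial_integrable[OF assms(1)] assms polyvec_polynomial)

lemma coef_cong_AE:
  assumes "f \<in> borel_measurable \<mu>" "g \<in> borel_measurable \<mu>" "AE x in \<mu>. f x = g x"
  shows "coef f \<kappa> = coef g \<kappa>"
  unfolding jacobi_coeff_def
  using continuous_measurable[OF polynomial_continuous[OF polyvec_polynomial[of \<kappa>]]] assms
  by (intro integral_cong_AE) auto

lemma coef_tendsto:
  assumes p: "1 < p" and F: "Lp_tendsto \<mu> p F f"
  shows "(\<lambda>k. coef (F k) \<kappa>) \<longlonglongrightarrow> coef f \<kappa>"
proof -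
  have mem: "f \<in> Lp_space \<mu> p" "\<And>k. F k \<in> Lp_space \<mu> p"
    and lim: "(\<lambda>k. Lp_norm \<mu> p (\<lambda>x. F k x - f x)) \<longlonglongrightarrow> 0"
    using F by (auto simp: Lp_tendsto_def)
  define q where "q = p / (p - 1)"
  have q: "1 < q" "1 / p + 1 / q = 1" using p by (auto simp: q_def field_simps)
  have p1: "1 \<le> p" using p by simp
  have bd: "\<bar>coef (F k) \<kappa> - coef f \<kappa>\<bar> \<le> Lp_norm \<mu> p (\<lambda>x. F k x - f x) * Lp_norm \<mu> q (\<phi> \<kappa>)" for k
    using Hoelder_inequality(2)[OF p q Lp_space_diff[OF p1 mem(2) mem(1)] polynomial_Lp[OF polyvec_polynomial], of k \<kappa>] q
    by (simp only: coef_diff_Lp[OF p mem(2) mem(1), symmetric] jacobi_coeff_def[of _ _ "\<lambda>x. F k x - f x"])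
  have "(\<lambda>k. coef (F k) \<kappa> - coef f \<kappa>) \<longlonglongrightarrow> 0"
  proof (rule Lim_null_comparison)
    show "(\<lambda>k. Lp_norm \<mu> p (\<lambda>x. F k x - f x) * Lp_norm \<mu> q (\<phi> \<kappa>)) \<longlonglongrightarrow> 0"
      using tendsto_mult_right[OF lim, of "Lp_norm \<mu> q (\<phi> \<kappa>)"] by simp
  qed (use bd in auto)
  then show ?thesis by (simp add: LIM_zero_iff)
qed

text \<open>
  Such a function is orthogonal to all polynomials. Those approximate \<open>signed_powr (p - 1) (z x)\<close> in the dual
  space, and the integral of \<open>z\<close> against it is the integral of \<open>\<bar>z\<bar> powr p\<close>.
\<close>

lemma coef_zero_imp_AE_zero:
  assumes p: "1 < p" and z: "z \<in> Lp_space \<mu> p" and coef: "\<And>\<kappa>. coef z \<kappa> = 0"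
  shows "AE x in \<mu>. z x = 0"
proof -
  define q where "q = p / (p - 1)"
  have q: "1 < q" "1 / p + 1 / q = 1" "(p - 1) * q = p" using p by (auto simp: q_def field_simps)
  have [measurable]: "z \<in> borel_measurable \<mu>" using z by (simp add: Lp_space_def)
  let ?h = "\<lambda>x. signed_powr (p - 1) (z x)"
  have hL: "?h \<in> Lp_space \<mu> q"
    using z unfolding Lp_space_def mem_Collect_eq abs_signed_powr powr_powr q(3) by (simp add: signed_powr_def)
  obtain P where P: "\<And>k. real_polynomial_function (P k)" "Lp_tendsto \<mu> q P ?h"
    using polynomial_sequence_tendsto[OF _ hL] q by auto
  have lim: "(\<lambda>k. Lp_norm \<mu> q (\<lambda>x. P k x - ?h x)) \<longlonglongrightarrow> 0" using P(2) by (simp add: Lp_tendsto_def)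
  have PL: "P k \<in> Lp_space \<mu> q" for k using polynomial_Lp[OF P(1)] q by simp
  have int0: "(\<integral>x. z x * g x \<partial>\<mu>) = 0" if g: "real_polynomial_function g" for g
  proof -
    obtain K where K: "finite K" "\<And>\<kappa>. \<kappa> \<notin> K \<Longrightarrow> coef g \<kappa> = 0" "g = comb K (coef g)"
      using polynomial_expansion[OF g] by blast
    have "(\<integral>x. z x * comb K (coef g) x \<partial>\<mu>) = (\<integral>x. (\<Sum>\<kappa>\<in>K. coef g \<kappa> * (z x * \<phi> \<kappa> x)) \<partial>\<mu>)"
      by (simp add: comb_def sum_distrib_left mult_ac)
    also have "\<dots> = (\<Sum>\<kappa>\<in>K. coef g \<kappa> * (\<integral>x. z x * \<phi> \<kappa> x \<partial>\<mu>))"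
      by (subst Bochner_Integration.integral_sum)
         (auto intro!: Lp_times_polynomial_integrable[OF p z] polyvec_polynomial)
    also have "\<dots> = 0" using coef by (simp add: jacobi_coeff_def)
    finally show ?thesis using K(3) by simp
  qed
  have "(\<integral>x. \<bar>z x\<bar> powr p \<partial>\<mu>) \<le> Lp_norm \<mu> p z * Lp_norm \<mu> q (\<lambda>x. P k x - ?h x)" for k
  proof -
    have dL: "(\<lambda>x. ?h x - P k x) \<in> Lp_space \<mu> q" using q by (intro Lp_space_diff hL PL) auto
    have "(\<integral>x. \<bar>z x\<bar> powr p \<partial>\<mu>) = (\<integral>x. z x * ?h x \<partial>\<mu>)" using mult_signed_powr[of _ "p - 1"] by simp
    also have "\<dots> = (\<integral>x. z x * ?h x \<partial>\<mu>) - (\<integral>x. z x * P k x \<partial>\<mu>)" by (simp add: int0[OF P(1)])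
    also have "\<dots> = (\<integral>x. z x * (?h x - P k x) \<partial>\<mu>)"
      unfolding right_diff_distrib
      by (intro Bochner_Integration.integral_diff[symmetric] Hoelder_inequality(1)[OF p q(1,2) z] hL PL)
    also have "\<dots> \<le> Lp_norm \<mu> p z * Lp_norm \<mu> q (\<lambda>x. ?h x - P k x)"
      using Hoelder_inequality(2)[OF p q(1,2) z dL] by simp
    finally show ?thesis by (simp add: Lp_norm_minus_commute[of \<mu> q ?h])
  qed
  moreover have "(\<lambda>k. Lp_norm \<mu> p z * Lp_norm \<mu> q (\<lambda>x. P k x - ?h x)) \<longlonglongrightarrow> 0"
    using tendsto_mult_left[OF lim, of "Lp_norm \<mu> p z"] by simp
  ultimately have "(\<integral>x. \<bar>z x\<bar> powr p \<partial>\<mu>) \<le> 0"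
    by (intro LIMSEQ_le_const) auto
  then have "Lp_norm \<mu> p z \<le> 0"
    using p by (intro Lp_norm_leI) auto
  then have "Lp_norm \<mu> p z = 0" by (simp add: order_antisym)
  then show ?thesis using AE_eq_0_of_Lp_norm_eq_0[OF _ z] p by simp
qed

text \<open>
  Both functions lie in the larger of the two spaces, the one with exponent \<open>min p q\<close>.
\<close>

lemma coef_eq_imp_AE_eq:
  assumes p: "1 < p" and q: "1 < q" and f: "f \<in> Lp_space \<mu> p" and g: "g \<in> Lp_space \<mu> q"
    and eq: "\<And>\<kappa>. coef f \<kappa> = coef g \<kappa>"
  shows "AE x in \<mu>. f x = g x"
proof -
  define r where "r = min p q"
  have r: "1 < r" "1 \<le> r" "r \<le> p" "r \<le> q" using p q by (auto simp: r_def)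
  have fr: "f \<in> Lp_space \<mu> r" and gr: "g \<in> Lp_space \<mu> r"
    using Lp_norm_mono_exponent(1)[OF r(2,3) f] Lp_norm_mono_exponent(1)[OF r(2,4) g] by auto
  have "AE x in \<mu>. f x - g x = 0"
    using coef_zero_imp_AE_zero[OF r(1) Lp_space_diff[OF r(2) fr gr]] coef_diff_Lp[OF r(1) fr gr] eq by simp
  then show ?thesis by simp
qed

lemma multiplier_tendsto:
  assumes p: "1 < p" and bd: "multiplier_bounded p m C"
    and P: "\<And>k. real_polynomial_function (P k)" and lim: "Lp_tendsto \<mu> p P f"
  shows "\<exists>h. Lp_tendsto \<mu> p (\<lambda>k. multiplier m (P k)) h \<and>
    (\<forall>\<kappa>. coef h \<kappa> = m \<kappa> * coef f \<kappa>) \<and> Lp_norm \<mu> p h \<le> C * Lp_norm \<mu> p f"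
proof -
  have p1: "1 \<le> p" using p by simp
  have C: "0 \<le> C" using bd by (simp add: multiplier_bounded_def)
  have "\<exists>h. Lp_tendsto \<mu> p (\<lambda>k. multiplier m (P k)) h"
  proof (rule Lp_complete[OF p1])
    show "multiplier m (P k) \<in> Lp_space \<mu> p" for k using polynomial_Lp[OF multiplier_polynomial[OF P]] p by simp
    fix e :: real assume e: "0 < e"
    then have "0 < e / (C + 1)" using C by (intro divide_pos_pos) auto
    then obtain N where N: "\<forall>i\<ge>N. \<forall>j\<ge>N. Lp_norm \<mu> p (\<lambda>x. P i x - P j x) < e / (C + 1)"
      using Lp_tendsto_Cauchy[OF p1 lim] by blast
    have "Lp_norm \<mu> p (\<lambda>x. multiplier m (P i) x - multiplier m (P j) x) < e" if "N \<le> i" "N \<le> j" for i j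
    proof -
      have "Lp_norm \<mu> p (\<lambda>x. multiplier m (P i) x - multiplier m (P j) x) \<le> C * Lp_norm \<mu> p (\<lambda>x. P i x - P j x)"
        using bd real_polynomial_function_diff[OF P P, of i j]
        by (auto simp: multiplier_bounded_def multiplier_diff[OF P P, symmetric])
      also have "\<dots> \<le> (C + 1) * Lp_norm \<mu> p (\<lambda>x. P i x - P j x)" by (intro mult_right_mono) auto
      also have "\<dots> < e" using N that C by (auto simp: pos_less_divide_eq mult.commute)
      finally show ?thesis .
    qed
    then show "\<exists>N. \<forall>i\<ge>N. \<forall>j\<ge>N. Lp_norm \<mu> p (\<lambda>x. multiplier m (P i) x - multiplier m (P j) x) < e" by blast
  qed
  then obtain h where h: "Lp_tendsto \<mu> p (\<lambda>k. multiplier m (P k)) h" by blast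
  show ?thesis
  proof (intro exI[of _ h] conjI h allI)
    fix \<kappa>
    have "(\<lambda>k. m \<kappa> * coef (P k) \<kappa>) \<longlonglongrightarrow> coef h \<kappa>"
      using coef_tendsto[OF p h, of \<kappa>] by (simp add: coef_multiplier[OF P])
    moreover have "(\<lambda>k. m \<kappa> * coef (P k) \<kappa>) \<longlonglongrightarrow> m \<kappa> * coef f \<kappa>"
      by (intro tendsto_intros coef_tendsto[OF p lim])
    ultimately show "coef h \<kappa> = m \<kappa> * coef f \<kappa>" by (rule LIMSEQ_unique)
  next
    show "Lp_norm \<mu> p h \<le> C * Lp_norm \<mu> p f"
    proof (rule LIMSEQ_le)
      show "(\<lambda>k. Lp_norm \<mu> p (multiplier m (P k))) \<longlonglongrightarrow> Lp_norm \<mu> p h" by (rule Lp_tendsto_norm[OF p1 h])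
      show "(\<lambda>k. C * Lp_norm \<mu> p (P k)) \<longlonglongrightarrow> C * Lp_norm \<mu> p f"
        by (intro tendsto_intros Lp_tendsto_norm[OF p1 lim])
      show "\<exists>N. \<forall>k\<ge>N. Lp_norm \<mu> p (multiplier m (P k)) \<le> C * Lp_norm \<mu> p (P k)"
        using bd P by (auto simp: multiplier_bounded_def)
    qed
  qed
qed

lemma multiplier_extend:
  assumes p: "1 < p" and bd: "multiplier_bounded p m C" and f: "f \<in> Lp_space \<mu> p"
  shows "\<exists>h \<in> Lp_space \<mu> p. (\<forall>\<kappa>. coef h \<kappa> = m \<kappa> * coef f \<kappa>) \<and> Lp_norm \<mu> p h \<le> C * Lp_norm \<mu> p f"
proof -
  obtain P where P: "\<And>k. real_polynomial_function (P k)" "Lp_tendsto \<mu> p P f"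
    using polynomial_sequence_tendsto[OF _ f] p by auto
  show ?thesis
    using multiplier_tendsto[where P=P, OF p bd P] by (auto simp: Lp_tendsto_def)
qed

text \<open>
  The value at \<open>\<kappa> = 0\<close> contributes the mean, which is bounded by the norm.
\<close>

lemma multiplier_bounded_add_const:
  assumes p: "1 < p" and bd: "multiplier_bounded p (\<lambda>\<kappa>. if \<kappa> = 0 then 0 else m \<kappa>) C"
  shows "multiplier_bounded p (\<lambda>\<kappa>. if \<kappa> = 0 then 1 else m \<kappa>) (C + 1)"
  unfolding multiplier_bounded_def
proof (intro conjI allI impI)
  have C: "0 \<le> C" using bd by (simp add: multiplier_bounded_def)
  then show "0 \<le> C + 1" by simp
  fix f :: "real^'n \<Rightarrow> real" assume f: "real_polynomial_function f"
  let ?m = "\<lambda>\<kappa>. if \<kappa> = 0 then 0 else m \<kappa>"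
  have "multiplier (\<lambda>\<kappa>. if \<kappa> = 0 then 1 else m \<kappa>) f = (\<lambda>x. multiplier ?m f x + (\<integral>y. f y \<partial>\<mu>))"
  proof (rule polynomial_eqI)
    show "coef (multiplier (\<lambda>\<kappa>. if \<kappa> = 0 then 1 else m \<kappa>) f) \<kappa> = coef (\<lambda>x. multiplier ?m f x + (\<integral>y. f y \<partial>\<mu>)) \<kappa>" for \<kappa>
      using f by (simp add: coef_add multiplier_polynomial real_polynomial_function.intros coef_multiplier coef_const coef_0)
  qed (intro poly_intros f)+
  moreover have "Lp_norm \<mu> p (\<lambda>x. multiplier ?m f x + (\<integral>y. f y \<partial>\<mu>)) \<le> Lp_norm \<mu> p (multiplier ?m f) + \<bar>\<integral>y. f y \<partial>\<mu>\<bar>"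
    using Lp_norm_triangle[OF _ polynomial_Lp[OF multiplier_polynomial[OF f]] Lp_space_const[of p "\<integral>y. f y \<partial>\<mu>"], of ?m] p
    by (simp add: Lp_norm_const)
  moreover have "\<bar>\<integral>y. f y \<partial>\<mu>\<bar> \<le> Lp_norm \<mu> p f"
    using p by (intro abs_integral_le_Lp_norm polynomial_Lp f) auto
  moreover have "Lp_norm \<mu> p (multiplier ?m f) \<le> C * Lp_norm \<mu> p f"
    using bd f by (auto simp: multiplier_bounded_def)
  ultimately show "Lp_norm \<mu> p (multiplier (\<lambda>\<kappa>. if \<kappa> = 0 then 1 else m \<kappa>) f) \<le> (C + 1) * Lp_norm \<mu> p f"
    by (simp add: algebra_simps)
qed

end

section \<open>Sobolev spaces and the fractional derivative\<close>

locale jacobi_sobolev_setting = jacobi \<alpha> \<beta> for \<alpha> \<beta> :: "real^'n" +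
  fixes \<gamma> :: real
  assumes gamma: "\<gamma> > 0"
begin

definition bessel_inv_weight :: "nat^'n \<Rightarrow> real" where
  "bessel_inv_weight \<kappa> = (1 + ev \<kappa>) powr (\<gamma> / 2)"

text \<open>
  At \<open>\<kappa> = 0\<close> this is \<open>0 powr (\<gamma> / 2) = 0\<close>: constants are annihilated.
\<close>

definition deriv_weight :: "nat^'n \<Rightarrow> real" where
  "deriv_weight \<kappa> = ev \<kappa> powr (\<gamma> / 2)"

abbreviation "bessel_inv \<equiv> multiplier bessel_inv_weight"
abbreviation "frac_deriv \<equiv> multiplier deriv_weight"

text \<open>
  The levels enumerate the eigenvalues without repetition, so summing over levels and then over the
  indices of a level runs through each index once.
\<close>

lemma spectral_sum_eq_multiplier:
  assumes f: "real_polynomial_function f"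
  shows "(\<Sum>n. h (jacobi_level \<alpha> \<beta> n) * jacobi_proj \<alpha> \<beta> n f x) = multiplier (\<lambda>\<kappa>. h (ev \<kappa>)) f x"
proof -
  let ?lev = "jacobi_level \<alpha> \<beta>"
  define K where "K = {\<kappa>. coef f \<kappa> \<noteq> 0}"
  obtain J where J: "finite J" "\<And>\<kappa>. \<kappa> \<notin> J \<Longrightarrow> coef f \<kappa> = 0" "f = comb J (coef f)"
    using polynomial_expansion[OF f] by blast
  have K: "finite K" unfolding K_def by (rule finite_subset[OF _ J(1)]) (use J(2) in blast)
  have inj: "inj ?lev" using jacobi_level(1) by (rule strict_mono_imp_inj_on)
  define idx where "idx \<kappa> = inv ?lev (ev \<kappa>)" for \<kappa>
  have lev_idx: "?lev (idx \<kappa>) = ev \<kappa>" for \<kappa>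
    unfolding idx_def by (rule f_inv_into_f) (simp add: jacobi_level(2))
  have idx_iff: "idx \<kappa> = n \<longleftrightarrow> \<kappa> \<in> jacobi_index \<alpha> \<beta> n" for \<kappa> n
    unfolding jacobi_index_def mem_Collect_eq lev_idx[symmetric] using inj_eq[OF inj] by simp
  have term_eq: "h (?lev n) * jacobi_proj \<alpha> \<beta> n f x = (\<Sum>\<kappa> | \<kappa> \<in> K \<and> idx \<kappa> = n. h (ev \<kappa>) * coef f \<kappa> * \<phi> \<kappa> x)" for n
  proof -
    have "h (?lev n) * jacobi_proj \<alpha> \<beta> n f x = (\<Sum>\<kappa>\<in>jacobi_index \<alpha> \<beta> n. h (ev \<kappa>) * coef f \<kappa> * \<phi> \<kappa> x)"
      unfolding jacobi_proj_def sum_distrib_left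
      by (rule sum.cong) (simp_all add: jacobi_index_def mult.assoc)
    also have "\<dots> = (\<Sum>\<kappa> | \<kappa> \<in> K \<and> idx \<kappa> = n. h (ev \<kappa>) * coef f \<kappa> * \<phi> \<kappa> x)"
      unfolding idx_iff
      by (rule sum.mono_neutral_right[OF finite_jacobi_index]) (auto simp: K_def)
    finally show ?thesis .
  qed
  have "(\<Sum>n. h (?lev n) * jacobi_proj \<alpha> \<beta> n f x) = (\<Sum>n\<in>idx ` K. h (?lev n) * jacobi_proj \<alpha> \<beta> n f x)"
  proof (rule suminf_finite)
    fix n assume "n \<notin> idx ` K"
    then have empty: "{\<kappa>. \<kappa> \<in> K \<and> idx \<kappa> = n} = {}" by auto
    show "h (?lev n) * jacobi_proj \<alpha> \<beta> n f x = 0" by (simp only: term_eq empty sum.empty)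
  qed (use K in simp)
  also have "\<dots> = (\<Sum>\<kappa>\<in>K. h (ev \<kappa>) * coef f \<kappa> * \<phi> \<kappa> x)"
    unfolding term_eq using K by (intro sum.group) auto
  finally show ?thesis by (simp add: multiplier_def K_def)
qed

lemma frac_deriv_poly_eq: "real_polynomial_function f \<Longrightarrow> jacobi_frac_deriv_poly \<alpha> \<beta> \<gamma> f = frac_deriv f"
  using spectral_sum_eq_multiplier[of f "\<lambda>t. t powr (\<gamma> / 2)"]
  by (auto simp: fun_eq_iff jacobi_frac_deriv_poly_def deriv_weight_def[abs_def])

lemma bessel_inv_poly_eq: "real_polynomial_function f \<Longrightarrow> jacobi_bessel_inv_poly \<alpha> \<beta> \<gamma> f = bessel_inv f"
  using spectral_sum_eq_multiplier[of f "\<lambda>t. (1 + t) powr (\<gamma> / 2)"]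
  by (auto simp: fun_eq_iff jacobi_bessel_inv_poly_def bessel_inv_weight_def[abs_def])

lemma bessel_inv_weight_pos: "0 < bessel_inv_weight \<kappa>"
  using eigenvalue_nonneg[of \<kappa>] by (simp add: bessel_inv_weight_def)

lemma weight_0: "bessel_inv_weight 0 = 1" "deriv_weight 0 = 0"
  by (simp_all add: bessel_inv_weight_def deriv_weight_def eigenvalue_0)

lemma bessel_bounded:
  assumes p: "1 < p" shows "\<exists>C. multiplier_bounded p (\<lambda>\<kappa>. inverse (bessel_inv_weight \<kappa>)) C"
proof -
  obtain C where C: "multiplier_bounded p (\<lambda>\<kappa>. if \<kappa> = 0 then 0 else (1 + ev \<kappa>) powr (- (\<gamma> / 2))) C"
    using bessel_mult_bounded[OF p, of "\<gamma> / 2"] gamma by auto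
  have "(\<lambda>\<kappa>. if \<kappa> = 0 then 1 else (1 + ev \<kappa>) powr (- (\<gamma> / 2))) = (\<lambda>\<kappa>. inverse (bessel_inv_weight \<kappa>))"
    by (auto simp: fun_eq_iff bessel_inv_weight_def powr_minus eigenvalue_0)
  then show ?thesis using multiplier_bounded_add_const[OF p C] by auto
qed

lemma deriv_over_bessel_bounded:
  assumes p: "1 < p" shows "\<exists>C. multiplier_bounded p (\<lambda>\<kappa>. deriv_weight \<kappa> / bessel_inv_weight \<kappa>) C"
proof -
  have "(\<lambda>\<kappa>. if \<kappa> = 0 then 0 else (ev \<kappa> / (1 + ev \<kappa>)) powr (\<gamma> / 2)) = (\<lambda>\<kappa>. deriv_weight \<kappa> / bessel_inv_weight \<kappa>)"
    using eigenvalue_nonneg by (auto simp: fun_eq_iff eigenvalue_0 bessel_inv_weight_def deriv_weight_def powr_divide)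
  then show ?thesis using ratio_mult_bounded[OF p, of "\<gamma> / 2"] by simp
qed

lemma bessel_over_deriv_bounded:
  assumes p: "1 < p"
  shows "\<exists>C. multiplier_bounded p (\<lambda>\<kappa>. if \<kappa> = 0 then 0 else bessel_inv_weight \<kappa> / deriv_weight \<kappa>) C"
proof -
  have "(ev \<kappa> / (1 + ev \<kappa>)) powr (- (\<gamma> / 2)) = bessel_inv_weight \<kappa> / deriv_weight \<kappa>" if "\<kappa> \<noteq> 0" for \<kappa>
    using eigenvalue_ge_1[OF that]
    by (simp add: bessel_inv_weight_def deriv_weight_def powr_divide powr_minus_divide)
  then have "(\<lambda>\<kappa>. if \<kappa> = 0 then 0 else (ev \<kappa> / (1 + ev \<kappa>)) powr (- (\<gamma> / 2)))
      = (\<lambda>\<kappa>. if \<kappa> = 0 then 0 else bessel_inv_weight \<kappa> / deriv_weight \<kappa>)" by auto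
  then show ?thesis using ratio_mult_bounded[OF p, of "- (\<gamma> / 2)"] by simp
qed

text \<open>
  This says that \<open>f\<close> is the Bessel potential of \<open>w\<close>. In terms of coefficients it is one equation for each
  index, and no approximating sequence occurs.
\<close>

definition bessel_preimage :: "real \<Rightarrow> (real^'n \<Rightarrow> real) \<Rightarrow> (real^'n \<Rightarrow> real) \<Rightarrow> bool" where
  "bessel_preimage p f w \<longleftrightarrow> f \<in> Lp_space \<mu> p \<and> w \<in> Lp_space \<mu> p \<and>
     (\<forall>\<kappa>. coef w \<kappa> = bessel_inv_weight \<kappa> * coef f \<kappa>)"

lemma bessel_preimage_of_limits:
  assumes p: "1 < p" and P: "\<And>k. real_polynomial_function (P k)"
    and f: "Lp_tendsto \<mu> p P f" and w: "Lp_tendsto \<mu> p (\<lambda>k. bessel_inv (P k)) w"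
  shows "bessel_preimage p f w"
proof -
  have "coef w \<kappa> = bessel_inv_weight \<kappa> * coef f \<kappa>" for \<kappa>
  proof (rule LIMSEQ_unique)
    show "(\<lambda>k. bessel_inv_weight \<kappa> * coef (P k) \<kappa>) \<longlonglongrightarrow> coef w \<kappa>"
      using coef_tendsto[OF p w, of \<kappa>] by (simp add: coef_multiplier[OF P])
    show "(\<lambda>k. bessel_inv_weight \<kappa> * coef (P k) \<kappa>) \<longlonglongrightarrow> bessel_inv_weight \<kappa> * coef f \<kappa>"
      by (intro tendsto_intros coef_tendsto[OF p f])
  qed
  then show ?thesis using f w by (auto simp: bessel_preimage_def Lp_tendsto_def)
qed

lemma bessel_inv_bessel:
  assumes "real_polynomial_function R"
  shows "bessel_inv (multiplier (\<lambda>\<kappa>. inverse (bessel_inv_weight \<kappa>)) R) = R"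
  unfolding multiplier_mult[OF assms]
  by (rule multiplier_one[OF assms]) (use bessel_inv_weight_pos in \<open>simp add: less_imp_neq[THEN not_sym]\<close>)

text \<open>
  Polynomials approximating \<open>w\<close> are mapped by the Bessel potential, a bounded multiplier, to polynomials
  that converge to a function with the coefficients of \<open>f\<close>.
\<close>

lemma bessel_preimage_approx:
  assumes p: "1 < p" and fw: "bessel_preimage p f w"
  obtains P where "\<And>k. real_polynomial_function (P k)" "Lp_tendsto \<mu> p P f"
    "Lp_tendsto \<mu> p (\<lambda>k. bessel_inv (P k)) w"
proof -
  have f: "f \<in> Lp_space \<mu> p" and w: "w \<in> Lp_space \<mu> p" and coef: "\<And>\<kappa>. coef w \<kappa> = bessel_inv_weight \<kappa> * coef f \<kappa>"
    using fw by (auto simp: bessel_preimage_def)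
  obtain R where R: "\<And>k. real_polynomial_function (R k)" "Lp_tendsto \<mu> p R w"
    using polynomial_sequence_tendsto[OF _ w] p by auto
  obtain C where C: "multiplier_bounded p (\<lambda>\<kappa>. inverse (bessel_inv_weight \<kappa>)) C" using bessel_bounded[OF p] by blast
  define P where "P k = multiplier (\<lambda>\<kappa>. inverse (bessel_inv_weight \<kappa>)) (R k)" for k
  have P: "real_polynomial_function (P k)" for k unfolding P_def by (rule multiplier_polynomial[OF R(1)])
  obtain h where h: "Lp_tendsto \<mu> p P h" "\<And>\<kappa>. coef h \<kappa> = inverse (bessel_inv_weight \<kappa>) * coef w \<kappa>"
    using multiplier_tendsto[where P=R, OF p C R] unfolding P_def[symmetric] by auto
  have "coef h \<kappa> = coef f \<kappa>" for \<kappa>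
    unfolding h(2) coef using bessel_inv_weight_pos[of \<kappa>] by simp
  then have "AE x in \<mu>. h x = f x"
    using coef_eq_imp_AE_eq[OF p p _ f] h(1) by (simp add: Lp_tendsto_def)
  then have "Lp_tendsto \<mu> p P f" using f by (intro Lp_tendsto_cong_AE[OF h(1)]) (auto simp: Lp_space_def)
  moreover have "Lp_tendsto \<mu> p (\<lambda>k. bessel_inv (P k)) w"
    using R(2) by (simp add: P_def bessel_inv_bessel[OF R(1)])
  ultimately show ?thesis using that P by blast
qed

lemma sobolev_norm_poly_eq:
  "real_polynomial_function f \<Longrightarrow> jacobi_sobolev_norm_poly \<alpha> \<beta> p \<gamma> f = Lp_norm \<mu> p (bessel_inv f)"
  by (simp add: jacobi_sobolev_norm_poly_def bessel_inv_poly_eq)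

lemma sobolev_approx_iff:
  assumes p: "1 < p"
  shows "jacobi_sobolev_approx \<alpha> \<beta> p \<gamma> P f \<longleftrightarrow> (\<forall>k. real_polynomial_function (P k)) \<and> Lp_tendsto \<mu> p P f \<and>
    (\<exists>w. Lp_tendsto \<mu> p (\<lambda>k. bessel_inv (P k)) w)"
proof (cases "\<forall>k. real_polynomial_function (P k)")
  case True
  then have P: "\<And>k. real_polynomial_function (P k)" by blast
  have p1: "1 \<le> p" using p by simp
  have eq: "jacobi_sobolev_norm_poly \<alpha> \<beta> p \<gamma> (\<lambda>x. P m x - P n x) = Lp_norm \<mu> p (\<lambda>x. bessel_inv (P m) x - bessel_inv (P n) x)" for m n
    by (simp add: sobolev_norm_poly_eq real_polynomial_function_diff P multiplier_diff[OF P P])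
  have L: "bessel_inv (P k) \<in> Lp_space \<mu> p" for k using polynomial_Lp[OF multiplier_polynomial[OF P]] p by simp
  have "(\<forall>e>0. \<exists>N. \<forall>m\<ge>N. \<forall>n\<ge>N. Lp_norm \<mu> p (\<lambda>x. bessel_inv (P m) x - bessel_inv (P n) x) < e)
      \<longleftrightarrow> (\<exists>w. Lp_tendsto \<mu> p (\<lambda>k. bessel_inv (P k)) w)"
    using Lp_complete[OF p1, of "\<lambda>k. bessel_inv (P k)", OF L] Lp_tendsto_Cauchy[OF p1, of \<mu> "\<lambda>k. bessel_inv (P k)"] by blast
  then show ?thesis unfolding jacobi_sobolev_approx_def eq using True by blast
qed (auto simp: jacobi_sobolev_approx_def)

lemma sobolev_iff:
  assumes p: "1 < p"
  shows "f \<in> jacobi_sobolev \<alpha> \<beta> p \<gamma> \<longleftrightarrow> (\<exists>w. bessel_preimage p f w)"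
proof
  assume "f \<in> jacobi_sobolev \<alpha> \<beta> p \<gamma>"
  then show "\<exists>w. bessel_preimage p f w"
    unfolding jacobi_sobolev_def mem_Collect_eq sobolev_approx_iff[OF p]
    using bessel_preimage_of_limits[OF p] by blast
next
  assume "\<exists>w. bessel_preimage p f w"
  then obtain w where "bessel_preimage p f w" by blast
  from bessel_preimage_approx[OF p this] show "f \<in> jacobi_sobolev \<alpha> \<beta> p \<gamma>"
    unfolding jacobi_sobolev_def mem_Collect_eq sobolev_approx_iff[OF p] by metis
qed

text \<open>
  Any two admissible sequences lead to functions \<open>w\<close> and \<open>w'\<close> with the same coefficients, hence to the same
  limit of the norms.
\<close>

lemma sobolev_norm_eq:
  assumes p: "1 < p" and fw: "bessel_preimage p f w"
  shows "jacobi_sobolev_norm \<alpha> \<beta> p \<gamma> f = Lp_norm \<mu> p w"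
  unfolding jacobi_sobolev_norm_def
proof (rule the_equality)
  have p1: "1 \<le> p" using p by simp
  obtain P where P: "\<And>k. real_polynomial_function (P k)" "Lp_tendsto \<mu> p P f" "Lp_tendsto \<mu> p (\<lambda>k. bessel_inv (P k)) w"
    using bessel_preimage_approx[OF p fw] by metis
  have "(\<lambda>k. jacobi_sobolev_norm_poly \<alpha> \<beta> p \<gamma> (P k)) \<longlonglongrightarrow> Lp_norm \<mu> p w"
    using Lp_tendsto_norm[OF p1 P(3)] by (simp add: sobolev_norm_poly_eq[OF P(1)])
  then show "\<exists>P. jacobi_sobolev_approx \<alpha> \<beta> p \<gamma> P f \<and> (\<lambda>k. jacobi_sobolev_norm_poly \<alpha> \<beta> p \<gamma> (P k)) \<longlonglongrightarrow> Lp_norm \<mu> p w"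
    unfolding sobolev_approx_iff[OF p] using P by blast
  fix l assume "\<exists>P. jacobi_sobolev_approx \<alpha> \<beta> p \<gamma> P f \<and> (\<lambda>k. jacobi_sobolev_norm_poly \<alpha> \<beta> p \<gamma> (P k)) \<longlonglongrightarrow> l"
  then obtain Q w' where Q: "\<And>k. real_polynomial_function (Q k)" "Lp_tendsto \<mu> p Q f"
      "Lp_tendsto \<mu> p (\<lambda>k. bessel_inv (Q k)) w'" "(\<lambda>k. jacobi_sobolev_norm_poly \<alpha> \<beta> p \<gamma> (Q k)) \<longlonglongrightarrow> l"
    unfolding sobolev_approx_iff[OF p] by blast
  have "bessel_preimage p f w'" by (rule bessel_preimage_of_limits[OF p Q(1-3)])
  then have w': "w' \<in> Lp_space \<mu> p" "\<And>\<kappa>. coef w' \<kappa> = coef w \<kappa>" and w: "w \<in> Lp_space \<mu> p"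
    using fw by (auto simp: bessel_preimage_def)
  have "AE x in \<mu>. w' x = w x" by (rule coef_eq_imp_AE_eq[OF p p w'(1) w w'(2)])
  then have "Lp_norm \<mu> p w' = Lp_norm \<mu> p w"
    using w w' by (intro Lp_norm_cong_AE) (auto simp: Lp_space_def)
  moreover have "(\<lambda>k. jacobi_sobolev_norm_poly \<alpha> \<beta> p \<gamma> (Q k)) \<longlonglongrightarrow> Lp_norm \<mu> p w'"
    using Lp_tendsto_norm[OF p1 Q(3)] by (simp add: sobolev_norm_poly_eq[OF Q(1)])
  ultimately show "l = Lp_norm \<mu> p w" using Q(4) LIMSEQ_unique by metis
qed

lemma bessel_preimage_polynomial:
  "1 < p \<Longrightarrow> real_polynomial_function P \<Longrightarrow> bessel_preimage p P (bessel_inv P)"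
  by (simp add: bessel_preimage_def polynomial_Lp multiplier_polynomial coef_multiplier)

lemma bessel_preimage_diff:
  assumes p: "1 < p" and "bessel_preimage p f w" "bessel_preimage p g v"
  shows "bessel_preimage p (\<lambda>x. f x - g x) (\<lambda>x. w x - v x)"
  using assms Lp_space_diff[of p _ \<mu>] by (auto simp: bessel_preimage_def coef_diff_Lp[OF p] right_diff_distrib)

lemma sobolev_tendsto_iff:
  assumes p: "1 < p" and P: "\<And>k. real_polynomial_function (P k)" and fw: "bessel_preimage p f w"
  shows "jacobi_sobolev_tendsto \<alpha> \<beta> p \<gamma> P f \<longleftrightarrow> Lp_tendsto \<mu> p (\<lambda>k. bessel_inv (P k)) w"
proof -
  have norm: "jacobi_sobolev_norm \<alpha> \<beta> p \<gamma> (\<lambda>x. P k x - f x) = Lp_norm \<mu> p (\<lambda>x. bessel_inv (P k) x - w x)" for k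
    by (rule sobolev_norm_eq[OF p bessel_preimage_diff[OF p bessel_preimage_polynomial[OF p P] fw]])
  have "f \<in> jacobi_sobolev \<alpha> \<beta> p \<gamma>" "P k \<in> jacobi_sobolev \<alpha> \<beta> p \<gamma>" for k
    using fw bessel_preimage_polynomial[OF p P] by (auto simp: sobolev_iff[OF p])
  moreover have "w \<in> Lp_space \<mu> p" "bessel_inv (P k) \<in> Lp_space \<mu> p" for k
    using fw bessel_preimage_polynomial[OF p P] by (auto simp: bessel_preimage_def)
  ultimately show ?thesis
    unfolding jacobi_sobolev_tendsto_def Lp_tendsto_def norm by blast
qed

definition has_frac_deriv_coefs :: "(real^'n \<Rightarrow> real) \<Rightarrow> (real^'n \<Rightarrow> real) \<Rightarrow> bool" where
  "has_frac_deriv_coefs f g \<longleftrightarrow> (\<forall>\<kappa>. coef g \<kappa> = deriv_weight \<kappa> * coef f \<kappa>)"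

text \<open>
  The fractional derivative of \<open>P k\<close> is a bounded multiplier applied to \<open>bessel_inv (P k)\<close>, which converges to
  the preimage of \<open>f\<close>.
\<close>

lemma frac_deriv_limit:
  assumes p: "1 < p" and P: "\<And>k. real_polynomial_function (P k)" and lim: "jacobi_sobolev_tendsto \<alpha> \<beta> p \<gamma> P f"
  shows "\<exists>g. Lp_tendsto \<mu> p (\<lambda>k. jacobi_frac_deriv_poly \<alpha> \<beta> \<gamma> (P k)) g \<and> has_frac_deriv_coefs f g"
proof -
  obtain w where fw: "bessel_preimage p f w"
    using lim sobolev_iff[OF p] by (auto simp: jacobi_sobolev_tendsto_def)
  have w: "Lp_tendsto \<mu> p (\<lambda>k. bessel_inv (P k)) w" using lim sobolev_tendsto_iff[where P=P, OF p P fw] by blast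
  obtain C where C: "multiplier_bounded p (\<lambda>\<kappa>. deriv_weight \<kappa> / bessel_inv_weight \<kappa>) C"
    using deriv_over_bessel_bounded[OF p] by blast
  obtain g where g: "Lp_tendsto \<mu> p (\<lambda>k. multiplier (\<lambda>\<kappa>. deriv_weight \<kappa> / bessel_inv_weight \<kappa>) (bessel_inv (P k))) g"
    "\<And>\<kappa>. coef g \<kappa> = deriv_weight \<kappa> / bessel_inv_weight \<kappa> * coef w \<kappa>"
    using multiplier_tendsto[where P="\<lambda>k. bessel_inv (P k)", OF p C multiplier_polynomial[OF P] w] by auto
  have nz: "bessel_inv_weight \<kappa> \<noteq> 0" for \<kappa> using bessel_inv_weight_pos[of \<kappa>] by simp
  have "multiplier (\<lambda>\<kappa>. deriv_weight \<kappa> / bessel_inv_weight \<kappa>) (bessel_inv (P k)) = jacobi_frac_deriv_poly \<alpha> \<beta> \<gamma> (P k)" for k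
    using nz by (simp add: multiplier_mult[OF P] frac_deriv_poly_eq[OF P])
  moreover have "has_frac_deriv_coefs f g"
    using fw nz by (simp add: has_frac_deriv_coefs_def g(2) bessel_preimage_def)
  ultimately show ?thesis using g(1) by auto
qed

lemma frac_deriv_coefs:
  assumes p: "1 < p" and P: "\<And>k. real_polynomial_function (P k)" and lim: "jacobi_sobolev_tendsto \<alpha> \<beta> p \<gamma> P f"
    and g: "Lp_tendsto \<mu> p (\<lambda>k. jacobi_frac_deriv_poly \<alpha> \<beta> \<gamma> (P k)) g"
  shows "has_frac_deriv_coefs f g"
proof -
  obtain h where h: "Lp_tendsto \<mu> p (\<lambda>k. jacobi_frac_deriv_poly \<alpha> \<beta> \<gamma> (P k)) h" "has_frac_deriv_coefs f h"
    using frac_deriv_limit[OF p P lim] by blast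
  have "AE x in \<mu>. g x = h x" using Lp_tendsto_unique[OF _ g h(1)] p by simp
  then have "coef g \<kappa> = coef h \<kappa>" for \<kappa>
    using g h(1) by (intro coef_cong_AE) (auto simp: Lp_tendsto_def Lp_space_def)
  then show ?thesis using h(2) by (simp add: has_frac_deriv_coefs_def)
qed

text \<open>
  The coefficients of a fractional derivative depend only on those of the function, which explains why
  neither the sequence nor the exponent matters.
\<close>

lemma has_frac_deriv_coefs_unique:
  assumes "1 < p" "1 < q" "g \<in> Lp_space \<mu> p" "h \<in> Lp_space \<mu> q"
    and "has_frac_deriv_coefs f g" "has_frac_deriv_coefs f' h" and "\<And>\<kappa>. coef f \<kappa> = coef f' \<kappa>"
  shows "AE x in \<mu>. g x = h x"
  using assms(5-7) by (intro coef_eq_imp_AE_eq[OF assms(1-4)]) (simp add: has_frac_deriv_coefs_def)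

lemma is_frac_deriv_coefs:
  assumes "is_jacobi_frac_deriv \<alpha> \<beta> \<gamma> f g"
  shows "\<exists>p>1. g \<in> Lp_space \<mu> p \<and> has_frac_deriv_coefs f g"
proof -
  obtain p P where p: "1 < p" and P: "\<And>k. real_polynomial_function (P k)" "jacobi_sobolev_tendsto \<alpha> \<beta> p \<gamma> P f"
    "Lp_tendsto \<mu> p (\<lambda>k. jacobi_frac_deriv_poly \<alpha> \<beta> \<gamma> (P k)) g"
    using assms unfolding is_jacobi_frac_deriv_def by blast
  then show ?thesis using frac_deriv_coefs[OF p P] by (auto simp: Lp_tendsto_def)
qed

lemma sobolev_has_frac_deriv:
  assumes p: "1 < p" and f: "f \<in> jacobi_sobolev \<alpha> \<beta> p \<gamma>"
  shows "\<exists>g. is_jacobi_frac_deriv \<alpha> \<beta> \<gamma> f g \<and> g \<in> Lp_space \<mu> p"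
proof -
  obtain w where fw: "bessel_preimage p f w" using f sobolev_iff[OF p] by blast
  obtain P where P: "\<And>k. real_polynomial_function (P k)" "Lp_tendsto \<mu> p (\<lambda>k. bessel_inv (P k)) w"
    using bessel_preimage_approx[OF p fw] by metis
  have lim: "jacobi_sobolev_tendsto \<alpha> \<beta> p \<gamma> P f" using sobolev_tendsto_iff[where P=P, OF p P(1) fw] P(2) by blast
  obtain g where g: "Lp_tendsto \<mu> p (\<lambda>k. jacobi_frac_deriv_poly \<alpha> \<beta> \<gamma> (P k)) g"
    using frac_deriv_limit[OF p P(1) lim] by auto
  have "is_jacobi_frac_deriv \<alpha> \<beta> \<gamma> f g"
    unfolding is_jacobi_frac_deriv_def by (rule exI[of _ p], intro conjI p exI[of _ P] allI P(1) lim g)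
  then show ?thesis using g by (auto simp: Lp_tendsto_def)
qed

lemma is_jacobi_frac_deriv_operator:
  assumes "f \<in> jacobi_sobolev_union \<alpha> \<beta> \<gamma>"
  shows "is_jacobi_frac_deriv \<alpha> \<beta> \<gamma> f (jacobi_frac_deriv \<alpha> \<beta> \<gamma> f)"
proof -
  obtain p where "1 < p" "f \<in> jacobi_sobolev \<alpha> \<beta> p \<gamma>" using assms by (auto simp: jacobi_sobolev_union_def)
  then have "\<exists>g. is_jacobi_frac_deriv \<alpha> \<beta> \<gamma> f g" using sobolev_has_frac_deriv by blast
  then show ?thesis unfolding jacobi_frac_deriv_def by (rule someI_ex)
qed

lemma frac_deriv_operator_coefs:
  assumes "f \<in> jacobi_sobolev_union \<alpha> \<beta> \<gamma>"
  obtains s where "1 < s" "jacobi_frac_deriv \<alpha> \<beta> \<gamma> f \<in> Lp_space \<mu> s" "has_frac_deriv_coefs f (jacobi_frac_deriv \<alpha> \<beta> \<gamma> f)"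
  using is_frac_deriv_coefs[OF is_jacobi_frac_deriv_operator[OF assms]] by blast

lemma sobolev_subset_union: "1 < p \<Longrightarrow> jacobi_sobolev \<alpha> \<beta> p \<gamma> \<subseteq> jacobi_sobolev_union \<alpha> \<beta> \<gamma>"
  by (auto simp: jacobi_sobolev_union_def)

lemma frac_deriv_operator_limit:
  assumes p: "1 < p" and P: "\<And>k. real_polynomial_function (P k)" and lim: "jacobi_sobolev_tendsto \<alpha> \<beta> p \<gamma> P f"
  shows "Lp_tendsto \<mu> p (\<lambda>k. jacobi_frac_deriv_poly \<alpha> \<beta> \<gamma> (P k)) (jacobi_frac_deriv \<alpha> \<beta> \<gamma> f)"
proof -
  obtain g where g: "Lp_tendsto \<mu> p (\<lambda>k. jacobi_frac_deriv_poly \<alpha> \<beta> \<gamma> (P k)) g" "has_frac_deriv_coefs f g"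
    using frac_deriv_limit[OF p P lim] by blast
  have "f \<in> jacobi_sobolev_union \<alpha> \<beta> \<gamma>"
    using lim sobolev_subset_union[OF p] by (auto simp: jacobi_sobolev_tendsto_def)
  then obtain s where s: "1 < s" "jacobi_frac_deriv \<alpha> \<beta> \<gamma> f \<in> Lp_space \<mu> s" "has_frac_deriv_coefs f (jacobi_frac_deriv \<alpha> \<beta> \<gamma> f)"
    using frac_deriv_operator_coefs by blast
  have "AE x in \<mu>. g x = jacobi_frac_deriv \<alpha> \<beta> \<gamma> f x"
    using has_frac_deriv_coefs_unique[OF p s(1) _ s(2) g(2) s(3)] g(1) by (simp add: Lp_tendsto_def)
  then show ?thesis
    using s(2) by (intro Lp_tendsto_cong_AE[OF g(1)]) (auto simp: Lp_space_def)
qed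

text \<open>
  For the converse, the bounded multiplier \<open>bessel_inv_weight \<kappa> / deriv_weight \<kappa>\<close>, applied to the derivative, gives
  an \<open>L\<^sup>p\<close> function with the required coefficients except at \<open>\<kappa> = 0\<close>, and adding the mean of \<open>f\<close> corrects that
  one. Its Bessel potential has the coefficients of \<open>f\<close>, so it equals \<open>f\<close> almost everywhere.
\<close>

lemma sobolev_mem_iff_frac_deriv_Lp:
  assumes p: "1 < p" and f: "f \<in> jacobi_sobolev_union \<alpha> \<beta> \<gamma>"
  shows "f \<in> jacobi_sobolev \<alpha> \<beta> p \<gamma> \<longleftrightarrow> jacobi_frac_deriv \<alpha> \<beta> \<gamma> f \<in> Lp_space \<mu> p"
proof -
  let ?g = "jacobi_frac_deriv \<alpha> \<beta> \<gamma> f"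
  obtain s where s: "1 < s" "?g \<in> Lp_space \<mu> s" "has_frac_deriv_coefs f ?g"
    using frac_deriv_operator_coefs[OF f] by blast
  show ?thesis
  proof
    assume "f \<in> jacobi_sobolev \<alpha> \<beta> p \<gamma>"
    then obtain h where h: "is_jacobi_frac_deriv \<alpha> \<beta> \<gamma> f h" "h \<in> Lp_space \<mu> p"
      using sobolev_has_frac_deriv[OF p] by blast
    have "AE x in \<mu>. h x = ?g x"
      using has_frac_deriv_coefs_unique[OF p s(1) h(2) s(2) _ s(3)] is_frac_deriv_coefs[OF h(1)] by auto
    then show "?g \<in> Lp_space \<mu> p"
      using s(2) by (intro Lp_space_cong_AE[OF h(2)]) (auto simp: Lp_space_def)
  next
    assume g: "?g \<in> Lp_space \<mu> p"
    obtain q w0 where q: "1 < q" "bessel_preimage q f w0"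
      using f sobolev_iff by (auto simp: jacobi_sobolev_union_def)
    have fq: "f \<in> Lp_space \<mu> q" using q(2) by (simp add: bessel_preimage_def)
    obtain C where C: "multiplier_bounded p (\<lambda>\<kappa>. if \<kappa> = 0 then 0 else bessel_inv_weight \<kappa> / deriv_weight \<kappa>) C"
      using bessel_over_deriv_bounded[OF p] by blast
    obtain v where v: "v \<in> Lp_space \<mu> p"
      "\<And>\<kappa>. coef v \<kappa> = (if \<kappa> = 0 then 0 else bessel_inv_weight \<kappa> / deriv_weight \<kappa>) * coef ?g \<kappa>"
      using multiplier_extend[OF p C g] by auto
    define w where "w x = v x - (- coef f 0)" for x
    have w: "w \<in> Lp_space \<mu> p" unfolding w_def[abs_def] using p by (intro Lp_space_diff v Lp_space_const) auto
    have cw: "coef w \<kappa> = bessel_inv_weight \<kappa> * coef f \<kappa>" for \<kappa>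
    proof -
      have "coef w \<kappa> = coef v \<kappa> - coef (\<lambda>_. - coef f 0) \<kappa>"
        unfolding w_def[abs_def] using p by (intro coef_diff_Lp[OF p v(1)] Lp_space_const) auto
      moreover have "deriv_weight \<kappa> \<noteq> 0" if "\<kappa> \<noteq> 0"
        using eigenvalue_ge_1[OF that] by (simp add: deriv_weight_def)
      ultimately show ?thesis
        using s(3) by (auto simp: v(2) coef_const weight_0 has_frac_deriv_coefs_def)
    qed
    obtain C' where C': "multiplier_bounded p (\<lambda>\<kappa>. inverse (bessel_inv_weight \<kappa>)) C'" using bessel_bounded[OF p] by blast
    obtain f' where f': "f' \<in> Lp_space \<mu> p" "\<And>\<kappa>. coef f' \<kappa> = inverse (bessel_inv_weight \<kappa>) * coef w \<kappa>"
      using multiplier_extend[OF p C' w] by auto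
    have "coef f' \<kappa> = coef f \<kappa>" for \<kappa>
      using bessel_inv_weight_pos[of \<kappa>] by (simp add: f'(2) cw)
    then have "AE x in \<mu>. f' x = f x" by (rule coef_eq_imp_AE_eq[OF p q(1) f'(1) fq])
    then have "f \<in> Lp_space \<mu> p" using fq by (intro Lp_space_cong_AE[OF f'(1)]) (auto simp: Lp_space_def)
    then have "bessel_preimage p f w" using w cw by (simp add: bessel_preimage_def)
    then show "f \<in> jacobi_sobolev \<alpha> \<beta> p \<gamma>" using sobolev_iff[OF p] by blast
  qed
qed

text \<open>
  Passing between \<open>D\<^sub>\<gamma> f\<close> and the preimage \<open>w\<close> of \<open>f\<close> is a bounded multiplier in either direction; going
  back, the coefficient at \<open>\<kappa> = 0\<close> is lost, but it is the mean of \<open>f\<close>.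
\<close>

lemma frac_deriv_norm_equivalence:
  assumes p: "1 < p"
  shows "\<exists>A B. A > 0 \<and> B > 0 \<and> (\<forall>f \<in> jacobi_sobolev \<alpha> \<beta> p \<gamma>.
       Lp_norm \<mu> p (jacobi_frac_deriv \<alpha> \<beta> \<gamma> f) \<le> A * jacobi_sobolev_norm \<alpha> \<beta> p \<gamma> f \<and>
       ((\<integral>x. f x \<partial>\<mu>) = 0 \<longrightarrow>
         B * jacobi_sobolev_norm \<alpha> \<beta> p \<gamma> f \<le> Lp_norm \<mu> p (jacobi_frac_deriv \<alpha> \<beta> \<gamma> f)))"
proof -
  obtain C where C: "multiplier_bounded p (\<lambda>\<kappa>. deriv_weight \<kappa> / bessel_inv_weight \<kappa>) C"
    using deriv_over_bessel_bounded[OF p] by blast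
  obtain D where D: "multiplier_bounded p (\<lambda>\<kappa>. if \<kappa> = 0 then 0 else bessel_inv_weight \<kappa> / deriv_weight \<kappa>) D"
    using bessel_over_deriv_bounded[OF p] by blast
  have C0: "0 \<le> C" and D0: "0 \<le> D" using C D by (auto simp: multiplier_bounded_def)
  have nz: "bessel_inv_weight \<kappa> \<noteq> 0" for \<kappa> using bessel_inv_weight_pos[of \<kappa>] by simp
  have main: "Lp_norm \<mu> p (jacobi_frac_deriv \<alpha> \<beta> \<gamma> f) \<le> (C + 1) * jacobi_sobolev_norm \<alpha> \<beta> p \<gamma> f \<and>
       ((\<integral>x. f x \<partial>\<mu>) = 0 \<longrightarrow>
         1 / (D + 1) * jacobi_sobolev_norm \<alpha> \<beta> p \<gamma> f \<le> Lp_norm \<mu> p (jacobi_frac_deriv \<alpha> \<beta> \<gamma> f))"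
    if f: "f \<in> jacobi_sobolev \<alpha> \<beta> p \<gamma>" for f
  proof -
    let ?g = "jacobi_frac_deriv \<alpha> \<beta> \<gamma> f"
    have fu: "f \<in> jacobi_sobolev_union \<alpha> \<beta> \<gamma>" using f sobolev_subset_union[OF p] by blast
    obtain s where s: "has_frac_deriv_coefs f ?g" using frac_deriv_operator_coefs[OF fu] by blast
    have g: "?g \<in> Lp_space \<mu> p" using sobolev_mem_iff_frac_deriv_Lp[OF p fu] f by blast
    obtain w where fw: "bessel_preimage p f w" using f sobolev_iff[OF p] by blast
    have w: "w \<in> Lp_space \<mu> p" "\<And>\<kappa>. coef w \<kappa> = bessel_inv_weight \<kappa> * coef f \<kappa>"
      using fw by (auto simp: bessel_preimage_def)
    have norm: "jacobi_sobolev_norm \<alpha> \<beta> p \<gamma> f = Lp_norm \<mu> p w" by (rule sobolev_norm_eq[OF p fw])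
    obtain h where h: "h \<in> Lp_space \<mu> p" "\<And>\<kappa>. coef h \<kappa> = deriv_weight \<kappa> / bessel_inv_weight \<kappa> * coef w \<kappa>"
      "Lp_norm \<mu> p h \<le> C * Lp_norm \<mu> p w"
      using multiplier_extend[OF p C w(1)] by auto
    have "AE x in \<mu>. h x = ?g x"
      using s nz by (intro coef_eq_imp_AE_eq[OF p p h(1) g]) (simp add: h(2) w(2) has_frac_deriv_coefs_def)
    then have "Lp_norm \<mu> p ?g = Lp_norm \<mu> p h"
      using h(1) g by (intro Lp_norm_cong_AE[symmetric]) (auto simp: Lp_space_def)
    then have upper: "Lp_norm \<mu> p ?g \<le> (C + 1) * Lp_norm \<mu> p w"
      using h(3) by (simp add: distrib_right add_increasing2)
    have lower: "1 / (D + 1) * Lp_norm \<mu> p w \<le> Lp_norm \<mu> p ?g" if mean: "(\<integral>x. f x \<partial>\<mu>) = 0"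
    proof -
      obtain v where v: "v \<in> Lp_space \<mu> p"
        "\<And>\<kappa>. coef v \<kappa> = (if \<kappa> = 0 then 0 else bessel_inv_weight \<kappa> / deriv_weight \<kappa>) * coef ?g \<kappa>"
        "Lp_norm \<mu> p v \<le> D * Lp_norm \<mu> p ?g"
        using multiplier_extend[OF p D g] by auto
      have "coef v \<kappa> = coef w \<kappa>" for \<kappa>
      proof (cases "\<kappa> = 0")
        case True
        moreover have "coef f 0 = 0" using mean by (simp add: coef_0)
        ultimately show ?thesis unfolding v(2) w(2) by simp
      next
        case False
        then have "deriv_weight \<kappa> \<noteq> 0" using eigenvalue_ge_1[OF False] by (simp add: deriv_weight_def)
        then show ?thesis using s False by (simp add: v(2) w(2) has_frac_deriv_coefs_def)
      qed
      then have "AE x in \<mu>. v x = w x" by (rule coef_eq_imp_AE_eq[OF p p v(1) w(1)])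
      then have "Lp_norm \<mu> p w = Lp_norm \<mu> p v"
        using v(1) w(1) by (intro Lp_norm_cong_AE[symmetric]) (auto simp: Lp_space_def)
      then have "Lp_norm \<mu> p w \<le> (D + 1) * Lp_norm \<mu> p ?g"
        using v(3) by (simp add: distrib_right add_increasing2)
      then show ?thesis using D0 by (simp add: pos_divide_le_eq mult.commute)
    qed
    show ?thesis using upper lower unfolding norm by blast
  qed
  show ?thesis
    by (rule exI[of _ "C + 1"], rule exI[of _ "1 / (D + 1)"]) (use main C0 D0 in auto)
qed

end

theorem theorem3p6:
  fixes \<alpha> \<beta> :: "real^'n" and \<gamma> p q :: real
  assumes "\<And>i. \<alpha> $ i > -1/2" and "\<And>i. \<beta> $ i > -1/2"
    and "\<gamma> > 0" and "1 < p" and "1 < q"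
  shows
    "\<comment> \<open>(i): the limit exists\<close>
    (\<forall>f P. (\<forall>k. real_polynomial_function (P k)) \<and> jacobi_sobolev_tendsto \<alpha> \<beta> p \<gamma> P f \<longrightarrow>
       (\<exists>g. Lp_tendsto (jacobi_measure \<alpha> \<beta>) p (\<lambda>k. jacobi_frac_deriv_poly \<alpha> \<beta> \<gamma> (P k)) g)) \<and>
    \<comment> \<open>(i): independence of the sequence\<close>
    (\<forall>f P Q g h.
       (\<forall>k. real_polynomial_function (P k)) \<and> jacobi_sobolev_tendsto \<alpha> \<beta> p \<gamma> P f \<and>
       (\<forall>k. real_polynomial_function (Q k)) \<and> jacobi_sobolev_tendsto \<alpha> \<beta> p \<gamma> Q f \<and>
       Lp_tendsto (jacobi_measure \<alpha> \<beta>) p (\<lambda>k. jacobi_frac_deriv_poly \<alpha> \<beta> \<gamma> (P k)) g \<and>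
       Lp_tendsto (jacobi_measure \<alpha> \<beta>) p (\<lambda>k. jacobi_frac_deriv_poly \<alpha> \<beta> \<gamma> (Q k)) h
       \<longrightarrow> (AE x in jacobi_measure \<alpha> \<beta>. g x = h x)) \<and>
    \<comment> \<open>(i): independence of the exponent\<close>
    (\<forall>f \<in> jacobi_sobolev \<alpha> \<beta> p \<gamma> \<inter> jacobi_sobolev \<alpha> \<beta> q \<gamma>. \<forall>P Q g h.
       (\<forall>k. real_polynomial_function (P k)) \<and> jacobi_sobolev_tendsto \<alpha> \<beta> p \<gamma> P f \<and>
       (\<forall>k. real_polynomial_function (Q k)) \<and> jacobi_sobolev_tendsto \<alpha> \<beta> q \<gamma> Q f \<and>
       Lp_tendsto (jacobi_measure \<alpha> \<beta>) p (\<lambda>k. jacobi_frac_deriv_poly \<alpha> \<beta> \<gamma> (P k)) g \<and>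
       Lp_tendsto (jacobi_measure \<alpha> \<beta>) q (\<lambda>k. jacobi_frac_deriv_poly \<alpha> \<beta> \<gamma> (Q k)) h
       \<longrightarrow> (AE x in jacobi_measure \<alpha> \<beta>. g x = h x)) \<and>
    \<comment> \<open>(i): the operator is well defined on the union and given by the limit\<close>
    (\<forall>f \<in> jacobi_sobolev_union \<alpha> \<beta> \<gamma>.
       is_jacobi_frac_deriv \<alpha> \<beta> \<gamma> f (jacobi_frac_deriv \<alpha> \<beta> \<gamma> f) \<and>
       (\<forall>s P. 1 < s \<and> (\<forall>k. real_polynomial_function (P k)) \<and>
          jacobi_sobolev_tendsto \<alpha> \<beta> s \<gamma> P f \<longrightarrow>
          Lp_tendsto (jacobi_measure \<alpha> \<beta>) s (\<lambda>k. jacobi_frac_deriv_poly \<alpha> \<beta> \<gamma> (P k))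
            (jacobi_frac_deriv \<alpha> \<beta> \<gamma> f))) \<and>
    (\<forall>f \<in> jacobi_sobolev_union \<alpha> \<beta> \<gamma>. \<forall>f' \<in> jacobi_sobolev_union \<alpha> \<beta> \<gamma>.
       (AE x in jacobi_measure \<alpha> \<beta>. f x = f' x) \<longrightarrow>
       (AE x in jacobi_measure \<alpha> \<beta>. jacobi_frac_deriv \<alpha> \<beta> \<gamma> f x = jacobi_frac_deriv \<alpha> \<beta> \<gamma> f' x)) \<and>
    \<comment> \<open>(ii)\<close>
    (\<forall>f \<in> jacobi_sobolev_union \<alpha> \<beta> \<gamma>.
       f \<in> jacobi_sobolev \<alpha> \<beta> p \<gamma> \<longleftrightarrow>
       jacobi_frac_deriv \<alpha> \<beta> \<gamma> f \<in> Lp_space (jacobi_measure \<alpha> \<beta>) p) \<and>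
    \<comment> \<open>(ii): the lower bound needs mean zero, since the derivative annihilates constants\<close>
    (\<exists>A B. A > 0 \<and> B > 0 \<and> (\<forall>f \<in> jacobi_sobolev \<alpha> \<beta> p \<gamma>.
       Lp_norm (jacobi_measure \<alpha> \<beta>) p (jacobi_frac_deriv \<alpha> \<beta> \<gamma> f)
         \<le> A * jacobi_sobolev_norm \<alpha> \<beta> p \<gamma> f \<and>
       ((\<integral>x. f x \<partial>jacobi_measure \<alpha> \<beta>) = 0 \<longrightarrow>
         B * jacobi_sobolev_norm \<alpha> \<beta> p \<gamma> f
           \<le> Lp_norm (jacobi_measure \<alpha> \<beta>) p (jacobi_frac_deriv \<alpha> \<beta> \<gamma> f))))"
proof -
  interpret jacobi_sobolev_setting \<alpha> \<beta> \<gamma>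
    using assms(1-3) by unfold_locales
  note p = \<open>1 < p\<close> and q = \<open>1 < q\<close>
  have uniq: "AE x in jacobi_measure \<alpha> \<beta>. g x = h x"
    if "1 < s" "1 < t" "\<And>k. real_polynomial_function (P k)" "jacobi_sobolev_tendsto \<alpha> \<beta> s \<gamma> P f"
      "\<And>k. real_polynomial_function (Q k)" "jacobi_sobolev_tendsto \<alpha> \<beta> t \<gamma> Q f"
      "Lp_tendsto \<mu> s (\<lambda>k. jacobi_frac_deriv_poly \<alpha> \<beta> \<gamma> (P k)) g"
      "Lp_tendsto \<mu> t (\<lambda>k. jacobi_frac_deriv_poly \<alpha> \<beta> \<gamma> (Q k)) h" for s t f P Q g h
    using has_frac_deriv_coefs_unique[OF that(1,2) _ _ frac_deriv_coefs[OF that(1,3,4,7)] frac_deriv_coefs[OF that(2,5,6,8)]]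
      that(7,8) by (simp add: Lp_tendsto_def)
  have cong: "AE x in \<mu>. jacobi_frac_deriv \<alpha> \<beta> \<gamma> f x = jacobi_frac_deriv \<alpha> \<beta> \<gamma> f' x"
    if f: "f \<in> jacobi_sobolev_union \<alpha> \<beta> \<gamma>" and f': "f' \<in> jacobi_sobolev_union \<alpha> \<beta> \<gamma>"
      and eq: "AE x in \<mu>. f x = f' x" for f f'
  proof -
    obtain s where s: "1 < s" "jacobi_frac_deriv \<alpha> \<beta> \<gamma> f \<in> Lp_space \<mu> s" "has_frac_deriv_coefs f (jacobi_frac_deriv \<alpha> \<beta> \<gamma> f)"
      using frac_deriv_operator_coefs[OF f] by blast
    obtain t where t: "1 < t" "jacobi_frac_deriv \<alpha> \<beta> \<gamma> f' \<in> Lp_space \<mu> t" "has_frac_deriv_coefs f' (jacobi_frac_deriv \<alpha> \<beta> \<gamma> f')"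
      using frac_deriv_operator_coefs[OF f'] by blast
    have "f \<in> borel_measurable \<mu>" "f' \<in> borel_measurable \<mu>"
      using f f' sobolev_iff by (auto simp: jacobi_sobolev_union_def bessel_preimage_def Lp_space_def)
    then have "coef f \<kappa> = coef f' \<kappa>" for \<kappa> using eq by (rule coef_cong_AE)
    then show ?thesis by (rule has_frac_deriv_coefs_unique[OF s(1) t(1) s(2) t(2) s(3) t(3)])
  qed
  show ?thesis
  proof (intro conjI)
    show "\<forall>f P. (\<forall>k. real_polynomial_function (P k)) \<and> jacobi_sobolev_tendsto \<alpha> \<beta> p \<gamma> P f \<longrightarrow>
       (\<exists>g. Lp_tendsto (jacobi_measure \<alpha> \<beta>) p (\<lambda>k. jacobi_frac_deriv_poly \<alpha> \<beta> \<gamma> (P k)) g)"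
      using frac_deriv_limit[OF p] by blast
  next
    show "\<forall>f \<in> jacobi_sobolev_union \<alpha> \<beta> \<gamma>.
       is_jacobi_frac_deriv \<alpha> \<beta> \<gamma> f (jacobi_frac_deriv \<alpha> \<beta> \<gamma> f) \<and>
       (\<forall>s P. 1 < s \<and> (\<forall>k. real_polynomial_function (P k)) \<and>
          jacobi_sobolev_tendsto \<alpha> \<beta> s \<gamma> P f \<longrightarrow>
          Lp_tendsto (jacobi_measure \<alpha> \<beta>) s (\<lambda>k. jacobi_frac_deriv_poly \<alpha> \<beta> \<gamma> (P k))
            (jacobi_frac_deriv \<alpha> \<beta> \<gamma> f))"
      using is_jacobi_frac_deriv_operator frac_deriv_operator_limit by blast
  next
    show "\<forall>f \<in> jacobi_sobolev_union \<alpha> \<beta> \<gamma>.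
       f \<in> jacobi_sobolev \<alpha> \<beta> p \<gamma> \<longleftrightarrow>
       jacobi_frac_deriv \<alpha> \<beta> \<gamma> f \<in> Lp_space (jacobi_measure \<alpha> \<beta>) p"
      using sobolev_mem_iff_frac_deriv_Lp[OF p] by blast
  next
    show "\<exists>A B. A > 0 \<and> B > 0 \<and> (\<forall>f \<in> jacobi_sobolev \<alpha> \<beta> p \<gamma>.
       Lp_norm (jacobi_measure \<alpha> \<beta>) p (jacobi_frac_deriv \<alpha> \<beta> \<gamma> f)
         \<le> A * jacobi_sobolev_norm \<alpha> \<beta> p \<gamma> f \<and>
       ((\<integral>x. f x \<partial>jacobi_measure \<alpha> \<beta>) = 0 \<longrightarrow>
         B * jacobi_sobolev_norm \<alpha> \<beta> p \<gamma> f
           \<le> Lp_norm (jacobi_measure \<alpha> \<beta>) p (jacobi_frac_deriv \<alpha> \<beta> \<gamma> f)))"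
      by (rule frac_deriv_norm_equivalence[OF p])
  qed (use uniq[OF p p] uniq[OF p q] cong in blast)+
qed

end
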